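(* In the asynchronous network model described in the context, for every constant $c$ there are procedures FindAny and FindAny-C, initiated by a node $x$ which receives the output, such that the following hold. If there is no edge leaving $T_x$, then $\mathrm{FindAny}(x)$ and $\mathrm{FindAny\text{-}C}(x)$ return $\emptyset$. Otherwise: (i) $\mathrm{FindAny}(x)$ returns an edge leaving $T_x$ with probability at least $1-n^{-c}$, and it uses expected time and expected number of messages $O(n)$; (ii) $\mathrm{FindAny\text{-}C}(x)$ returns an edge leaving $T_x$ with probability at least $1/16$, else it returns $\emptyset$, and it uses worst case time and number of messages $O(n)$.
   Context: A communications network is an undirected graph with $n$ nodes. Each node has a unique ID in $\{1,\dots,n^{a}\}$ for a constant $a$. Each node knows its own ID and the IDs of its neighbors, and has private random bits. The initiating node $x$ knows an error parameter $\epsilon(n)<1/(2n^c)$ such that $\epsilon(n)^{-1}$ is polynomial in $n$. A message consists of $O(\log n)$ bits and is passed along a single edge. The network is asynchronous: every message is eventually received, and a node acts only when it receives a message or its state otherwise changes. Time is measured in the standard way for asynchronous networks (each message delay counts as at most one unit). Each node may mark its incident edges. The network is properly marked: every edge is marked by both or neither of its endpoints. The marked edges form a forest, and $T_x$ denotes the maximal tree of marked edges containing node $x$. An edge leaving $T_x$ is an (unmarked) edge of the network with exactly one endpoint in $T_x$. *)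

theory Defs
  imports "HOL-Probability.Probability" "HOL-Library.Landau_Symbols"
begin

section \<open>Marked networks\<close>

text \<open>Nodes are identified with their unique IDs. The set \<open>marks N v\<close> consists of the
  edges marked by their endpoint \<open>v\<close>.\<close>

record network =
  nodes :: "nat set"
  edges :: "nat set set"
  marks :: "nat \<Rightarrow> nat set set"

definition network_size :: "network \<Rightarrow> nat" where
  "network_size N = card (nodes N)"

definition is_network :: "real \<Rightarrow> network \<Rightarrow> bool" where
  "is_network a N \<longleftrightarrow>
     finite (nodes N) \<and>
     (\<forall>v\<in>nodes N. 1 \<le> v \<and> real v \<le> real (network_size N) powr a) \<and>
     edges N \<subseteq> {{u, v} | u v. u \<in> nodes N \<and> v \<in> nodes N \<and> u \<noteq> v} \<and>
     (\<forall>v\<in>nodes N. marks N v \<subseteq> {e \<in> edges N. v \<in> e})"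

definition properly_marked :: "network \<Rightarrow> bool" where
  "properly_marked N \<longleftrightarrow>
     (\<forall>e\<in>edges N. (\<forall>v\<in>e. e \<in> marks N v) \<or> (\<forall>v\<in>e. e \<notin> marks N v))"

definition marked_edges :: "network \<Rightarrow> nat set set" where
  "marked_edges N = {e \<in> edges N. \<forall>v\<in>e. e \<in> marks N v}"

definition is_cycle :: "nat set set \<Rightarrow> nat list \<Rightarrow> bool" where
  "is_cycle F vs \<longleftrightarrow> 3 \<le> length vs \<and> distinct vs \<and>
     (\<forall>i<length vs. {vs ! i, vs ! (Suc i mod length vs)} \<in> F)"

definition is_forest :: "nat set set \<Rightarrow> bool" where
  "is_forest F \<longleftrightarrow> (\<nexists>vs. is_cycle F vs)"

text \<open>The node set of the maximal tree of marked edges containing \<open>x\<close>.\<close>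

definition tree_of :: "network \<Rightarrow> nat \<Rightarrow> nat set" where
  "tree_of N x = {v. (x, v) \<in> {(u, w). {u, w} \<in> marked_edges N}\<^sup>*}"

definition leaving_edges :: "network \<Rightarrow> nat \<Rightarrow> nat set set" where
  "leaving_edges N x = {e \<in> edges N - marked_edges N. card (e \<inter> tree_of N x) = 1}"


section \<open>Procedures\<close>

text \<open>The initial knowledge of a node. Only the initiator knows the error parameter, so
  \<open>known_error\<close> also tells a node whether it is the initiator. The number of nodes is not
  part of the knowledge of any node.\<close>

record local_input =
  own_id :: nat
  neighbour_ids :: "nat set"
  marked_neighbour_ids :: "nat set"
  known_error :: "real option"

definition local_input_of :: "network \<Rightarrow> nat \<Rightarrow> real \<Rightarrow> nat \<Rightarrow> local_input" where
  "local_input_of N x err v =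
     \<lparr>own_id = v,
      neighbour_ids = {u. {v, u} \<in> edges N},
      marked_neighbour_ids = {u. {v, u} \<in> marks N v},
      known_error = (if v = x then Some err else None)\<rparr>"

text \<open>The local state of a node is determined by its initial knowledge, its private random
  bits and its history, which is the list of the messages received so far (oldest first) with
  their senders. A procedure is therefore a function of these three.

  Whenever a node acts, it sends the listed messages (receiver, bits). The history then
  already includes the message just received; the initiator also acts at the start, with empty
  history. An output \<open>Some r\<close> means that the procedure returns \<open>r\<close>, where
  \<open>r = None\<close> stands for the result \<open>\<emptyset>\<close> and \<open>r = Some e\<close> for the edge \<open>e\<close>.\<close>

type_synonym random_bits = "nat \<Rightarrow> bool"
type_synonym history = "(nat \<times> bool list) list"

record procedure =
  sends :: "local_input \<Rightarrow> random_bits \<Rightarrow> history \<Rightarrow> (nat \<times> bool list) list"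
  outcome :: "local_input \<Rightarrow> random_bits \<Rightarrow> history \<Rightarrow> nat set option option"

text \<open>Each node has an infinite sequence of fair bits, all of them independent.\<close>

definition coins :: "network \<Rightarrow> (nat \<Rightarrow> random_bits) measure" where
  "coins N = (\<Pi>\<^sub>M v\<in>nodes N. \<Pi>\<^sub>M i\<in>(UNIV :: nat set). measure_pmf (bernoulli_pmf (1/2)))"


section \<open>Asynchronous executions\<close>

record message =
  source :: nat
  target :: nat
  content :: "bool list"
  sent_at :: real

text \<open>All messages sent so far are kept, and the set \<open>received\<close> contains the positions
  of those already received. The clock shows the time of the latest event; local computation
  takes no time.\<close>

record config =
  sent :: "message list"
  received :: "nat set"
  histories :: "nat \<Rightarrow> history"
  clock :: real

definition act ::
  "procedure \<Rightarrow> network \<Rightarrow> nat \<Rightarrow> real \<Rightarrow> (nat \<Rightarrow> random_bits) \<Rightarrow> nat \<Rightarrow> history \<Rightarrow> real \<Rightarrow> message list"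
  where
  "act P N x err \<omega> v h t =
     map (\<lambda>(u, bs). \<lparr>source = v, target = u, content = bs, sent_at = t\<rparr>)
       (sends P (local_input_of N x err v) (\<omega> v) h)"

definition initial ::
  "procedure \<Rightarrow> network \<Rightarrow> nat \<Rightarrow> real \<Rightarrow> (nat \<Rightarrow> random_bits) \<Rightarrow> config" where
  "initial P N x err \<omega> =
     \<lparr>sent = act P N x err \<omega> x [] 0, received = {}, histories = (\<lambda>_. []), clock = 0\<rparr>"

definition deliver ::
  "procedure \<Rightarrow> network \<Rightarrow> nat \<Rightarrow> real \<Rightarrow> (nat \<Rightarrow> random_bits) \<Rightarrow> nat \<times> real \<Rightarrow> config \<Rightarrow> config"
  where
  "deliver P N x err \<omega> = (\<lambda>(k, t) C.
     let m = sent C ! k;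
         v = target m;
         h = histories C v @ [(source m, content m)]
     in \<lparr>sent = sent C @ act P N x err \<omega> v h t,
         received = insert k (received C),
         histories = (histories C)(v := h),
         clock = t\<rparr>)"

definition deliverable :: "config \<Rightarrow> nat \<times> real \<Rightarrow> bool" where
  "deliverable C = (\<lambda>(k, t).
     k < length (sent C) \<and> k \<notin> received C \<and> clock C \<le> t \<and> t \<le> sent_at (sent C ! k) + 1)"

definition quiescent :: "config \<Rightarrow> bool" where
  "quiescent C \<longleftrightarrow> (\<forall>k<length (sent C). k \<in> received C)"

text \<open>An execution is an infinite sequence of configurations in which every message is
  eventually received. After the last event, if there is one, the sequence is constant.
  Messages may overtake each other.\<close>

definition is_execution ::
  "procedure \<Rightarrow> network \<Rightarrow> nat \<Rightarrow> real \<Rightarrow> (nat \<Rightarrow> random_bits) \<Rightarrow> (nat \<Rightarrow> config) \<Rightarrow> bool" where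
  "is_execution P N x err \<omega> \<rho> \<longleftrightarrow>
     \<rho> 0 = initial P N x err \<omega> \<and>
     (\<forall>i. if quiescent (\<rho> i) then \<rho> (Suc i) = \<rho> i
          else \<exists>d. deliverable (\<rho> i) d \<and> \<rho> (Suc i) = deliver P N x err \<omega> d (\<rho> i)) \<and>
     (\<forall>i. \<forall>k<length (sent (\<rho> i)). \<exists>j. k \<in> received (\<rho> j))"

text \<open>The first output of the initiator counts, so that a result cannot be revoked.\<close>

definition output_at ::
  "procedure \<Rightarrow> network \<Rightarrow> nat \<Rightarrow> real \<Rightarrow> (nat \<Rightarrow> random_bits) \<Rightarrow> config \<Rightarrow> nat set option option"
  where
  "output_at P N x err \<omega> C = outcome P (local_input_of N x err x) (\<omega> x) (histories C x)"

definition returns ::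
  "procedure \<Rightarrow> network \<Rightarrow> nat \<Rightarrow> real \<Rightarrow> (nat \<Rightarrow> random_bits) \<Rightarrow> (nat \<Rightarrow> config) \<Rightarrow> nat set option \<Rightarrow> bool"
  where
  "returns P N x err \<omega> \<rho> r \<longleftrightarrow>
     (\<exists>i. output_at P N x err \<omega> (\<rho> i) = Some r \<and>
          (\<forall>j<i. output_at P N x err \<omega> (\<rho> j) = None))"

definition message_count :: "(nat \<Rightarrow> config) \<Rightarrow> ennreal" where
  "message_count \<rho> = (SUP i. of_nat (length (sent (\<rho> i))))"

text \<open>The time of the last event anywhere in the network, not just of the output.\<close>

definition running_time :: "(nat \<Rightarrow> config) \<Rightarrow> ennreal" where
  "running_time \<rho> = (SUP i. ennreal (clock (\<rho> i)))"

definition messages_legal :: "network \<Rightarrow> real \<Rightarrow> (nat \<Rightarrow> config) \<Rightarrow> bool" where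
  "messages_legal N b \<rho> \<longleftrightarrow>
     (\<forall>i. \<forall>m\<in>set (sent (\<rho> i)). {source m, target m} \<in> edges N \<and> real (length (content m)) \<le> b)"


section \<open>Schedulers\<close>

text \<open>Probabilities and expectations are taken against an adaptive scheduler. It chooses the
  next message to be received and the time of this event, knowing all configurations so far
  (including message contents), but neither the private random bits nor the future.\<close>

type_synonym scheduler = "config list \<Rightarrow> nat \<times> real"

primrec trace ::
  "procedure \<Rightarrow> network \<Rightarrow> nat \<Rightarrow> real \<Rightarrow> scheduler \<Rightarrow> (nat \<Rightarrow> random_bits) \<Rightarrow> nat \<Rightarrow> config list" where
  "trace P N x err \<sigma> \<omega> 0 = [initial P N x err \<omega>]"
| "trace P N x err \<sigma> \<omega> (Suc i) =
     (let Cs = trace P N x err \<sigma> \<omega> i; C = last Cs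
      in Cs @ [if quiescent C then C else deliver P N x err \<omega> (\<sigma> Cs) C])"

definition run ::
  "procedure \<Rightarrow> network \<Rightarrow> nat \<Rightarrow> real \<Rightarrow> scheduler \<Rightarrow> (nat \<Rightarrow> random_bits) \<Rightarrow> nat \<Rightarrow> config" where
  "run P N x err \<sigma> \<omega> i = last (trace P N x err \<sigma> \<omega> i)"

definition is_scheduler :: "procedure \<Rightarrow> network \<Rightarrow> nat \<Rightarrow> real \<Rightarrow> scheduler \<Rightarrow> bool" where
  "is_scheduler P N x err \<sigma> \<longleftrightarrow>
     (\<forall>\<omega>\<in>space (coins N). is_execution P N x err \<omega> (run P N x err \<sigma> \<omega>))"

text \<open>Measurability is demanded explicitly, since the nonnegative integral of a
  non-measurable function is only a lower integral.\<close>

definition expectation_le ::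
  "network \<Rightarrow> ((nat \<Rightarrow> random_bits) \<Rightarrow> ennreal) \<Rightarrow> real \<Rightarrow> bool" where
  "expectation_le N X b \<longleftrightarrow>
     X \<in> borel_measurable (coins N) \<and> (\<integral>\<^sup>+\<omega>. X \<omega> \<partial>coins N) \<le> ennreal b"

definition return_leaving_prob ::
  "procedure \<Rightarrow> network \<Rightarrow> nat \<Rightarrow> real \<Rightarrow> scheduler \<Rightarrow> real" where
  "return_leaving_prob P N x err \<sigma> =
     measure (coins N) {\<omega> \<in> space (coins N).
       \<exists>e\<in>leaving_edges N x. returns P N x err \<omega> (run P N x err \<sigma> \<omega>) (Some e)}"

end

theory Submission
  imports Defs
begin

text \<open>
  Both procedures repeat one Monte Carlo attempt, which consists of four rounds of broadcast and
  echo on the marked tree. In each round every node answers a query about its incident edges by a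
  bit list, and the answers are combined by exclusive or on the way to the initiator; edges inside
  the tree are counted twice and cancel. The attempt draws a pairwise independent hash function,
  learns for each \<open>j\<close> the parity of the number of leaving edges with hash value below \<open>2 ^ j\<close>,
  asks for the exclusive or of the codes of the edges below the smallest odd level, and finally tests
  the resulting candidate. If some level contains exactly one leaving edge, then the candidate is that
  edge; this happens with probability at least 3/16. The test makes wrong answers impossible.

  FindAny-C makes one attempt. FindAny stops at the first success or after \<open>k\<close> attempts, where
  \<open>(13/16) ^ k \<le> \<epsilon>(n)\<close>, and so makes fewer than six attempts in expectation if a leaving edge exists.

  Since every delivery advances the clock by at most one, the running time never exceeds the number
  of messages.
\<close>


section \<open>Exclusive or of bit lists\<close>

text \<open>The scheduler sees every message and may reorder them, so independence cannot be argued
  along a run. Instead, the result, the number of rounds and the bound on messages are shown to be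
  functions of the initiator's coins alone: one invariant determines all messages in transit from a
  round number and two sets of nodes. Success probabilities then reduce to counting blocks of coins.
  No node knows the size of the network, so field widths must be learnt and then travel as message
  lengths. Exclusive or keeps the longer length, hence the unary answers of the first round combine
  to the maximal ID width \<open>l\<close>. An edge code has \<open>2 * l\<close> bits, and the hash
  \<open>s * y + t\<close> is taken modulo \<open>2 ^ (4 * l)\<close>. A power of two makes uniform
  seeds plain bit strings; the price is that \<open>s * (y' - y)\<close> is uniform only on the
  multiples of the power of two dividing \<open>y' - y\<close>. Doubling the width leaves enough
  thresholds that are themselves such multiples. The constant 3/16 is the least value of
  \<open>\<mu> - \<mu> * \<mu>\<close> for a mean \<open>\<mu>\<close> between 1/4 and 1/2.\<close>

fun xorl :: "bool list \<Rightarrow> bool list \<Rightarrow> bool list" where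
  "xorl [] ys = ys"
| "xorl (x # xs) [] = x # xs"
| "xorl (x # xs) (y # ys) = (x \<noteq> y) # xorl xs ys"

text \<open>Reading False past the end matches the padding done by \<open>xorl\<close>, so that
  exclusive or becomes pointwise although lengths differ.\<close>

definition bit_at :: "bool list \<Rightarrow> nat \<Rightarrow> bool" where
  "bit_at xs i \<longleftrightarrow> i < length xs \<and> xs ! i"

lemma length_xorl: "length (xorl xs ys) = max (length xs) (length ys)"
  by (induction xs ys rule: xorl.induct) auto

lemma bit_at_Cons: "bit_at (x # xs) i = (case i of 0 \<Rightarrow> x | Suc j \<Rightarrow> bit_at xs j)"
  by (auto simp: bit_at_def split: nat.split)

lemma bit_at_Nil [simp]: "\<not> bit_at [] i"
  by (simp add: bit_at_def)

lemma bit_at_xorl: "bit_at (xorl xs ys) i \<longleftrightarrow> bit_at xs i \<noteq> bit_at ys i"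
  by (induction xs ys arbitrary: i rule: xorl.induct) (auto simp: bit_at_Cons split: nat.split)

lemma bit_list_eqI:
  assumes "length xs = length ys" "\<And>i. bit_at xs i = bit_at ys i"
  shows "xs = ys"
  by (rule nth_equalityI) (use assms in \<open>auto simp: bit_at_def\<close>)

text \<open>Commutativity and associativity make the combined answer independent of the order in
  which echoes arrive. Lengths combine by maximum, so the unit is the empty list and not a list of
  zeros.\<close>

interpretation xorl: comm_monoid_set xorl "[]"
proof
  show "xorl (xorl xs ys) zs = xorl xs (xorl ys zs)" for xs ys zs
    by (rule bit_list_eqI) (auto simp: length_xorl bit_at_xorl)
  show "xorl xs ys = xorl ys xs" for xs ys
    by (rule bit_list_eqI) (auto simp: length_xorl bit_at_xorl)
  show "xorl xs [] = xs" for xs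
    by (cases xs) auto
qed

lemma less_length_xorl_F:
  "finite A \<Longrightarrow> j < length (xorl.F f A) \<longleftrightarrow> (\<exists>v\<in>A. j < length (f v))"
  by (induction A rule: finite_induct) (auto simp: length_xorl less_max_iff_disj)

lemma length_xorl_F_le:
  "(\<And>v. v \<in> A \<Longrightarrow> length (f v) \<le> L) \<Longrightarrow> length (xorl.F f A) \<le> L"
  by (induction A rule: infinite_finite_induct) (auto simp: length_xorl)

lemma bit_at_xorl_F:
  "finite A \<Longrightarrow> bit_at (xorl.F f A) j \<longleftrightarrow> odd (card {v\<in>A. bit_at (f v) j})"
proof (induction A rule: finite_induct)
  case (insert a A)
  have "{v\<in>insert a A. bit_at (f v) j} =
      (if bit_at (f a) j then insert a {v\<in>A. bit_at (f v) j} else {v\<in>A. bit_at (f v) j})"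
    by auto
  with insert show ?case
    by (auto simp: bit_at_xorl)
qed auto


section \<open>Rooted trees\<close>

text \<open>Parent pointers replace the graph view because the node programs talk only to the parent
  or to children. The depth \<open>dep\<close> is a measure: it excludes cycles of pointers and
  drives the inductions in both directions.\<close>

locale rooted_tree =
  fixes T :: "nat set" and x :: nat and nb :: "nat \<Rightarrow> nat set"
    and par :: "nat \<Rightarrow> nat" and dep :: "nat \<Rightarrow> nat"
  assumes finite_T: "finite T"
    and root: "x \<in> T"

    and par: "v \<in> T \<Longrightarrow> v \<noteq> x \<Longrightarrow> par v \<in> T \<and> v \<in> nb (par v) \<and> par v \<in> nb v \<and> dep v = Suc (dep (par v))"
    and nb: "v \<in> T \<Longrightarrow> u \<in> nb v \<Longrightarrow> u \<in> T \<and> (u \<noteq> x \<and> par u = v \<or> v \<noteq> x \<and> par v = u)"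
begin

definition V :: "nat set" where "V = T - {x}"

definition ch :: "nat \<Rightarrow> nat set" where "ch v = {u \<in> V. par u = v}"

lemma finite_V: "finite V" and finite_ch: "finite (ch v)"
  using finite_T by (auto simp: V_def ch_def)

lemma V_T: "v \<in> V \<Longrightarrow> v \<in> T" and V_x: "v \<in> V \<Longrightarrow> v \<noteq> x" and x_V [simp]: "x \<notin> V"
  by (auto simp: V_def)

lemma par_T: "v \<in> V \<Longrightarrow> par v \<in> T"
  using par by (auto simp: V_def)

lemma par_cases: "v \<in> V \<Longrightarrow> par v = x \<or> par v \<in> V"
  using par_T by (auto simp: V_def)

lemma dep_par: "v \<in> V \<Longrightarrow> dep v = Suc (dep (par v))"
  using par by (auto simp: V_def)

lemma par_par: "v \<in> V \<Longrightarrow> par v \<in> V \<Longrightarrow> par (par v) \<noteq> v"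
  by (metis dep_par less_Suc_eq not_less_eq less_not_refl)

lemma par_not_ch: "v \<in> V \<Longrightarrow> par v \<notin> ch v"
  using par_par[of v] by (auto simp: ch_def)

lemma nb_root: "nb x = ch x"
  using nb[OF root] par by (auto simp: ch_def V_def)

lemma nb_V: "v \<in> V \<Longrightarrow> nb v - {par v} = ch v"
proof -
  assume v: "v \<in> V"
  have "u \<in> ch v" if "u \<in> nb v" "u \<noteq> par v" for u
    using nb[OF V_T[OF v] that(1)] that by (auto simp: ch_def V_def)
  moreover have "u \<in> nb v" if "u \<in> ch v" for u
    using par[of u] that by (auto simp: ch_def V_def)
  ultimately show ?thesis
    using par_not_ch[OF v] by auto
qed

lemma par_neq: "v \<in> V \<Longrightarrow> par v \<noteq> v"
  using dep_par[of v] by auto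

lemma tree_induct [consumes 1, case_names step]:
  assumes "v \<in> V" "\<And>v. v \<in> V \<Longrightarrow> (par v \<in> V \<Longrightarrow> P (par v)) \<Longrightarrow> P v"
  shows "P v"
  using assms(1)
proof (induction "dep v" arbitrary: v)
  case 0
  then show ?case using dep_par by simp
next
  case (Suc d)
  then show ?case
    using assms(2)[OF Suc.prems] dep_par[OF Suc.prems] by auto
qed

text \<open>Induction from the leaves towards the root, well-founded because the depths in a finite
  tree are bounded. It follows the echoes, as \<open>tree_induct\<close> follows the
  broadcast.\<close>

lemma tree_coinduct [consumes 1, case_names step]:
  assumes "v \<in> V" "\<And>v. v \<in> V \<Longrightarrow> (\<And>u. u \<in> ch v \<Longrightarrow> P u) \<Longrightarrow> P v"
  shows "P v"
proof -
  define D where "D = Max (dep ` V)"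
  have D: "dep v \<le> D" if "v \<in> V" for v
    unfolding D_def using finite_V that by auto
  show ?thesis using assms(1)
  proof (induction "D - dep v" arbitrary: v rule: less_induct)
    case less
    have "P u" if "u \<in> ch v" for u
      using that less dep_par[of u] D[of u] by (auto simp: ch_def)
    then show ?case using assms(2) less by auto
  qed
qed

text \<open>The relation points from child to parent, so these are the descendants of
  \<open>v\<close>, with \<open>v\<close> itself included.\<close>

definition sub :: "nat \<Rightarrow> nat set" where
  "sub v = {u. (u, v) \<in> {(w, par w) | w. w \<in> V}\<^sup>*}"

lemma sub_eq: "sub v = insert v (\<Union>c\<in>ch v. sub c)"
proof -
  have "(u, v) \<in> {(w, par w) | w. w \<in> V}\<^sup>* \<longleftrightarrow>
      u = v \<or> (\<exists>c\<in>ch v. (u, c) \<in> {(w, par w) | w. w \<in> V}\<^sup>*)" for u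
    by (subst rtrancl.simps) (auto simp: ch_def)
  then show ?thesis
    by (auto simp: sub_def)
qed

lemma sub_dep: "u \<in> sub v \<Longrightarrow> u = v \<or> dep v < dep u"
  unfolding sub_def mem_Collect_eq
  by (induction rule: rtrancl_induct) (auto dest: dep_par)

text \<open>The parent relation is single valued, so two ancestors of one node are comparable.
  Siblings have equal depth and hence are not.\<close>

lemma sub_disjoint:
  assumes "c \<in> ch v" "c' \<in> ch v" "c \<noteq> c'"
  shows "sub c \<inter> sub c' = {}"
proof -
  let ?R = "{(w, par w) | w. w \<in> V}"
  have d: "dep c = dep c'"
    using assms dep_par[of c] dep_par[of c'] by (auto simp: ch_def)
  have sv: "single_valued ?R"
    by (auto simp: single_valued_def)
  have "False" if "u \<in> sub c" "u \<in> sub c'" for u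
  proof -
    have "(c, c') \<in> ?R\<^sup>* \<or> (c', c) \<in> ?R\<^sup>*"
      using single_valued_confluent[OF sv] that by (auto simp: sub_def)
    then have "c \<in> sub c' \<or> c' \<in> sub c"
      by (auto simp: sub_def)
    then show False
      using sub_dep[of c c'] sub_dep[of c' c] d assms by auto
  qed
  then show ?thesis by auto
qed

lemma sub_T: "v \<in> T \<Longrightarrow> sub v \<subseteq> T"
proof
  fix u assume "v \<in> T" "u \<in> sub v"
  then show "u \<in> T"
    unfolding sub_def by (auto elim!: converse_rtranclE simp: V_def)
qed

lemma sub_root: "sub x = T"
proof
  show "T \<subseteq> sub x"
  proof
    fix v assume "v \<in> T"
    show "v \<in> sub x"
    proof (cases "v = x")
      case False
      with \<open>v \<in> T\<close> have "v \<in> V" by (auto simp: V_def)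
      then show ?thesis
      proof (induction v rule: tree_induct)
        case (step v)
        then have "par v \<in> sub x"
          using par_cases by (auto simp: sub_def)
        with step.hyps show ?case
          by (auto simp: sub_def intro: converse_rtrancl_into_rtrancl)
      qed
    qed (simp add: sub_def)
  qed
qed (use sub_T root in auto)

definition agg :: "(nat \<Rightarrow> bool list) \<Rightarrow> nat \<Rightarrow> bool list" where
  "agg f v = xorl.F f (sub v)"

lemma agg_root: "agg f x = xorl.F f T"
  by (simp add: agg_def sub_root)

text \<open>This recursion is the local step of the echo: the own answer combined with what the
  children report.\<close>

lemma agg_eq:
  assumes "v \<in> T"
  shows "agg f v = xorl (f v) (xorl.F (agg f) (ch v))"
proof -
  have ch_T: "c \<in> T" if "c \<in> ch v" for c
    using that by (auto simp: ch_def V_def)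
  have fin: "finite (sub c)" if "c \<in> ch v" for c
    using sub_T[OF ch_T[OF that]] finite_T finite_subset by blast
  have nin: "v \<notin> (\<Union>c\<in>ch v. sub c)"
    using sub_dep dep_par by (fastforce simp: ch_def)
  have "agg f v = xorl.F f (insert v (\<Union>c\<in>ch v. sub c))"
    unfolding agg_def by (subst sub_eq) simp
  also have "\<dots> = xorl (f v) (xorl.F f (\<Union>c\<in>ch v. sub c))"
    using nin fin finite_ch by (subst xorl.insert) auto
  also have "xorl.F f (\<Union>c\<in>ch v. sub c) = xorl.F (agg f) (ch v)"
    unfolding agg_def using fin finite_ch sub_disjoint
    by (subst xorl.UNION_disjoint) auto
  finally show ?thesis .
qed

lemma length_agg_le: "(\<And>v. v \<in> T \<Longrightarrow> length (f v) \<le> L) \<Longrightarrow> v \<in> T \<Longrightarrow> length (agg f v) \<le> L"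
  unfolding agg_def using sub_T by (intro length_xorl_F_le) auto

end


section \<open>The marked tree is a rooted tree\<close>

definition walk :: "nat set set \<Rightarrow> nat list \<Rightarrow> bool" where
  "walk F = successively (\<lambda>u v. {u, v} \<in> F)"

lemma walk_rev: "walk F (rev xs) = walk F xs"
  by (simp add: walk_def insert_commute)

lemma walk_append:
  "walk F (xs @ ys) \<longleftrightarrow> walk F xs \<and> walk F ys \<and> (xs = [] \<or> ys = [] \<or> {last xs, hd ys} \<in> F)"
  by (simp add: walk_def successively_append_iff)

lemma walk_Cons: "walk F (y # ys) \<longleftrightarrow> ys = [] \<or> {y, hd ys} \<in> F \<and> walk F ys"
  by (simp add: walk_def successively_Cons)

lemma walk_pair: "walk F [u, v] \<Longrightarrow> {v, u} \<in> F"
  by (simp add: walk_def insert_commute)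

lemma closed_walk_is_cycle:
  assumes w: "walk F vs" and l: "3 \<le> length vs" and d: "distinct vs" and c: "{last vs, hd vs} \<in> F"
  shows "is_cycle F vs"
  unfolding is_cycle_def
proof (intro conjI allI impI l d)
  fix i assume i: "i < length vs"
  show "{vs ! i, vs ! (Suc i mod length vs)} \<in> F"
  proof (cases "Suc i < length vs")
    case True
    then show ?thesis
      using w by (auto simp: walk_def successively_conv_nth)
  next
    case False
    then have "i = length vs - 1" using i by simp
    moreover have "vs \<noteq> []" using i by auto
    ultimately show ?thesis using c i by (simp add: last_conv_nth hd_conv_nth)
  qed
qed

text \<open>Induction on the first path from its far end. Equal vertices before \<open>v\<close> are
  stripped; different ones lead to a cycle through \<open>v\<close>.\<close>

lemma forest_unique_path:
  assumes F: "is_forest F"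
    and "walk F (x # p @ [v])" "distinct (x # p @ [v])"
    and "walk F (x # q @ [v])" "distinct (x # q @ [v])"
  shows "p = q"
  using assms(2-)
proof (induction p arbitrary: q v rule: rev_induct)
  case Nil
  show ?case
  proof (rule ccontr)
    assume "[] \<noteq> q"
    moreover have "{v, x} \<in> F"
      using Nil(1) walk_pair by simp
    moreover have "3 \<le> length (x # q @ [v])"
      using \<open>[] \<noteq> q\<close> by (cases q) simp_all
    ultimately have "is_cycle F (x # q @ [v])"
      using Nil(3,4) closed_walk_is_cycle[of F "x # q @ [v]"] by simp
    then show False using F by (auto simp: is_forest_def)
  qed
next
  case (snoc a p)
  show ?case
  proof (cases q rule: rev_cases)
    case Nil
    moreover from this have "{v, x} \<in> F"
      using snoc.prems(3) walk_pair by simp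
    ultimately have "is_cycle F (x # (p @ [a]) @ [v])"
      using snoc.prems(1,2) closed_walk_is_cycle[of F "x # (p @ [a]) @ [v]"] by simp
    then show ?thesis using F by (auto simp: is_forest_def)
  next
    case (snoc q' b)
    note q = this
    show ?thesis
    proof (cases "a = b")
      case True
      have "walk F ((x # p @ [b]) @ [v])" "walk F ((x # q' @ [b]) @ [v])"
        using snoc.prems by (simp_all add: q True)
      then have "p = q'"
        using snoc.prems unfolding q True walk_append by (intro snoc.IH[of b]) auto
      then show ?thesis using q True by simp
    next
      case False
      define P where "P = x # p @ [a]"
      define Q where "Q = x # q' @ [b]"
      have "walk F (P @ [v])" "walk F (Q @ [v])" "distinct (P @ [v])" "distinct (Q @ [v])"
        using snoc.prems by (auto simp: P_def Q_def q)
      moreover have "last P = a" "last Q = b" "P \<noteq> []" "Q \<noteq> []"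
        by (auto simp: P_def Q_def)
      ultimately have wP: "walk F P" "distinct P" "{a, v} \<in> F" "v \<notin> set P"
        and wQ: "walk F Q" "distinct Q" "{b, v} \<in> F" "v \<notin> set Q"
        by (simp_all add: walk_append)
      have "\<exists>y\<in>set P. y \<in> set Q"
        by (auto simp: P_def Q_def)
      \<comment> \<open>The last vertex \<open>y\<close> of \<open>P\<close> that also lies on
        \<open>Q\<close> is where the paths part for good. Going from \<open>y\<close> along
        \<open>P2\<close> to \<open>v\<close> and back along \<open>Q2\<close> repeats no vertex,
        and it has at least three since \<open>P\<close> and \<open>Q\<close> end
        differently.\<close>
      then have "\<exists>P1 y P2. P = P1 @ y # P2 \<and> y \<in> set Q \<and> (\<forall>z\<in>set P2. z \<notin> set Q)"
        by (rule split_list_last_prop)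
      then obtain P1 y P2 where
        P: "P = P1 @ y # P2" and y: "y \<in> set Q" and P2: "\<forall>z\<in>set P2. z \<notin> set Q"
        by auto
      from y obtain Q1 Q2 where Q: "Q = Q1 @ y # Q2"
        by (auto dest: split_list)
      have lP: "last (y # P2) = a"
      proof -
        have "last P = a" by (simp add: P_def)
        then show ?thesis by (simp add: P)
      qed
      have lQ: "last (y # Q2) = b"
      proof -
        have "last Q = b" by (simp add: Q_def)
        then show ?thesis by (simp add: Q)
      qed
      let ?C = "(y # P2) @ [v] @ rev Q2"
      have "is_cycle F ?C"
      proof (rule closed_walk_is_cycle)
        have "walk F (y # P2)"
          using wP(1) unfolding P by (simp add: walk_append)
        moreover have "walk F (y # Q2)"
          using wQ(1) unfolding Q by (simp add: walk_append)
        then have "walk F Q2" by (auto simp: walk_Cons) (simp add: walk_def)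
        then have "walk F (rev Q2)" by (simp add: walk_rev)
        moreover have "rev Q2 = [] \<or> {v, hd (rev Q2)} \<in> F"
          using lQ wQ(3) by (auto simp: hd_rev insert_commute split: if_splits)
        ultimately show "walk F ?C"
          unfolding walk_append[of F "y # P2"] walk_append[of F "[v]"] using lP wP(3)
          by (simp add: walk_Cons[of F v] del: last.simps) (simp add: walk_def)
        have "P2 \<noteq> [] \<or> Q2 \<noteq> []"
          using lP lQ False by auto
        then show "3 \<le> length ?C"
          by (auto simp: Suc_le_eq)
        show "distinct ?C"
          using wP wQ P2 by (auto simp: P Q)
        show "{last ?C, hd ?C} \<in> F"
        proof (cases Q2)
          case Nil
          then show ?thesis using lQ wQ(3) by (simp add: insert_commute)
        next
          case (Cons z zs)
          have "walk F (y # Q2)"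
            using wQ(1) unfolding Q by (simp add: walk_append)
          then show ?thesis
            using Cons by (simp add: walk_Cons insert_commute)
        qed
      qed
      then show ?thesis using F by (auto simp: is_forest_def)
    qed
  qed
qed

lemma forest_path_eq:
  assumes F: "is_forest F" and "xs \<noteq> []" "ys \<noteq> []" "hd xs = hd ys" "last xs = last ys"
    and "walk F xs" "distinct xs" "walk F ys" "distinct ys"
  shows "xs = ys"
proof (cases "hd xs = last xs")
  case True
  have "zs = [hd zs]" if "zs \<noteq> []" "distinct zs" "hd zs = last zs" for zs :: "nat list"
    using that by (cases zs) (auto split: if_splits)
  from this[of xs] this[of ys] show ?thesis
    using assms True by simp
next
  case False
  have "\<exists>p. zs = hd zs # p @ [last zs]" if "zs \<noteq> []" "hd zs \<noteq> last zs" for zs :: "nat list"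
  proof -
    from that obtain y ys where "zs = y # ys" "ys \<noteq> []" by (cases zs) (auto split: if_splits)
    then show ?thesis by (intro exI[of _ "butlast ys"]) simp
  qed
  from this[of xs] this[of ys] obtain p q
    where "xs = hd xs # p @ [last xs]" "ys = hd ys # q @ [last ys]"
    using assms False by auto
  then obtain a b where eq: "xs = a # p @ [b]" "ys = a # q @ [b]"
    using assms by auto
  have "p = q"
    using assms(6-9) unfolding eq by (rule forest_unique_path[OF F])
  then show ?thesis
    by (simp add: eq)
qed

section \<open>Simple paths from a fixed vertex of a forest\<close>

definition simple_path :: "nat set set \<Rightarrow> nat \<Rightarrow> nat \<Rightarrow> nat list \<Rightarrow> bool" where
  "simple_path F x v xs \<longleftrightarrow> xs \<noteq> [] \<and> hd xs = x \<and> last xs = v \<and> walk F xs \<and> distinct xs"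

lemma simple_path_unique:
  "is_forest F \<Longrightarrow> simple_path F x v xs \<Longrightarrow> simple_path F x v ys \<Longrightarrow> xs = ys"
  using forest_path_eq[of F xs ys] by (simp add: simple_path_def)

lemma simple_path_snoc:
  "simple_path F x u xs \<Longrightarrow> {u, v} \<in> F \<Longrightarrow> v \<notin> set xs \<Longrightarrow> simple_path F x v (xs @ [v])"
  by (auto simp: simple_path_def walk_append walk_Cons)

lemma simple_path_prefix:
  "simple_path F x v (xs @ u # ys) \<Longrightarrow> simple_path F x u (xs @ [u])"
  by (auto simp: simple_path_def walk_append walk_Cons hd_append)

lemma simple_path_exists:
  assumes "(x, v) \<in> {(u, w). {u, w} \<in> F}\<^sup>*"
  shows "\<exists>xs. simple_path F x v xs"
  using assms
proof (induction rule: rtrancl_induct)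
  case base
  then show ?case by (intro exI[of _ "[x]"]) (simp add: simple_path_def walk_def)
next
  case (step u v)
  then obtain xs where xs: "simple_path F x u xs" by auto
  show ?case
  proof (cases "v \<in> set xs")
    case True
    then obtain A B where "xs = A @ v # B" by (auto dest: split_list)
    then show ?thesis using xs simple_path_prefix[of F x u A v B] by auto
  next
    case False
    then show ?thesis using simple_path_snoc[OF xs] step by auto
  qed
qed

lemma simple_path_reach:
  assumes "simple_path F x v xs"
  shows "(x, v) \<in> {(u, w). {u, w} \<in> F}\<^sup>*"
  using assms
proof (induction xs arbitrary: v rule: rev_induct)
  case (snoc w xs)
  show ?case
  proof (cases xs rule: rev_cases)
    case Nil
    then show ?thesis using snoc.prems by (auto simp: simple_path_def)
  next
    case (snoc ys u)
    have "simple_path F x u xs"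
      using simple_path_prefix[of F x v ys u "[w]"] snoc.prems snoc by simp
    then have "(x, u) \<in> {(u, w). {u, w} \<in> F}\<^sup>*"
      by (rule snoc.IH)
    moreover have "{u, v} \<in> F"
      using snoc.prems snoc by (auto simp: simple_path_def walk_append walk_Cons)
    ultimately show ?thesis by (auto intro: rtrancl_into_rtrancl)
  qed
qed (simp add: simple_path_def)

text \<open>If \<open>u\<close> is off the path to \<open>v\<close>, appending \<open>u\<close>
  gives the unique path to \<open>u\<close>. If it is on the path, the edge closes a cycle with
  everything after \<open>u\<close> unless only \<open>v\<close> comes after it.\<close>

lemma simple_path_edge:
  assumes F: "is_forest F" and xs: "simple_path F x v xs" and ys: "simple_path F x u ys"
    and e: "{v, u} \<in> F" "v \<noteq> u"
  shows "ys = xs @ [u] \<or> xs = ys @ [v]"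
proof (cases "u \<in> set xs")
  case False
  then show ?thesis
    using simple_path_snoc[OF xs e(1)] simple_path_unique[OF F ys] by auto
next
  case True
  then obtain A B where AB: "xs = A @ u # B" by (auto dest: split_list)
  have A: "A @ [u] = ys"
    using simple_path_prefix xs AB simple_path_unique[OF F _ ys] by auto
  have B: "B \<noteq> []" "last B = v"
    using xs AB e(2) by (auto simp: simple_path_def split: if_splits)
  have "length B < 2"
  proof (rule ccontr)
    assume "\<not> length B < 2"
    then have "is_cycle F (u # B)"
      using xs AB B e(1) by (intro closed_walk_is_cycle) (auto simp: simple_path_def walk_append)
    then show False using F by (auto simp: is_forest_def)
  qed
  then have "B = [v]"
    using B by (cases B) auto
  then show ?thesis using A AB by auto
qed

section \<open>From local marks to parents and depths\<close>

lemma marks_iff_marked_edges: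
  assumes "is_network a N" "properly_marked N" "v \<in> nodes N"
  shows "{v, u} \<in> marks N v \<longleftrightarrow> {v, u} \<in> marked_edges N"
proof
  assume m: "{v, u} \<in> marks N v"
  then have e: "{v, u} \<in> edges N"
    using assms(1,3) unfolding is_network_def by blast
  show "{v, u} \<in> marked_edges N"
    using assms(2) e m unfolding properly_marked_def marked_edges_def by blast
qed (simp add: marked_edges_def)

lemma edge_nodes:
  assumes "is_network a N" "{u, v} \<in> edges N"
  shows "u \<in> nodes N" "v \<in> nodes N" "u \<noteq> v"
proof -
  obtain u' v' where "{u, v} = {u', v'}" "u' \<in> nodes N" "v' \<in> nodes N" "u' \<noteq> v'"
    using assms unfolding is_network_def by blast
  then show "u \<in> nodes N" "v \<in> nodes N" "u \<noteq> v"
    by (auto simp: doubleton_eq_iff)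
qed

lemma tree_of_nodes:
  assumes N: "is_network a N" "x \<in> nodes N"
  shows "tree_of N x \<subseteq> nodes N"
proof
  fix v assume "v \<in> tree_of N x"
  then show "v \<in> nodes N"
    unfolding tree_of_def mem_Collect_eq
    by (cases rule: rtranclE) (use N in \<open>auto simp: marked_edges_def dest: edge_nodes\<close>)
qed

text \<open>The parent of \<open>v\<close> is the penultimate vertex of the unique simple path from
  \<open>x\<close> to \<open>v\<close>, and the depth is the length of that path. That marked
  neighbours are parents or children is \<open>simple_path_edge\<close>.\<close>

lemma rooted_tree_of:
  assumes N: "is_network a N" and pm: "properly_marked N" and F: "is_forest (marked_edges N)"
    and x: "x \<in> nodes N"
  shows "\<exists>par dep. rooted_tree (tree_of N x) x (\<lambda>v. {u. {v, u} \<in> marks N v}) par dep"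
proof -
  define path where "path v = (SOME xs. simple_path (marked_edges N) x v xs)" for v
  have path: "simple_path (marked_edges N) x v (path v)" if "v \<in> tree_of N x" for v
    unfolding path_def
    by (rule someI_ex, rule simple_path_exists) (use that in \<open>simp add: tree_of_def\<close>)
  have path_eq: "path v = xs" if "simple_path (marked_edges N) x v xs" for v xs
    by (rule simple_path_unique[OF F path that]) (use simple_path_reach[OF that] in \<open>simp add: tree_of_def\<close>)
  have path_x: "path x = [x]"
    by (rule path_eq) (simp add: simple_path_def walk_def)
  have "rooted_tree (tree_of N x) x (\<lambda>v. {u. {v, u} \<in> marks N v})
     (\<lambda>v. last (butlast (path v))) (\<lambda>v. length (path v) - 1)"
  proof
    show "finite (tree_of N x)"
      using tree_of_nodes[OF N x] N by (auto simp: is_network_def intro: finite_subset)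
    show "x \<in> tree_of N x" by (simp add: tree_of_def)

  next
    fix v assume v: "v \<in> tree_of N x" "v \<noteq> x"
    obtain B where B: "path v = B @ [v]"
      using path[OF v(1)] by (cases "path v" rule: rev_cases) (auto simp: simple_path_def)
    with path[OF v(1)] v(2) have "B \<noteq> []"
      by (auto simp: simple_path_def)
    then obtain A u where A: "path v = (A @ [u]) @ [v]"
      using B by (cases B rule: rev_cases) auto
    have sp: "simple_path (marked_edges N) x u (A @ [u])"
      using path[OF v(1)] unfolding A by (intro simple_path_prefix[of _ _ v A u "[v]"]) simp
    have u: "u \<in> tree_of N x"
      using simple_path_reach[OF sp] by (simp add: tree_of_def)
    have "{u, v} \<in> marked_edges N"
      using path[OF v(1)] unfolding A by (simp add: simple_path_def walk_append walk_Cons)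
    then have "v \<in> {w. {u, w} \<in> marks N u}" "u \<in> {w. {v, w} \<in> marks N v}"
      using marks_iff_marked_edges[OF N pm] tree_of_nodes[OF N x] u v
      by (metis mem_Collect_eq subsetD, metis insert_commute mem_Collect_eq subsetD)
    then show "last (butlast (path v)) \<in> tree_of N x \<and>
       v \<in> {u. {last (butlast (path v)), u} \<in> marks N (last (butlast (path v)))} \<and>
       last (butlast (path v)) \<in> {u. {v, u} \<in> marks N v} \<and>
       length (path v) - 1 = Suc (length (path (last (butlast (path v)))) - 1)"
      using u by (simp add: A path_eq[OF sp] butlast_append)
  next
    fix v u assume v: "v \<in> tree_of N x" and "u \<in> {u. {v, u} \<in> marks N v}"
    then have e: "{v, u} \<in> marked_edges N"
      using marks_iff_marked_edges[OF N pm] tree_of_nodes[OF N x] by auto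
    then have u: "u \<in> tree_of N x"
      using v by (auto simp: tree_of_def intro: rtrancl_into_rtrancl)
    have "v \<noteq> u"
      using e edge_nodes[OF N] by (auto simp: marked_edges_def)
    from simple_path_edge[OF F path[OF v] path[OF u] e this] have
      "u \<noteq> x \<and> last (butlast (path u)) = v \<or> v \<noteq> x \<and> last (butlast (path v)) = u"
    proof
      assume "path u = path v @ [u]"
      then show ?thesis using path[OF v] path_x by (auto simp: simple_path_def)
    next
      assume "path v = path u @ [v]"
      then show ?thesis using path[OF u] path_x by (auto simp: simple_path_def)
    qed
    with u show "u \<in> tree_of N x \<and>
       (u \<noteq> x \<and> last (butlast (path u)) = v \<or> v \<noteq> x \<and> last (butlast (path v)) = u)"
      by blast
  qed
  then show ?thesis by blast
qed


section \<open>Broadcast and echo\<close>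

type_synonym strategy =
  "local_input \<Rightarrow> random_bits \<Rightarrow> bool list list \<Rightarrow> bool list + nat set option"

definition stream :: "nat \<Rightarrow> history \<Rightarrow> bool list list" where
  "stream u h = map snd (filter (\<lambda>m. fst m = u) h)"

definition answered :: "nat set \<Rightarrow> nat \<Rightarrow> history \<Rightarrow> bool" where
  "answered cs r h \<longleftrightarrow> (\<forall>c\<in>cs. length (stream c h) = r)"

text \<open>A node learns its parent \<open>p\<close> as the sender of the first message it ever
  receives. The two parts are tested after every message, so a leaf echoes at once, while an inner
  node forwards first and echoes when every child has sent as many messages as the parent.\<close>

definition relay :: "(local_input \<Rightarrow> bool list \<Rightarrow> bool list) \<Rightarrow> local_input \<Rightarrow> history \<Rightarrow> (nat \<times> bool list) list"
  where
  "relay val li h =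
     (let p = fst (hd h); cs = marked_neighbour_ids li - {p}; b = last (stream p h)
      in (if fst (last h) = p then map (\<lambda>c. (c, b)) (sorted_list_of_set cs) else []) @
         (if answered cs (length (stream p h)) h
          then [(p, xorl (val li b) (xorl.F (\<lambda>c. last (stream c h)) cs))] else []))"

text \<open>A history records received messages only, so the initiator has to rebuild its own
  earlier queries; each query is a function of the combined answers to the previous ones.\<close>

primrec transcript ::
  "(bool list list \<Rightarrow> bool list) \<Rightarrow> (nat \<Rightarrow> bool list \<Rightarrow> bool list) \<Rightarrow> nat \<Rightarrow> bool list list" where
  "transcript bc resp 0 = []"
| "transcript bc resp (Suc j) =
     transcript bc resp j @ [resp j (bc (transcript bc resp j))]"

text \<open>Any fixed marked neighbour would do, since \<open>root_step\<close> acts only when all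
  of them have sent equally many messages.\<close>

definition root_round :: "local_input \<Rightarrow> history \<Rightarrow> nat" where
  "root_round li h = length (stream (Min (marked_neighbour_ids li)) h)"

definition root_view ::
  "(local_input \<Rightarrow> bool list \<Rightarrow> bool list) \<Rightarrow> strategy \<Rightarrow> local_input \<Rightarrow> random_bits \<Rightarrow> history \<Rightarrow> bool list list"
  where
  "root_view val strat li \<beta> h =
     transcript (\<lambda>ts. projl (strat li \<beta> ts))
       (\<lambda>j b. xorl (val li b) (xorl.F (\<lambda>c. stream c h ! j) (marked_neighbour_ids li)))
       (root_round li h)"

definition root_step ::
  "(local_input \<Rightarrow> bool list \<Rightarrow> bool list) \<Rightarrow> strategy \<Rightarrow> local_input \<Rightarrow> random_bits \<Rightarrow> history \<Rightarrow>
     (bool list + nat set option) option"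
  where
  "root_step val strat li \<beta> h =
     (if answered (marked_neighbour_ids li) (root_round li h) h
      then Some (strat li \<beta> (root_view val strat li \<beta> h)) else None)"

text \<open>An initiator without marked edges is its whole tree, so all its edges leave the tree.\<close>

definition echo_procedure ::
  "(local_input \<Rightarrow> bool list \<Rightarrow> bool list) \<Rightarrow> strategy \<Rightarrow> procedure" where
  "echo_procedure val strat =
     \<lparr>sends = \<lambda>li \<beta> h.
        if known_error li = None then relay val li h
        else if marked_neighbour_ids li = {} then []
        else (case root_step val strat li \<beta> h of
                Some (Inl b) \<Rightarrow> map (\<lambda>c. (c, b)) (sorted_list_of_set (marked_neighbour_ids li))
              | _ \<Rightarrow> []),
      outcome = \<lambda>li \<beta> h.
        if marked_neighbour_ids li = {}
        then Some (if neighbour_ids li = {} then None else Some {own_id li, Min (neighbour_ids li)})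
        else (case root_step val strat li \<beta> h of Some (Inr r) \<Rightarrow> Some r | _ \<Rightarrow> None)\<rparr>"

lemma stream_Nil [simp]: "stream u [] = []"
  by (simp add: stream_def)

lemma stream_snoc: "stream u (h @ [(s, b)]) = stream u h @ (if s = u then [b] else [])"
  by (simp add: stream_def)

lemma transcript_cong:
  assumes "\<And>j. j < r \<Longrightarrow> resp j (bc (transcript bc resp' j)) = resp' j (bc (transcript bc resp' j))"
  shows "transcript bc resp r = transcript bc resp' r"
  using assms by (induction r) auto



section \<open>Pending messages\<close>

definition triple :: "message \<Rightarrow> nat \<times> nat \<times> bool list" where
  "triple m = (source m, target m, content m)"

text \<open>A multiset forgets positions and send times. Neither is visible to the node programs,
  and messages may overtake each other, so an invariant can be stated in terms of it alone.\<close>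

definition pending :: "config \<Rightarrow> (nat \<times> nat \<times> bool list) multiset" where
  "pending C = image_mset (\<lambda>k. triple (sent C ! k)) (mset_set ({..<length (sent C)} - received C))"

lemma quiescent_iff_pending:
  "quiescent C \<longleftrightarrow> pending C = {#}"
  by (auto simp: quiescent_def pending_def mset_set_empty_iff)

lemma length_sent:
  assumes "received C \<subseteq> {..<length (sent C)}"
  shows "length (sent C) = card (received C) + size (pending C)"
  using assms card_mono[OF _ assms] by (simp add: pending_def card_Diff_subset finite_subset)

lemma image_mset_nth_shift:
  "image_mset (\<lambda>k. f ((xs @ ys) ! k)) (mset_set {length xs..<length xs + length ys}) = mset (map f ys)"
proof -
  have "mset_set {length xs..<length xs + length ys} = image_mset ((+) (length xs)) (mset_set {0..<length ys})"
    by (subst image_mset_mset_set) auto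
  also have "image_mset (\<lambda>k. f ((xs @ ys) ! k)) \<dots> = image_mset f (image_mset ((!) ys) (mset_set {0..<length ys}))"
    by (simp add: multiset.map_comp comp_def)
  also have "image_mset ((!) ys) (mset_set {0..<length ys}) = mset ys"
    by (metis map_nth mset_map mset_upt)
  finally show ?thesis by simp
qed

lemma pending_initial:
  "pending (initial P N x err \<omega>) =
     mset (map (\<lambda>(u, bs). (x, u, bs)) (sends P (local_input_of N x err x) (\<omega> x) []))"
  using image_mset_nth_shift[of triple "[]" "act P N x err \<omega> x [] 0"]
  by (simp add: pending_def initial_def act_def lessThan_atLeast0 triple_def comp_def case_prod_beta)

lemma pending_deliver:
  assumes k: "k < length (sent C)" "k \<notin> received C" and rec: "received C \<subseteq> {..<length (sent C)}"
    and m: "triple (sent C ! k) = (u, v, bs)"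
  defines "h \<equiv> histories C v @ [(u, bs)]"
  shows "pending (deliver P N x err \<omega> (k, t) C) =
     pending C - {#(u, v, bs)#} +
     mset (map (\<lambda>(w, b). (v, w, b)) (sends P (local_input_of N x err v) (\<omega> v) h))"
proof -
  let ?A = "act P N x err \<omega> v h t"
  let ?n = "length (sent C)"
  let ?U = "{..<?n} - received C"
  have D: "deliver P N x err \<omega> (k, t) C =
      \<lparr>sent = sent C @ ?A, received = insert k (received C), histories = (histories C)(v := h), clock = t\<rparr>"
    using m by (simp add: deliver_def triple_def h_def Let_def)
  have split: "{..<?n + length ?A} - insert k (received C) = (?U - {k}) \<union> {?n..<?n + length ?A}"
    using rec k by (auto simp: not_less)
  have "pending (deliver P N x err \<omega> (k, t) C) =
      image_mset (\<lambda>j. triple ((sent C @ ?A) ! j)) (mset_set (?U - {k})) +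
      image_mset (\<lambda>j. triple ((sent C @ ?A) ! j)) (mset_set {?n..<?n + length ?A})"
    unfolding pending_def D by (simp add: split) (subst mset_set_Union, auto)
  also have "image_mset (\<lambda>j. triple ((sent C @ ?A) ! j)) (mset_set (?U - {k})) =
      image_mset (\<lambda>j. triple (sent C ! j)) (mset_set (?U - {k}))"
    by (intro image_mset_cong) (auto simp: nth_append)
  also have "\<dots> = pending C - {#(u, v, bs)#}"
  proof -
    have "mset_set ?U = add_mset k (mset_set (?U - {k}))"
      using k by (subst mset_set.remove[of _ k]) auto
    then show ?thesis
      using m by (simp add: pending_def)
  qed
  also have "image_mset (\<lambda>j. triple ((sent C @ ?A) ! j)) (mset_set {?n..<?n + length ?A}) = mset (map triple ?A)"
    by (rule image_mset_nth_shift)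
  also have "map triple ?A = map (\<lambda>(w, b). (v, w, b)) (sends P (local_input_of N x err v) (\<omega> v) h)"
    by (auto simp: act_def triple_def)
  finally show ?thesis .
qed

lemma mset_map_sorted_list_of_set:
  "finite A \<Longrightarrow> inj_on f A \<Longrightarrow> mset (map f (sorted_list_of_set A)) = mset_set (f ` A)"
  by (simp add: image_mset_mset_set flip: sorted_list_of_mset_set)

lemma mset_set_replace:
  assumes "finite S" "m \<in> S" "finite S'" "(S - {m}) \<inter> S' = {}"
  shows "mset_set S - {#m#} + mset_set S' = mset_set ((S - {m}) \<union> S')"
  using assms by (simp add: mset_set_Union mset_set_Diff)


section \<open>Executions of the broadcast and echo procedure\<close>

lemma execution_step:
  assumes "is_execution P N x err \<omega> \<rho>"
  shows "if quiescent (\<rho> i) then \<rho> (Suc i) = \<rho> i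
     else \<exists>d. deliverable (\<rho> i) d \<and> \<rho> (Suc i) = deliver P N x err \<omega> d (\<rho> i)"
  using assms unfolding is_execution_def by blast

text \<open>The coins are fixed here, so everything except the order and timing of deliveries is
  determined. The round number \<open>R\<close> and the result \<open>out\<close> are parameters,
  tied to the strategy by \<open>concludes\<close>.\<close>

locale echo_run = rooted_tree T x nb par dep
  for T :: "nat set" and x :: nat and nb par dep +
  fixes N :: network and err :: real and \<omega> :: "nat \<Rightarrow> random_bits"
    and val :: "local_input \<Rightarrow> bool list \<Rightarrow> bool list" and strat :: strategy
    and R :: nat and out :: "nat set option"
  assumes nb_eq: "nb v = {u. {v, u} \<in> marks N v}"
    and children: "nb x \<noteq> {}"
begin

abbreviation I :: "nat \<Rightarrow> local_input" where
  "I v \<equiv> local_input_of N x err v"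

text \<open>The ideal transcript, defined from exact totals over the tree without reference to any
  schedule.\<close>

definition ts :: "nat \<Rightarrow> bool list list" where
  "ts = transcript (\<lambda>ts. projl (strat (I x) (\<omega> x) ts)) (\<lambda>_ b. xorl.F (\<lambda>v. val (I v) b) T)"

definition bc :: "nat \<Rightarrow> bool list" where
  "bc r = projl (strat (I x) (\<omega> x) (ts r))"

definition echo :: "nat \<Rightarrow> nat \<Rightarrow> bool list" where
  "echo v r = agg (\<lambda>u. val (I u) (bc r)) v"

text \<open>The first image holds broadcasts on their way to the frontier below \<open>A\<close>,
  the second the echoes of finished subtrees that have not arrived. Nothing else can be in
  transit.\<close>

definition Pend :: "nat \<Rightarrow> nat set \<Rightarrow> nat set \<Rightarrow> (nat \<times> nat \<times> bool list) set" where
  "Pend r A E = (if r < R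
     then (\<lambda>v. (par v, v, bc r)) ` {v \<in> V - A. par v \<in> insert x A} \<union>
          (\<lambda>v. (v, par v, echo v r)) ` {v \<in> A - E. ch v \<subseteq> E}
     else {})"

text \<open>In round \<open>r\<close>, the nodes in \<open>A\<close> have received the broadcast, and the echoes of the
  nodes in \<open>E\<close> have been received by their parents.\<close>

definition state :: "nat \<Rightarrow> nat set \<Rightarrow> nat set \<Rightarrow> config \<Rightarrow> bool" where
  "state r A E C \<longleftrightarrow>
     r \<le> R \<and> A \<subseteq> V \<and> E \<subseteq> A \<and> (\<forall>v\<in>A. par v \<in> insert x A) \<and> (\<forall>v\<in>E. ch v \<subseteq> E) \<and> \<not> ch x \<subseteq> E \<and>
     (r = R \<longrightarrow> A = {}) \<and>
     (\<forall>v\<in>V. stream (par v) (histories C v) = map bc [0..<(if v \<in> A then Suc r else r)]) \<and>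
     (\<forall>v\<in>V. stream v (histories C (par v)) = map (echo v) [0..<(if v \<in> E then Suc r else r)]) \<and>
     (\<forall>v\<in>V. histories C v \<noteq> [] \<longrightarrow> fst (hd (histories C v)) = par v) \<and>
     received C \<subseteq> {..<length (sent C)} \<and>
     card (received C) = 2 * card V * r + card A + card E \<and>
     pending C = mset_set (Pend r A E) \<and>
     (\<forall>m\<in>set (sent C). \<exists>v\<in>V. \<exists>r<R. triple m = (par v, v, bc r) \<or> triple m = (v, par v, echo v r))"

lemma ch_x: "ch x \<noteq> {}"
  using children nb_root by simp

lemma marked_nb [simp]: "marked_neighbour_ids (I v) = nb v"
  by (simp add: local_input_of_def nb_eq)

lemma known [simp]: "known_error (I v) = None \<longleftrightarrow> v \<noteq> x"
  by (simp add: local_input_of_def)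

lemma echo_eq: "v \<in> T \<Longrightarrow> echo v r = xorl (val (I v) (bc r)) (xorl.F (\<lambda>c. echo c r) (ch v))"
  unfolding echo_def by (rule agg_eq)

lemma echo_root: "echo x r = xorl.F (\<lambda>v. val (I v) (bc r)) T"
  unfolding echo_def by (rule agg_root)


lemma finite_Pend: "A \<subseteq> V \<Longrightarrow> finite (Pend r A E)"
  using finite_V finite_subset[of A V] by (auto simp: Pend_def)

text \<open>Serves both events at a node other than the initiator: a broadcast from the parent and
  an echo from a child. With streams of these lengths, the test \<open>answered\<close> amounts to
  \<open>ch v \<subseteq> E\<close>.\<close>

lemma relay_eq:
  assumes v: "v \<in> V" and h: "fst (hd h) = par v"
    and down: "stream (par v) h = map bc [0..<Suc r]"
    and up: "\<And>c. c \<in> ch v \<Longrightarrow> stream c h = map (echo c) [0..<(if c \<in> E then Suc r else r)]"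
  shows "relay val (I v) h =
     (if fst (last h) = par v then map (\<lambda>c. (c, bc r)) (sorted_list_of_set (ch v)) else []) @
     (if ch v \<subseteq> E then [(par v, echo v r)] else [])"
proof -
  have cs: "nb v - {par v} = ch v"
    using nb_V[OF v] .
  have "answered (ch v) (Suc r) h \<longleftrightarrow> ch v \<subseteq> E"
    using up by (auto simp: answered_def)
  moreover have "xorl (val (I v) (bc r)) (xorl.F (\<lambda>c. last (stream c h)) (ch v)) = echo v r"
    if "ch v \<subseteq> E"
  proof -
    have "xorl.F (\<lambda>c. last (stream c h)) (ch v) = xorl.F (\<lambda>c. echo c r) (ch v)"
      by (rule xorl.cong) (use up that in auto)
    then show ?thesis
      using echo_eq[OF V_T[OF v]] by simp
  qed
  ultimately show ?thesis
    unfolding relay_def Let_def h marked_nb cs down by simp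
qed

text \<open>The j-th message from a child is its echo of round j, as a child sends again only after
  the next broadcast. Hence the rebuilt view agrees with the ideal transcript.\<close>

lemma root_step_complete:
  assumes "\<And>c. c \<in> ch x \<Longrightarrow> stream c h = map (echo c) [0..<r]"
  shows "root_step val strat (I x) (\<omega> x) h = Some (strat (I x) (\<omega> x) (ts r))"
proof -
  have "Min (ch x) \<in> ch x"
    using ch_x finite_ch by simp
  then have r: "root_round (I x) h = r"
    using assms by (simp add: root_round_def nb_root)
  have "answered (ch x) r h"
    using assms by (simp add: answered_def)
  moreover have "root_view val strat (I x) (\<omega> x) h = ts r"
    unfolding root_view_def r ts_def
  proof (rule transcript_cong, fold ts_def, fold bc_def)
    fix j assume "j < r"
    then have "xorl.F (\<lambda>c. stream c h ! j) (ch x) = xorl.F (\<lambda>c. echo c j) (ch x)"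
      by (intro xorl.cong) (use assms in auto)
    then show "xorl (val (I x) (bc j)) (xorl.F (\<lambda>c. stream c h ! j) (marked_neighbour_ids (I x)))
        = xorl.F (\<lambda>v. val (I v) (bc j)) T"
      using echo_eq[OF root] by (simp add: nb_root echo_root)
  qed
  ultimately show ?thesis
    by (simp add: root_step_def r nb_root)
qed

lemma root_step_incomplete:
  assumes up: "\<And>c. c \<in> ch x \<Longrightarrow> stream c h = map (echo c) [0..<(if c \<in> E then Suc r else r)]"
    and "c \<in> ch x" "c \<in> E" "c' \<in> ch x" "c' \<notin> E"
  shows "root_step val strat (I x) (\<omega> x) h = None"
proof -
  have "length (stream c h) \<noteq> length (stream c' h)"
    using assms by simp
  then have "\<not> answered (ch x) (root_round (I x) h) h"
    using assms(2,4) unfolding answered_def by metis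
  then show ?thesis
    by (simp add: root_step_def nb_root)
qed

definition concludes :: bool where
  "concludes \<longleftrightarrow> (\<forall>r<R. strat (I x) (\<omega> x) (ts r) = Inl (bc r)) \<and> strat (I x) (\<omega> x) (ts R) = Inr out"

lemma sends_root:
  assumes concludes: concludes and r: "r \<le> R"
    and up: "\<And>c. c \<in> ch x \<Longrightarrow> stream c h = map (echo c) [0..<r]"
  shows "sends (echo_procedure val strat) (I x) (\<omega> x) h =
     (if r < R then map (\<lambda>c. (c, bc r)) (sorted_list_of_set (ch x)) else [])"
proof -
  have "root_step val strat (I x) (\<omega> x) h = Some (strat (I x) (\<omega> x) (ts r))"
    by (rule root_step_complete) (rule up)
  then show ?thesis
    using concludes r by (cases "r = R") (auto simp: echo_procedure_def nb_root ch_x concludes_def)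
qed

lemma Pend_new_round: "Pend r {} {} = (if r < R then (\<lambda>c. (x, c, bc r)) ` ch x else {})"
  by (auto simp: Pend_def ch_def)

lemma mset_new_round:
  "mset (map (\<lambda>(w, b). (x, w, b)) (if r < R then map (\<lambda>c. (c, bc r)) (sorted_list_of_set (ch x)) else []))
     = mset_set (Pend r {} {})"
proof (cases "r < R")
  case True
  then show ?thesis
    using mset_map_sorted_list_of_set[OF finite_ch[of x], of "\<lambda>c. (x, c, bc r)"]
    by (simp add: Pend_new_round inj_on_def comp_def)
qed (simp add: Pend_new_round)

lemma triple_act: "triple ` set (act P N x err \<omega> v h t) =
    set (map (\<lambda>(w, b). (v, w, b)) (sends P (I v) (\<omega> v) h))"
  by (force simp: act_def triple_def)

section \<open>Preservation of the invariant by deliveries\<close>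

lemma state_initial:
  assumes concludes
  shows "state 0 {} {} (initial (echo_procedure val strat) N x err \<omega>)"
proof -
  let ?P = "echo_procedure val strat"
  let ?C = "initial ?P N x err \<omega>"
  have s: "sends ?P (I x) (\<omega> x) [] =
      (if 0 < R then map (\<lambda>c. (c, bc 0)) (sorted_list_of_set (ch x)) else [])"
    by (rule sends_root[OF assms]) auto
  have p: "pending ?C = mset_set (Pend 0 {} {})"
    unfolding pending_initial s by (rule mset_new_round)
  have "\<exists>v\<in>V. \<exists>r<R. triple m = (par v, v, bc r) \<or> triple m = (v, par v, echo v r)"
    if "m \<in> set (sent ?C)" for m
  proof -
    have "triple m \<in> set (map (\<lambda>(w, b). (x, w, b)) (sends ?P (I x) (\<omega> x) []))"
      using that triple_act[of ?P x "[]" 0] by (auto simp: initial_def)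
    then show ?thesis
      unfolding s using finite_ch by (auto split: if_splits simp: ch_def)
  qed
  with p show ?thesis
    unfolding state_def using ch_x by (auto simp: initial_def)
qed

text \<open>\<open>S'\<close> is the set of messages sent by the receiver in response to the delivery.\<close>

lemma state_deliver_aux:
  assumes st: "state r A E C" and d: "deliverable C (k, t)"
    and m: "triple (sent C ! k) = (u, v, bs)"
    and h: "h = histories C v @ [(u, bs)]"
    and S': "mset (map (\<lambda>(w, b). (v, w, b)) (sends P (I v) (\<omega> v) h)) = mset_set S'"
       "finite S'" "(Pend r A E - {(u, v, bs)}) \<inter> S' = {}"
    and Pend': "Pend r' A' E' = (Pend r A E - {(u, v, bs)}) \<union> S'"
    and sets: "r' \<le> R" "A' \<subseteq> V" "E' \<subseteq> A'" "\<And>v. v \<in> A' \<Longrightarrow> par v \<in> insert x A'" "\<And>v. v \<in> E' \<Longrightarrow> ch v \<subseteq> E'"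
       "\<not> ch x \<subseteq> E'" "r' = R \<Longrightarrow> A' = {}"
    and card: "2 * card V * r' + card A' + card E' = Suc (2 * card V * r + card A + card E)"
    and down: "\<And>w. w \<in> V \<Longrightarrow> stream (par w) (histories C w) @ (if w = v \<and> u = par w then [bs] else []) =
         map bc [0..<(if w \<in> A' then Suc r' else r')]"
    and up: "\<And>w. w \<in> V \<Longrightarrow> stream w (histories C (par w)) @ (if par w = v \<and> u = w then [bs] else []) =
         map (echo w) [0..<(if w \<in> E' then Suc r' else r')]"
    and hd: "v \<in> V \<Longrightarrow> fst (hd h) = par v"
    and S'_ok: "\<And>s. s \<in> S' \<Longrightarrow> \<exists>v\<in>V. \<exists>r<R. s = (par v, v, bc r) \<or> s = (v, par v, echo v r)"
  shows "state r' A' E' (deliver P N x err \<omega> (k, t) C)"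
proof -
  let ?C = "deliver P N x err \<omega> (k, t) C"
  have D: "?C = \<lparr>sent = sent C @ act P N x err \<omega> v h t, received = insert k (received C),
      histories = (histories C)(v := h), clock = t\<rparr>"
    using m by (simp add: deliver_def triple_def h Let_def)
  have k: "k < length (sent C)" "k \<notin> received C"
    using d by (auto simp: deliverable_def)
  have rec: "received C \<subseteq> {..<length (sent C)}"
    using st by (simp add: state_def)
  have A: "A \<subseteq> V" and pend: "pending C = mset_set (Pend r A E)"
    using st by (auto simp: state_def)
  have "(u, v, bs) \<in># pending C"
    using k unfolding pending_def m[symmetric] by auto
  then have mem: "(u, v, bs) \<in> Pend r A E"
    using pend finite_Pend[OF A] by simp
  have "pending ?C = mset_set (Pend r' A' E')"
    unfolding pending_deliver[OF k rec m] h[symmetric] S'(1) Pend' pend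
    by (rule mset_set_replace[OF finite_Pend[OF A] mem S'(2,3)])
  moreover have "received ?C \<subseteq> {..<length (sent ?C)}"
    using k rec by (auto simp: D)
  moreover have "card (received ?C) = 2 * card V * r' + card A' + card E'"
    using st k rec finite_subset[OF rec] by (simp add: D card state_def)
  moreover have "stream (par w) (histories ?C w) = map bc [0..<(if w \<in> A' then Suc r' else r')]" if "w \<in> V" for w
    using down[OF that] by (auto simp: D h stream_snoc)
  moreover have "stream w (histories ?C (par w)) = map (echo w) [0..<(if w \<in> E' then Suc r' else r')]" if "w \<in> V" for w
    using up[OF that] by (auto simp: D h stream_snoc)
  moreover have "fst (hd (histories ?C w)) = par w" if "w \<in> V" "histories ?C w \<noteq> []" for w
    using st hd that by (auto simp: D state_def)
  moreover have "\<exists>v\<in>V. \<exists>r<R. triple m = (par v, v, bc r) \<or> triple m = (v, par v, echo v r)"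
    if "m \<in> set (sent ?C)" for m
  proof (cases "m \<in> set (sent C)")
    case True
    then show ?thesis using st by (simp add: state_def)
  next
    case False
    then have "triple m \<in> set (map (\<lambda>(w, b). (v, w, b)) (sends P (I v) (\<omega> v) h))"
      using that triple_act[of P v h t] by (auto simp: D)
    then have "triple m \<in># mset (map (\<lambda>(w, b). (v, w, b)) (sends P (I v) (\<omega> v) h))"
      by simp
    then have "triple m \<in> S'"
      using S'(2) unfolding S'(1) by simp
    then show ?thesis by (rule S'_ok)
  qed
  ultimately show ?thesis
    unfolding state_def using sets by blast
qed

lemma sends_V: "v \<in> V \<Longrightarrow> sends (echo_procedure val strat) (I v) \<beta> h = relay val (I v) h"
  using V_x by (simp add: echo_procedure_def)

text \<open>The receiver \<open>v\<close> joins \<open>A\<close>. The reply is the broadcast to its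
  children, or its echo if it is a leaf.\<close>

lemma state_deliver_down:
  assumes st: "state r A E C" and d: "deliverable C (k, t)" and r: "r < R"
    and m: "triple (sent C ! k) = (par v, v, bc r)" and v: "v \<in> V - A" "par v \<in> insert x A"
  shows "state r (insert v A) E (deliver (echo_procedure val strat) N x err \<omega> (k, t) C)"
proof -
  define h where "h = histories C v @ [(par v, bc r)]"
  define S' where "S' = (if ch v = {} then {(v, par v, echo v r)} else (\<lambda>c. (v, c, bc r)) ` ch v)"
  have vV: "v \<in> V" "v \<notin> A" "v \<noteq> x"
    using v V_x by auto
  note st' = st[unfolded state_def]
  have AV: "A \<subseteq> V" and EA: "E \<subseteq> A" and cA: "\<And>v. v \<in> A \<Longrightarrow> par v \<in> insert x A"
    and cE: "\<And>v. v \<in> E \<Longrightarrow> ch v \<subseteq> E"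
    using st' by auto
  have down: "stream (par w) (histories C w) = map bc [0..<(if w \<in> A then Suc r else r)]" if "w \<in> V" for w
    using st' that by auto
  have up: "stream w (histories C (par w)) = map (echo w) [0..<(if w \<in> E then Suc r else r)]" if "w \<in> V" for w
    using st' that by auto
  have hd: "histories C v \<noteq> [] \<longrightarrow> fst (hd (histories C v)) = par v"
    using st' vV by auto
  \<comment> \<open>\<open>A\<close> is closed under parents and \<open>v\<close> was outside it, so
    no child of \<open>v\<close> has the broadcast yet; only a leaf can have all its children in
    \<open>E\<close>.\<close>
  have chA: "ch v \<inter> A = {}"
    using cA vV by (force simp: ch_def)
  have chE: "ch v \<subseteq> E \<longleftrightarrow> ch v = {}"
    using chA EA by auto
  have hd_h: "fst (hd h) = par v"
    using hd by (cases "histories C v") (auto simp: h_def)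
  have "relay val (I v) h =
     (if fst (last h) = par v then map (\<lambda>c. (c, bc r)) (sorted_list_of_set (ch v)) else []) @
     (if ch v \<subseteq> E then [(par v, echo v r)] else [])"
  proof (rule relay_eq[OF vV(1) hd_h])
    show "stream (par v) h = map bc [0..<Suc r]"
      using down[OF vV(1)] vV by (simp add: h_def stream_snoc)
    show "stream c h = map (echo c) [0..<(if c \<in> E then Suc r else r)]" if "c \<in> ch v" for c
      using up[of c] that par_not_ch[OF vV(1)] by (auto simp: h_def stream_snoc ch_def)
  qed
  then have relay: "relay val (I v) h =
     (if ch v = {} then [(par v, echo v r)] else map (\<lambda>c. (c, bc r)) (sorted_list_of_set (ch v)))"
    by (simp add: chE h_def)
  have S'_mset: "mset (map (\<lambda>(w, b). (v, w, b)) (relay val (I v) h)) = mset_set S'"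
    using mset_map_sorted_list_of_set[OF finite_ch[of v], of "\<lambda>c. (v, c, bc r)"]
    unfolding relay by (simp add: S'_def inj_on_def comp_def multiset.map_comp)
  show ?thesis
  proof (rule state_deliver_aux[OF st d m h_def, of "echo_procedure val strat" S'])
    show "mset (map (\<lambda>(w, b). (v, w, b)) (sends (echo_procedure val strat) (I v) (\<omega> v) h)) = mset_set S'"
      by (simp only: sends_V[OF vV(1)] S'_mset)
    show "finite S'"
      using finite_ch by (simp add: S'_def)
    show "(Pend r A E - {(par v, v, bc r)}) \<inter> S' = {}"
    proof -
      have "fst s \<noteq> v" if "s \<in> Pend r A E" for s
        using that vV by (auto simp: Pend_def split: if_splits)
      moreover have "fst s = v" if "s \<in> S'" for s
        using that by (auto simp: S'_def split: if_splits)
      ultimately show ?thesis by blast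
    qed
    show "Pend r (insert v A) E = (Pend r A E - {(par v, v, bc r)}) \<union> S'"
    proof -
      have 1: "{w \<in> V - insert v A. par w \<in> insert x (insert v A)} =
          ({w \<in> V - A. par w \<in> insert x A} - {v}) \<union> ch v"
        using chA par_neq[OF vV(1)] vV by (auto simp: ch_def)
      have 2: "{w \<in> insert v A - E. ch w \<subseteq> E} =
          {w \<in> A - E. ch w \<subseteq> E} \<union> (if ch v = {} then {v} else {})"
        using chE EA vV by auto
      have 3: "(\<lambda>w. (par w, w, bc r)) ` ch v = (\<lambda>c. (v, c, bc r)) ` ch v"
        by (auto simp: ch_def)
      \<comment> \<open>A broadcast to \<open>v\<close> can equal an echo as a triple only if the
        sender \<open>par v\<close> has \<open>v\<close> as its own parent, which the depths
        forbid.\<close>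
      have 4: "(par v, v, bc r) \<notin> (\<lambda>w. (w, par w, echo w r)) ` {w \<in> A - E. ch w \<subseteq> E}"
      proof
        assume "(par v, v, bc r) \<in> (\<lambda>w. (w, par w, echo w r)) ` {w \<in> A - E. ch w \<subseteq> E}"
        then have "par v \<in> V" "par (par v) = v" using AV by auto
        then show False using par_par[OF vV(1)] by simp
      qed
      have 5: "(\<lambda>w. (par w, w, bc r)) ` ({w \<in> V - A. par w \<in> insert x A} - {v}) =
          (\<lambda>w. (par w, w, bc r)) ` {w \<in> V - A. par w \<in> insert x A} - {(par v, v, bc r)}"
        by auto
      show ?thesis
        unfolding Pend_def 1 2 image_Un 3 5 using r 4 by (auto simp: S'_def)
    qed
    show "insert v A \<subseteq> V" "E \<subseteq> insert v A" "r \<le> R"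
      using vV AV EA r by auto
    show "par w \<in> insert x (insert v A)" if "w \<in> insert v A" for w
      using that v cA by auto
    show "2 * card V * r + card (insert v A) + card E = Suc (2 * card V * r + card A + card E)"
      using vV finite_subset[OF AV finite_V] by simp
    show "stream (par w) (histories C w) @ (if w = v \<and> par v = par w then [bc r] else []) =
        map bc [0..<(if w \<in> insert v A then Suc r else r)]" if "w \<in> V" for w
      using down[OF that] vV by auto
    show "stream w (histories C (par w)) @ (if par w = v \<and> par v = w then [bc r] else []) =
        map (echo w) [0..<(if w \<in> E then Suc r else r)]" if "w \<in> V" for w
      using up[OF that] par_par[OF that] vV by auto
    show "\<exists>v\<in>V. \<exists>r<R. s = (par v, v, bc r) \<or> s = (v, par v, echo v r)" if "s \<in> S'" for s
    proof (cases "ch v = {}")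
      case True
      then show ?thesis using that vV r by (auto simp: S'_def)
    next
      case False
      with that obtain c where "c \<in> ch v" "s = (v, c, bc r)" by (auto simp: S'_def)
      then show ?thesis using r by (intro bexI[of _ c]) (auto simp: ch_def)
    qed
    show "\<not> ch x \<subseteq> E" using st' by simp
    show "ch w \<subseteq> E" if "w \<in> E" for w using cE that .
    show "insert v A = {}" if "r = R" using that r by simp
    show "fst (hd h) = par v" by (rule hd_h)
  qed
qed

text \<open>The sender \<open>c\<close> joins \<open>E\<close>. Its parent echoes in turn if
  \<open>c\<close> was the last missing child; the initiator stays silent because
  \<open>inner\<close> leaves it waiting for another child.\<close>

lemma state_deliver_up_inner:
  assumes st: "state r A E C" and d: "deliverable C (k, t)" and r: "r < R"
    and m: "triple (sent C ! k) = (c, par c, echo c r)" and c: "c \<in> A - E" "ch c \<subseteq> E"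
    and inner: "par c \<noteq> x \<or> \<not> ch x \<subseteq> insert c E"
  shows "state r A (insert c E) (deliver (echo_procedure val strat) N x err \<omega> (k, t) C)"
proof -
  define p where "p = par c"
  define h where "h = histories C p @ [(c, echo c r)]"
  define S' where "S' = (if p \<noteq> x \<and> ch p \<subseteq> insert c E then {(p, par p, echo p r)} else {})"
  note st' = st[unfolded state_def]
  have AV: "A \<subseteq> V" and EA: "E \<subseteq> A" and cA: "\<And>v. v \<in> A \<Longrightarrow> par v \<in> insert x A"
    and cE: "\<And>v. v \<in> E \<Longrightarrow> ch v \<subseteq> E" and xE: "\<not> ch x \<subseteq> E"
    using st' by auto
  have down: "stream (par w) (histories C w) = map bc [0..<(if w \<in> A then Suc r else r)]" if "w \<in> V" for w
    using st' that by auto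
  have up: "stream w (histories C (par w)) = map (echo w) [0..<(if w \<in> E then Suc r else r)]" if "w \<in> V" for w
    using st' that by auto
  have cV: "c \<in> V" "c \<in> A" "c \<notin> E" "c \<in> ch p"
    using c AV by (auto simp: ch_def p_def)
  have pA: "p = x \<or> p \<in> A \<and> p \<in> V \<and> p \<noteq> x"
    using cA[OF cV(2)] AV V_x by (auto simp: p_def)
  have pE: "p \<notin> E"
    using cE cV by auto
  have up_h: "stream w h = map (echo w) [0..<(if w \<in> insert c E then Suc r else r)]" if "w \<in> ch p" for w
    using up[of w] that cV by (auto simp: h_def stream_snoc ch_def)
  have hd_h: "fst (hd h) = par p" if "p \<in> V"
  proof -
    have "p \<in> A" using pA that V_x by auto
    then have "histories C p \<noteq> []" using down[OF that] by auto
    then show ?thesis using st' that by (simp add: h_def)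
  qed
  have S'_mset: "mset (map (\<lambda>(w, b). (p, w, b)) (sends (echo_procedure val strat) (I p) (\<omega> p) h)) = mset_set S'"
  proof (cases "p = x")
    case True
    with inner obtain c' where "c' \<in> ch x" "c' \<notin> insert c E"
      by (auto simp: p_def)
    then have "root_step val strat (I x) (\<omega> x) h = None"
      using root_step_incomplete[of h "insert c E" r c c'] up_h cV True by auto
    then show ?thesis
      using True by (simp add: S'_def echo_procedure_def)
  next
    case False
    then have p: "p \<in> V" "p \<in> A" using pA by auto
    have "relay val (I p) h =
       (if fst (last h) = par p then map (\<lambda>c. (c, bc r)) (sorted_list_of_set (ch p)) else []) @
       (if ch p \<subseteq> insert c E then [(par p, echo p r)] else [])"
    proof (rule relay_eq[OF p(1) hd_h[OF p(1)]])
      show "stream (par p) h = map bc [0..<Suc r]"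
        using down[OF p(1)] p par_not_ch[OF p(1)] cV by (auto simp: h_def stream_snoc)
      show "stream w h = map (echo w) [0..<(if w \<in> insert c E then Suc r else r)]" if "w \<in> ch p" for w
        using up_h[OF that] .
    qed
    moreover have "fst (last h) \<noteq> par p"
      using par_not_ch[OF p(1)] cV by (auto simp: h_def)
    ultimately show ?thesis
      using False by (simp add: S'_def sends_V[OF p(1)])
  qed
  show ?thesis
  proof (rule state_deliver_aux[OF st d m[folded p_def] h_def, of "echo_procedure val strat" S'])
    show "mset (map (\<lambda>(w, b). (p, w, b)) (sends (echo_procedure val strat) (I p) (\<omega> p) h)) = mset_set S'"
      by (rule S'_mset)
    show "finite S'" by (simp add: S'_def)
    show "(Pend r A E - {(c, p, echo c r)}) \<inter> S' = {}"
    proof -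
      \<comment> \<open>The new echo would already be in transit either as a broadcast from
        \<open>p\<close> to its own parent, excluded by depths, or as an echo sent with
        \<open>c\<close> still missing.\<close>
      have "(p, par p, echo p r) \<notin> Pend r A E" if "p \<noteq> x"
      proof
        assume "(p, par p, echo p r) \<in> Pend r A E"
        then have "(\<exists>w\<in>V - A. p = par w \<and> par p = w) \<or> ch p \<subseteq> E"
          by (auto simp: Pend_def split: if_splits)
        moreover have False if "w \<in> V" "p = par w" "par p = w" for w
          using par_par[of w] that pA \<open>p \<noteq> x\<close> by simp
        ultimately show False
          using cV by blast
      qed
      then show ?thesis by (auto simp: S'_def)
    qed
    show "Pend r A (insert c E) = (Pend r A E - {(c, p, echo c r)}) \<union> S'"
    proof -
      have 1: "{w \<in> A - insert c E. ch w \<subseteq> insert c E} =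
          ({w \<in> A - E. ch w \<subseteq> E} - {c}) \<union> (if p \<noteq> x \<and> ch p \<subseteq> insert c E then {p} else {})"
      proof -
        have "w = p" if "w \<in> A" "ch w \<subseteq> insert c E" "\<not> ch w \<subseteq> E" for w
          using that cV by (auto simp: ch_def)
        moreover have "p \<noteq> c" using par_neq[OF cV(1)] by (simp add: p_def)
        moreover have "x \<notin> A" using AV x_V by blast
        moreover have "p = x \<or> p \<in> A" using pA by blast
        ultimately show ?thesis using pE by (intro set_eqI) (auto split: if_splits)
      qed
      have 4: "(c, p, echo c r) \<notin> (\<lambda>w. (par w, w, bc r)) ` {w \<in> V - A. par w \<in> insert x A}"
        using pA by auto
      have 5: "(\<lambda>w. (w, par w, echo w r)) ` ({w \<in> A - E. ch w \<subseteq> E} - {c}) =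
          (\<lambda>w. (w, par w, echo w r)) ` {w \<in> A - E. ch w \<subseteq> E} - {(c, p, echo c r)}"
        by (auto simp: p_def)
      show ?thesis
        unfolding Pend_def 1 image_Un 5 using r 4 by (auto simp: S'_def)
    qed
    show "A \<subseteq> V" "insert c E \<subseteq> A" "r \<le> R" using AV EA cV r by auto
    show "par w \<in> insert x A" if "w \<in> A" for w using cA that .
    show "ch w \<subseteq> insert c E" if "w \<in> insert c E" for w using that c cE by auto
    show "\<not> ch x \<subseteq> insert c E"
    proof
      assume "ch x \<subseteq> insert c E"
      with inner xE show False by (auto simp: ch_def)
    qed
    show "A = {}" if "r = R" using that r by simp
    show "2 * card V * r + card A + card (insert c E) = Suc (2 * card V * r + card A + card E)"
      using cV finite_subset[OF EA finite_subset[OF AV finite_V]] by simp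
    show "stream (par w) (histories C w) @ (if w = p \<and> c = par w then [echo c r] else []) =
        map bc [0..<(if w \<in> A then Suc r else r)]" if "w \<in> V" for w
    proof -
      have "\<not> (w = p \<and> c = par w)"
        using par_par[OF cV(1), folded p_def] that by blast
      then show ?thesis using down[OF that] by simp
    qed
    show "stream w (histories C (par w)) @ (if par w = p \<and> c = w then [echo c r] else []) =
        map (echo w) [0..<(if w \<in> insert c E then Suc r else r)]" if "w \<in> V" for w
      using up[OF that] cV by (auto simp: p_def)
    show "fst (hd h) = par p" if "p \<in> V" using hd_h[OF that] .
    show "\<exists>v\<in>V. \<exists>r<R. s = (par v, v, bc r) \<or> s = (v, par v, echo v r)" if "s \<in> S'" for s
      using that r pA by (auto simp: S'_def split: if_splits)
  qed
qed

text \<open>The echo that completes a round. The message in transit was then the only one, so the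
  next round starts from empty \<open>A\<close> and \<open>E\<close>.\<close>

lemma state_deliver_up_root:
  assumes concludes: concludes and st: "state r A E C" and d: "deliverable C (k, t)" and r: "r < R"
    and m: "triple (sent C ! k) = (c, par c, echo c r)" and c: "c \<in> A - E" "ch c \<subseteq> E"
    and px: "par c = x" and complete: "ch x \<subseteq> insert c E"
  shows "state (Suc r) {} {} (deliver (echo_procedure val strat) N x err \<omega> (k, t) C)"
proof -
  define h where "h = histories C x @ [(c, echo c r)]"
  define S' where "S' = Pend (Suc r) {} {}"
  note st' = st[unfolded state_def]
  have AV: "A \<subseteq> V" and EA: "E \<subseteq> A" and cE: "\<And>v. v \<in> E \<Longrightarrow> ch v \<subseteq> E"
    using st' by auto
  have down: "stream (par w) (histories C w) = map bc [0..<(if w \<in> A then Suc r else r)]" if "w \<in> V" for w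
    using st' that by auto
  have up: "stream w (histories C (par w)) = map (echo w) [0..<(if w \<in> E then Suc r else r)]" if "w \<in> V" for w
    using st' that by auto
  have cV: "c \<in> V" "c \<in> A" "c \<notin> E"
    using c AV by auto
  \<comment> \<open>All children of the initiator are in \<open>insert c E\<close>, which is closed
    under children, so going down the tree reaches every node.\<close>
  have "v \<in> insert c E" if "v \<in> V" for v
    using that
  proof (induction v rule: tree_induct)
    case (step v)
    then show ?case
      using par_cases[OF step.hyps] complete c(2) cE by (auto simp: ch_def)
  qed
  then have V: "V = insert c E" "A = V"
    using AV EA cV by auto
  have E: "E = V - {c}"
    using V cV by auto
  have up_h: "stream w h = map (echo w) [0..<Suc r]" if "w \<in> ch x" for w
    using up[of w] that cV V by (auto simp: h_def stream_snoc ch_def)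
  have S'_mset: "mset (map (\<lambda>(w, b). (x, w, b)) (sends (echo_procedure val strat) (I x) (\<omega> x) h)) = mset_set S'"
    using sends_root[OF concludes, of "Suc r" h] r up_h mset_new_round[of "Suc r"] by (simp add: S'_def)
  have P0: "Pend r A E - {(c, x, echo c r)} = {}"
    using V px by (auto simp: Pend_def)
  show ?thesis
  proof (rule state_deliver_aux[OF st d m[unfolded px] h_def, of "echo_procedure val strat" S'])
    show "mset (map (\<lambda>(w, b). (x, w, b)) (sends (echo_procedure val strat) (I x) (\<omega> x) h)) = mset_set S'"
      by (rule S'_mset)
    show "finite S'" by (simp add: S'_def finite_Pend)
    show "(Pend r A E - {(c, x, echo c r)}) \<inter> S' = {}" by (simp only: P0) simp
    show "Pend (Suc r) {} {} = (Pend r A E - {(c, x, echo c r)}) \<union> S'"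
      by (simp only: P0 S'_def) simp
    show "2 * card V * Suc r + card ({} :: nat set) + card ({} :: nat set) = Suc (2 * card V * r + card A + card E)"
    proof -
      have "card V = Suc (card E)"
        using V(1) cV(3) finite_V by (metis card_insert_disjoint finite_insert)
      then show ?thesis using V(2) by simp
    qed
    show "stream (par w) (histories C w) @ (if w = x \<and> c = par w then [echo c r] else []) =
        map bc [0..<(if w \<in> {} then Suc (Suc r) else Suc r)]" if "w \<in> V" for w
      using down[OF that] V_x[OF that] that V by auto
    show "stream w (histories C (par w)) @ (if par w = x \<and> c = w then [echo c r] else []) =
        map (echo w) [0..<(if w \<in> {} then Suc (Suc r) else Suc r)]" if "w \<in> V" for w
      using up[OF that] that px E by auto
    show "\<exists>v\<in>V. \<exists>r<R. s = (par v, v, bc r) \<or> s = (v, par v, echo v r)" if "s \<in> S'" for s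
      using that by (auto simp: S'_def Pend_def split: if_splits)
  qed (use r ch_x in auto)
qed

lemma state_deliver:
  assumes concludes: concludes and st: "state r A E C" and d: "deliverable C d"
  shows "\<exists>r' A' E'. state r' A' E' (deliver (echo_procedure val strat) N x err \<omega> d C)"
proof -
  obtain k t where kt: "d = (k, t)" by (cases d)
  have d': "deliverable C (k, t)" using d kt by simp
  have "triple (sent C ! k) \<in># pending C"
    using d' by (auto simp: pending_def deliverable_def)
  then have "triple (sent C ! k) \<in> Pend r A E"
    using st finite_Pend by (simp add: state_def)
  then consider (down) v where "r < R" "triple (sent C ! k) = (par v, v, bc r)" "v \<in> V - A" "par v \<in> insert x A"
    | (up) c where "r < R" "triple (sent C ! k) = (c, par c, echo c r)" "c \<in> A - E" "ch c \<subseteq> E"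
    by (auto simp: Pend_def split: if_splits)
  then show ?thesis
  proof cases
    case down
    show ?thesis
      unfolding kt using state_deliver_down[OF st d' down] by blast
  next
    case up
    show ?thesis
    proof (cases "par c \<noteq> x \<or> \<not> ch x \<subseteq> insert c E")
      case True
      then show ?thesis
        unfolding kt using state_deliver_up_inner[OF st d' up] by blast
    next
      case False
      then show ?thesis
        unfolding kt using state_deliver_up_root[OF concludes st d' up] by blast
    qed
  qed
qed

section \<open>Consequences of the invariant: message bound, termination, output\<close>

lemma finite_received: "state r A E C \<Longrightarrow> finite (received C)"
  by (rule finite_subset[of _ "{..<length (sent C)}"]) (auto simp: state_def)

lemma state_execution:
  assumes concludes and ex: "is_execution (echo_procedure val strat) N x err \<omega> \<rho>"
  shows "\<exists>r A E. state r A E (\<rho> i)"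
proof (induction i)
  case 0
  then show ?case using state_initial[OF assms(1)] ex by (auto simp: is_execution_def)
next
  case (Suc i)
  then obtain r A E where st: "state r A E (\<rho> i)" by blast
  show ?case
    using execution_step[OF ex, of i] state_deliver[OF assms(1) st] st by (auto split: if_splits)
qed

text \<open>In one round each node of \<open>V\<close> is charged once for the broadcast and once
  for the echo, whether received or in transit.\<close>

lemma card_Pend: "A \<subseteq> V \<Longrightarrow> E \<subseteq> A \<Longrightarrow> card (Pend r A E) + card A + card E \<le> (if r < R then 2 * card V else card A + card E)"
proof -
  assume A: "A \<subseteq> V" and E: "E \<subseteq> A"
  have fA: "finite A" using A finite_V finite_subset by blast
  have card_Diff: "card (V - B) + card B = card V" if "B \<subseteq> V" for B
    using card_mono[OF finite_V that] finite_subset[OF that finite_V] by (simp add: card_Diff_subset that)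
  have 1: "card {v \<in> V - A. par v \<in> insert x A} \<le> card (V - A)" "card (V - A) + card A = card V"
    using card_Diff[OF A] by (auto intro: card_mono[OF finite_Diff[OF finite_V]])
  have "{v \<in> A - E. ch v \<subseteq> E} \<subseteq> V - E" using A by auto
  then have 2: "card {v \<in> A - E. ch v \<subseteq> E} \<le> card (V - E)" "card (V - E) + card E = card V"
    using card_Diff[of E] A E by (auto intro: card_mono[OF finite_Diff[OF finite_V]])
  show ?thesis
  proof (cases "r < R")
    case True
    have "card (Pend r A E) \<le> card {v \<in> V - A. par v \<in> insert x A} + card {v \<in> A - E. ch v \<subseteq> E}"
      unfolding Pend_def using True finite_V fA
      by (simp, intro order.trans[OF card_Un_le] add_mono card_image_le) auto
    then show ?thesis using 1 2 True by simp
  qed (simp add: Pend_def)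
qed

lemma length_sent_le:
  assumes "state r A E C"
  shows "length (sent C) \<le> 2 * card V * R"
proof -
  have "length (sent C) = card (received C) + size (pending C)"
    using assms by (intro length_sent) (simp add: state_def)
  also have "\<dots> = 2 * card V * r + (card (Pend r A E) + card A + card E)"
    using assms finite_Pend by (simp add: state_def)
  also have "\<dots> \<le> 2 * card V * R"
  proof (cases "r < R")
    case True
    then have "2 * card V * r + 2 * card V \<le> 2 * card V * R"
      using mult_le_mono2[of "Suc r" R "2 * card V"] by simp
    then show ?thesis using card_Pend[of A E r] assms True by (simp add: state_def)
  next
    case False
    then have "r = R" "A = {}" "E = {}" using assms by (auto simp: state_def)
    then show ?thesis by (simp add: Pend_def)
  qed
  finally show ?thesis .
qed

text \<open>With nothing in transit the broadcast must have reached every node, by induction down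
  the tree, and then all echoes must have arrived, by induction up the tree. A round in that state
  would already have been closed.\<close>

lemma quiescent_state:
  assumes "state r A E C" "quiescent C"
  shows "r = R"
proof (rule ccontr)
  assume "r \<noteq> R"
  with assms have r: "r < R" and AV: "A \<subseteq> V" and EA: "E \<subseteq> A" and xE: "\<not> ch x \<subseteq> E"
    by (auto simp: state_def)
  have "pending C = mset_set (Pend r A E)" using assms by (simp add: state_def)
  then have P: "Pend r A E = {}"
    using assms(2) finite_Pend[OF AV] by (simp add: quiescent_iff_pending mset_set_empty_iff)
  have A: "v \<in> A" if "v \<in> V" for v
    using that
  proof (induction v rule: tree_induct)
    case (step v)
    then have "par v \<in> insert x A" using par_cases by auto
    then show ?case using P r step.hyps by (auto simp: Pend_def)
  qed
  have "v \<in> E" if "v \<in> V" for v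
    using that
  proof (induction v rule: tree_coinduct)
    case (step v)
    then have "ch v \<subseteq> E" by auto
    then show ?case using P r A[OF step.hyps] by (auto simp: Pend_def)
  qed
  then show False using xE by (auto simp: ch_def)
qed

text \<open>Between rounds the strategy is consulted on \<open>ts r\<close>, which yields a result
  only for \<open>r = R\<close>; within a round the children disagree in their counts and the
  initiator is silent.\<close>

lemma output_state:
  assumes concludes and "state r A E C"
  shows "output_at (echo_procedure val strat) N x err \<omega> C = (if r = R then Some out else None)"
proof -
  have up: "stream c (histories C x) = map (echo c) [0..<(if c \<in> E then Suc r else r)]" if "c \<in> ch x" for c
    using assms(2) that by (auto simp: state_def ch_def)
  have r: "r \<le> R" and xE: "\<not> ch x \<subseteq> E" and E: "r = R \<Longrightarrow> E = {}" using assms(2) by (auto simp: state_def)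
  show ?thesis
  proof (cases "ch x \<inter> E = {}")
    case True
    have "root_step val strat (I x) (\<omega> x) (histories C x) = Some (strat (I x) (\<omega> x) (ts r))"
      by (rule root_step_complete) (use up True in auto)
    then show ?thesis
      using assms(1) r children by (cases "r = R") (auto simp: output_at_def echo_procedure_def concludes_def)
  next
    case False
    then obtain c c' where c: "c \<in> ch x" "c \<in> E" "c' \<in> ch x" "c' \<notin> E" using xE by auto
    have "root_step val strat (I x) (\<omega> x) (histories C x) = None"
      by (rule root_step_incomplete[OF up c])
    moreover have "r \<noteq> R" using E c by auto
    ultimately show ?thesis using children by (simp add: output_at_def echo_procedure_def)
  qed
qed

text \<open>Every step before quiescence receives a new message, while the number of messages ever
  sent is bounded.\<close>

lemma execution_quiescent:
  assumes concludes and ex: "is_execution (echo_procedure val strat) N x err \<omega> \<rho>"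
  shows "\<exists>i. quiescent (\<rho> i)"
proof (rule ccontr)
  assume nq: "\<not> ?thesis"
  have "i \<le> card (received (\<rho> i))" for i
  proof (induction i)
    case (Suc i)
    obtain k t where d: "deliverable (\<rho> i) (k, t)"
      "\<rho> (Suc i) = deliver (echo_procedure val strat) N x err \<omega> (k, t) (\<rho> i)"
      using execution_step[OF ex, of i] nq by auto
    have "finite (received (\<rho> i))"
      using state_execution[OF assms, of i] finite_received by blast
    then show ?case
      using Suc d by (simp add: deliver_def deliverable_def Let_def)
  qed simp
  moreover have "card (received (\<rho> i)) \<le> 2 * card V * R" for i
  proof -
    obtain r A E where st: "state r A E (\<rho> i)" using state_execution[OF assms] by blast
    then have "received (\<rho> i) \<subseteq> {..<length (sent (\<rho> i))}"
      by (simp add: state_def)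
    then have "card (received (\<rho> i)) \<le> length (sent (\<rho> i))"
      using card_mono[of "{..<length (sent (\<rho> i))}" "received (\<rho> i)"] by simp
    then show ?thesis using length_sent_le[OF st] by simp
  qed
  ultimately show False
    by (meson Suc_n_not_le_n order.trans)
qed

lemma execution_returns:
  assumes concludes and ex: "is_execution (echo_procedure val strat) N x err \<omega> \<rho>"
  shows "returns (echo_procedure val strat) N x err \<omega> \<rho> out"
proof -
  let ?o = "\<lambda>i. output_at (echo_procedure val strat) N x err \<omega> (\<rho> i)"
  obtain i where i: "quiescent (\<rho> i)" using execution_quiescent[OF assms] by blast
  obtain r A E where st: "state r A E (\<rho> i)" using state_execution[OF assms] by blast
  have ex_i: "?o i = Some out"
    using output_state[OF assms(1) st] quiescent_state[OF st i] by simp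
  have vals: "?o i = None \<or> ?o i = Some out" for i
    using state_execution[OF assms, of i] output_state[OF assms(1)] by (metis (full_types))
  define j where "j = (LEAST i. ?o i = Some out)"
  have "?o j = Some out" unfolding j_def by (rule LeastI[of _ i]) (rule ex_i)
  moreover have "?o l = None" if "l < j" for l
    using not_less_Least[of l] that vals[of l] unfolding j_def by blast
  ultimately show ?thesis unfolding returns_def by blast
qed

lemma execution_message_count:
  assumes concludes and ex: "is_execution (echo_procedure val strat) N x err \<omega> \<rho>"
  shows "message_count \<rho> \<le> of_nat (2 * card V * R)"
  unfolding message_count_def
proof (rule SUP_least)
  fix i
  obtain r A E where "state r A E (\<rho> i)" using state_execution[OF assms] by blast
  then show "of_nat (length (sent (\<rho> i))) \<le> (of_nat (2 * card V * R) :: ennreal)"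
    using length_sent_le of_nat_mono by blast
qed

lemma execution_legal:
  assumes concludes and ex: "is_execution (echo_procedure val strat) N x err \<omega> \<rho>"
    and marks: "\<And>v. v \<in> T \<Longrightarrow> marks N v \<subseteq> edges N"
    and L: "\<And>r. r < R \<Longrightarrow> length (bc r) \<le> L"
       "\<And>r v. r < R \<Longrightarrow> v \<in> T \<Longrightarrow> length (val (I v) (bc r)) \<le> L"
    and b: "real L \<le> b"
  shows "messages_legal N b \<rho>"
  unfolding messages_legal_def
proof (intro allI ballI)
  fix i m assume m: "m \<in> set (sent (\<rho> i))"
  obtain r' A E where "state r' A E (\<rho> i)" using state_execution[OF assms(1,2)] by blast
  with m obtain v r where vr: "v \<in> V" "r < R"
    "triple m = (par v, v, bc r) \<or> triple m = (v, par v, echo v r)"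
    unfolding state_def by blast
  have "{par v, v} \<in> edges N"
    using par[of v] V_T[OF vr(1)] V_x[OF vr(1)] marks[of v] nb_eq[of v] by (auto simp: insert_commute)
  moreover have "length (echo v r) \<le> L"
    unfolding echo_def by (rule length_agg_le) (use L(2) vr V_T in auto)
  then have "length (content m) \<le> L"
    using vr L(1)[OF vr(2)] by (auto simp: triple_def)
  ultimately show "{source m, target m} \<in> edges N \<and> real (length (content m)) \<le> b"
    using vr(3) b by (auto simp: triple_def insert_commute)
qed

end


section \<open>Time against messages\<close>

lemma clock_le_received:
  assumes ex: "is_execution P N x err \<omega> \<rho>"
  shows "clock (\<rho> i) \<le> real (card (received (\<rho> i))) \<and> received (\<rho> i) \<subseteq> {..<length (sent (\<rho> i))} \<and>
    (\<forall>m\<in>set (sent (\<rho> i)). sent_at m \<le> clock (\<rho> i))"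
proof (induction i)
  case 0
  have "\<rho> 0 = initial P N x err \<omega>" using ex by (simp add: is_execution_def)
  then show ?case by (auto simp: initial_def act_def)
next
  case (Suc i)
  note step = execution_step[OF ex, of i]
  show ?case
  proof (cases "quiescent (\<rho> i)")
    case True
    then show ?thesis using step Suc by simp
  next
    case False
    with step obtain k t where d: "deliverable (\<rho> i) (k, t)" and e: "\<rho> (Suc i) = deliver P N x err \<omega> (k, t) (\<rho> i)"
      by auto
    have k: "k < length (sent (\<rho> i))" "k \<notin> received (\<rho> i)" "clock (\<rho> i) \<le> t" "t \<le> sent_at (sent (\<rho> i) ! k) + 1"
      using d by (auto simp: deliverable_def)
    \<comment> \<open>The delivered message was sent no later than the current clock, so
      \<open>t\<close> exceeds the clock by at most one; the new element of \<open>received\<close>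
      pays for it.\<close>
    have "sent_at (sent (\<rho> i) ! k) \<le> clock (\<rho> i)" using Suc k by simp
    moreover have "finite (received (\<rho> i))" using Suc finite_subset by blast
    moreover have "sent_at m \<le> t" if "m \<in> set (sent (\<rho> i))" for m
      using Suc that k(3) by force
    moreover from calculation(1) have "t \<le> 1 + real (card (received (\<rho> i)))"
      using Suc k by linarith
    ultimately show ?thesis
      unfolding e using Suc k by (auto simp: deliver_def Let_def act_def)
  qed
qed

lemma running_time_le_message_count:
  assumes "is_execution P N x err \<omega> \<rho>"
  shows "running_time \<rho> \<le> message_count \<rho>"
  unfolding running_time_def message_count_def
proof (rule SUP_mono)
  fix i
  have "card (received (\<rho> i)) \<le> length (sent (\<rho> i))"
    using clock_le_received[OF assms, of i] card_mono[of "{..<length (sent (\<rho> i))}"] by auto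
  then have "clock (\<rho> i) \<le> real (length (sent (\<rho> i)))"
    using clock_le_received[OF assms, of i] by linarith
  then have "ennreal (clock (\<rho> i)) \<le> of_nat (length (sent (\<rho> i)))"
    by (simp add: ennreal_leI flip: ennreal_of_nat_eq_real_of_nat)
  then show "\<exists>j\<in>UNIV. ennreal (clock (\<rho> i)) \<le> of_nat (length (sent (\<rho> j)))" by blast
qed


section \<open>A pairwise independent hash family\<close>

definition hash :: "nat \<Rightarrow> nat \<Rightarrow> nat \<Rightarrow> nat \<Rightarrow> nat" where
  "hash W s t y = (s * y + t) mod 2 ^ W"

lemma bij_betw_affine_mod:
  fixes u P a :: nat
  assumes "coprime u P" "0 < P"
  shows "bij_betw (\<lambda>s. (a + s * u) mod P) {..<P} {..<P}"
proof -
  have *: "s = s'" if "s \<le> s'" "s' < P" "(a + s * u) mod P = (a + s' * u) mod P" for s s'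
  proof -
    have "P dvd (a + s' * u) - (a + s * u)"
      using that by (subst mod_eq_dvd_iff_nat[symmetric]) simp_all
    also have "(a + s' * u) - (a + s * u) = (s' - s) * u"
      by (simp add: diff_mult_distrib)
    finally have "P dvd s' - s"
      using assms by (simp add: coprime_commute coprime_dvd_mult_left_iff)
    then show ?thesis
      using that dvd_imp_le[of P "s' - s"] by (cases "s' - s = 0") auto
  qed
  have "inj_on (\<lambda>s. (a + s * u) mod P) {..<P}"
  proof (rule inj_onI)
    fix s s' assume "s \<in> {..<P}" "s' \<in> {..<P}" "(a + s * u) mod P = (a + s' * u) mod P"
    then show "s = s'"
      using *[of s s'] *[of s' s] by (cases "s \<le> s'") auto
  qed
  moreover have "(\<lambda>s. (a + s * u) mod P) ` {..<P} \<subseteq> {..<P}"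
    using assms by auto
  ultimately show ?thesis
    by (simp add: bij_betw_def endo_inj_surj)
qed

lemma card_bij_less:
  fixes f :: "nat \<Rightarrow> nat"
  assumes "bij_betw f {..<P} {..<P}" "\<theta> \<le> P"
  shows "card {s \<in> {..<P}. f s < \<theta>} = \<theta>"
proof -
  have "bij_betw f {s \<in> {..<P}. f s < \<theta>} {..<\<theta>}"
    unfolding bij_betw_def
  proof
    show "inj_on f {s \<in> {..<P}. f s < \<theta>}"
      using assms by (auto simp: bij_betw_def intro: inj_on_subset)
    show "f ` {s \<in> {..<P}. f s < \<theta>} = {..<\<theta>}"
    proof
      show "{..<\<theta>} \<subseteq> f ` {s \<in> {..<P}. f s < \<theta>}"
      proof
        fix y assume y: "y \<in> {..<\<theta>}"
        then have "y \<in> f ` {..<P}" using assms by (auto simp: bij_betw_def)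
        then show "y \<in> f ` {s \<in> {..<P}. f s < \<theta>}" using y by auto
      qed
    qed auto
  qed
  from bij_betw_same_card[OF this] show ?thesis by simp
qed

lemma card_periodic:
  fixes c P :: nat
  assumes "0 < P"
  shows "card {s \<in> {..<c * P}. Q (s mod P)} = c * card {s \<in> {..<P}. Q s}"
proof -
  have "bij_betw (\<lambda>(q, r). q * P + r) ({..<c} \<times> {s \<in> {..<P}. Q s}) {s \<in> {..<c * P}. Q (s mod P)}"
  proof (rule bij_betw_byWitness[where f' = "\<lambda>s. (s div P, s mod P)"])
    show "(\<lambda>(q, r). q * P + r) ` ({..<c} \<times> {s \<in> {..<P}. Q s}) \<subseteq> {s \<in> {..<c * P}. Q (s mod P)}"
    proof -
      have "q * P + r < c * P" if "q < c" "r < P" for q r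
      proof -
        have "q * P + r < Suc q * P" using that by simp
        also have "\<dots> \<le> c * P" using that by (intro mult_le_mono1) simp
        finally show ?thesis .
      qed
      then show ?thesis by auto
    qed
    show "(\<lambda>s. (s div P, s mod P)) ` {s \<in> {..<c * P}. Q (s mod P)} \<subseteq> {..<c} \<times> {s \<in> {..<P}. Q s}"
      using assms by (auto simp: less_mult_imp_div_less)
    show "\<forall>p\<in>{..<c} \<times> {s \<in> {..<P}. Q s}.
        (\<lambda>s. (s div P, s mod P)) ((\<lambda>(q, r). q * P + r) p) = p"
      using assms by (auto simp: div_mult_self3)
    show "\<forall>s\<in>{s \<in> {..<c * P}. Q (s mod P)}. (\<lambda>(q, r). q * P + r) (s div P, s mod P) = s"
      by simp
  qed
  from bij_betw_same_card[OF this] show ?thesis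
    by (simp add: card_cartesian_product)
qed

text \<open>Write \<open>\<delta>\<close> as \<open>2 ^ k * u\<close> with \<open>u\<close> odd. The
  low \<open>k\<close> bits of \<open>A + s * \<delta>\<close> do not depend on \<open>s\<close>,
  and the remaining ones run uniformly because \<open>u\<close> is invertible. The threshold
  \<open>2 ^ j\<close> is a multiple of \<open>2 ^ k\<close>, so the fixed low bits do not affect
  the comparison.\<close>

lemma card_multiples_less:
  assumes \<delta>: "0 < \<delta>" "\<delta> < 2 ^ w" and j: "w \<le> j" "j \<le> W"
  shows "card {s \<in> {..<2 ^ W}. (A + s * \<delta>) mod 2 ^ W < (2 :: nat) ^ j} = 2 ^ j"
proof -
  obtain u where u: "\<delta> = 2 ^ multiplicity 2 \<delta> * u" "odd u"
    by (rule multiplicity_decompose'[of \<delta> 2]) (use \<delta> in auto)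
  define k where "k = multiplicity 2 \<delta>"
  have ku: "\<delta> = 2 ^ k * u" "odd u"
    using u by (simp_all add: k_def)
  have "2 ^ k \<le> \<delta>" using ku \<delta> by (cases u) auto
  \<comment> \<open>This is where thresholds must start at \<open>2 ^ w\<close>: \<open>k\<close>
    stays below \<open>w\<close>, hence below \<open>j\<close>.\<close>
  then have "k < w"
    using \<delta>(2) by (metis le_less_trans nat_power_less_imp_less pos2)
  then have k: "k \<le> j" "k \<le> W" using j by auto
  define P where "P = (2 :: nat) ^ (W - k)"
  have W: "2 ^ W = 2 ^ k * P" and Pj: "(2 :: nat) ^ j = 2 ^ k * 2 ^ (j - k)"
    using k by (simp_all add: P_def flip: power_add)
  define a b where "a = A div 2 ^ k" and "b = A mod 2 ^ k"
  have eq: "(A + s * \<delta>) mod 2 ^ W = 2 ^ k * ((a + s * u) mod P) + b" for s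
  proof -
    have "A + s * \<delta> = 2 ^ k * (a + s * u) + b"
      by (simp add: a_def b_def ku algebra_simps)
    moreover have "b < 2 ^ k" by (simp add: b_def)
    ultimately show ?thesis
      unfolding W by (simp add: mod_mult2_eq)
  qed
  have lt: "2 ^ k * q + b < 2 ^ k * 2 ^ (j - k) \<longleftrightarrow> q < 2 ^ (j - k)" for q
  proof
    assume "2 ^ k * q + b < 2 ^ k * 2 ^ (j - k)"
    then have "2 ^ k * q < 2 ^ k * 2 ^ (j - k)" by linarith
    then show "q < 2 ^ (j - k)" by simp
  next
    assume "q < 2 ^ (j - k)"
    then have "2 ^ k * Suc q \<le> 2 ^ k * 2 ^ (j - k)" by (intro mult_le_mono2) simp
    moreover have "b < 2 ^ k" by (simp add: b_def)
    ultimately show "2 ^ k * q + b < 2 ^ k * 2 ^ (j - k)" by simp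
  qed
  have set: "{s \<in> {..<2 ^ W}. (A + s * \<delta>) mod 2 ^ W < (2 :: nat) ^ j} =
      {s \<in> {..<2 ^ k * P}. (a + s mod P * u) mod P < 2 ^ (j - k)}"
  proof -
    have "(a + s mod P * u) mod P = (a + s * u) mod P" for s
      by (metis mod_add_right_eq mod_mult_left_eq)
    then show ?thesis unfolding eq Pj lt unfolding W by simp
  qed
  have "0 < P" by (simp add: P_def)
  have period: "card {s \<in> {..<2 ^ k * P}. (a + s mod P * u) mod P < 2 ^ (j - k)} =
      2 ^ k * card {s \<in> {..<P}. (a + s * u) mod P < 2 ^ (j - k)}"
    by (rule card_periodic[OF \<open>0 < P\<close>])
  have "coprime u P" "2 ^ (j - k) \<le> P"
    using ku(2) j by (auto simp: P_def)
  then have "card {s \<in> {..<P}. (a + s * u) mod P < 2 ^ (j - k)} = 2 ^ (j - k)"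
    by (intro card_bij_less[OF bij_betw_affine_mod] \<open>0 < P\<close>)
  then show ?thesis unfolding set period using Pj by simp
qed

text \<open>For each fixed \<open>s\<close> the shift \<open>t\<close> alone makes the hash value
  uniform.\<close>

lemma card_hash_less:
  assumes "j \<le> W"
  shows "card {(s, t) \<in> {..<2 ^ W} \<times> {..<2 ^ W}. hash W s t y < 2 ^ j} = 2 ^ W * 2 ^ j"
proof -
  have set: "{(s, t) \<in> {..<2 ^ W} \<times> {..<2 ^ W}. hash W s t y < 2 ^ j} =
      (SIGMA s:{..<2 ^ W}. {t \<in> {..<2 ^ W}. (s * y + t * 1) mod 2 ^ W < 2 ^ j})"
    by (auto simp: hash_def)
  have "card {t \<in> {..<2 ^ W}. (s * y + t * 1) mod 2 ^ W < 2 ^ j} = 2 ^ j" for s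
    by (rule card_bij_less[OF bij_betw_affine_mod]) (use assms in simp_all)
  then show ?thesis
    unfolding set by (subst card_SigmaI) simp_all
qed

text \<open>Replace the seed \<open>(s, t)\<close> by \<open>s\<close> and the hash value
  \<open>A\<close> of \<open>y\<close>. The value of \<open>y'\<close> is then
  \<open>A + s * (y' - y)\<close>, and \<open>card_multiples_less\<close> counts the admissible
  \<open>s\<close> for each \<open>A\<close>.\<close>

lemma card_hash_less2:
  assumes y: "y < y'" "y' < 2 ^ w" and j: "w \<le> j" "j \<le> W"
  shows "card {(s, t) \<in> {..<2 ^ W} \<times> {..<2 ^ W}. hash W s t y < 2 ^ j \<and> hash W s t y' < 2 ^ j} \<le> 2 ^ j * 2 ^ j"
proof -
  let ?B = "{(s, t) \<in> {..<2 ^ W} \<times> {..<2 ^ W}. hash W s t y < 2 ^ j \<and> hash W s t y' < 2 ^ j}"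
  let ?C = "SIGMA A:{..<2 ^ j}. {s \<in> {..<2 ^ W}. (A + s * (y' - y)) mod 2 ^ W < 2 ^ j}"
  have B: "card ?B \<le> card ?C"
  proof (rule card_inj_on_le[where f = "\<lambda>(s, t). (hash W s t y, s)"])
    show "inj_on (\<lambda>(s, t). (hash W s t y, s)) ?B"
    proof (rule inj_onI)
      fix p p' assume p: "p \<in> ?B" "p' \<in> ?B"
        and e: "(\<lambda>(s, t). (hash W s t y, s)) p = (\<lambda>(s, t). (hash W s t y, s)) p'"
      obtain s t s' t' where st: "p = (s, t)" "p' = (s', t')"
        by (metis surj_pair)
      have s: "s = s'" and t: "t < 2 ^ W" "t' < 2 ^ W"
        and "(s * y + t * 1) mod 2 ^ W = (s * y + t' * 1) mod 2 ^ W"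
        using p e by (auto simp: st hash_def)
      moreover have "inj_on (\<lambda>t. (s * y + t * 1) mod 2 ^ W) {..<2 ^ W}"
        using bij_betw_affine_mod[of 1 "2 ^ W" "s * y"] by (simp add: bij_betw_def)
      ultimately have "t = t'"
        by (meson inj_onD lessThan_iff)
      then show "p = p'" by (simp add: st s)
    qed
    have "(hash W s t y + s * (y' - y)) mod 2 ^ W = hash W s t y'" for s t
    proof -
      have "s * y' = s * y + s * (y' - y)"
        using y by (simp flip: add_mult_distrib2)
      then show ?thesis by (simp add: hash_def mod_simps algebra_simps)
    qed
    then show "(\<lambda>(s, t). (hash W s t y, s)) ` ?B \<subseteq> ?C" by auto
    show "finite ?C" by (intro finite_SigmaI) auto
  qed
  have "card {s \<in> {..<2 ^ W}. (A + s * (y' - y)) mod 2 ^ W < 2 ^ j} = 2 ^ j" for A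
    by (rule card_multiples_less[OF _ _ j]) (use y in auto)
  then have "card ?C = 2 ^ j * 2 ^ j"
    by (subst card_SigmaI) simp_all
  with B show ?thesis by simp
qed

text \<open>Take the last doubling of \<open>m\<close> that does not exceed half of
  \<open>2 ^ w\<close>; one more would, so it exceeds a quarter.\<close>

lemma ex_isolating_scale:
  fixes m w :: nat
  assumes "1 \<le> m" "2 * m \<le> 2 ^ w"
  shows "\<exists>i<w. 2 * (m * 2 ^ i) \<le> 2 ^ w \<and> 2 ^ w < 4 * (m * 2 ^ i)"
proof -
  define k where "k = (LEAST i. 2 ^ w < 2 * (m * 2 ^ i))"
  have k: "2 ^ w < 2 * (m * 2 ^ k)"
    unfolding k_def by (rule LeastI[of _ w]) (use assms in \<open>simp add: Suc_le_eq\<close>)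
  then have "k \<noteq> 0" using assms by (cases k) auto
  then obtain i where i: "k = Suc i" by (cases k) auto
  then have le: "2 * (m * 2 ^ i) \<le> 2 ^ w"
    using not_less_Least[of i "\<lambda>i. 2 ^ w < 2 * (m * 2 ^ i)"] by (simp add: k_def)
  have "(2::nat) ^ i < 2 ^ w"
  proof -
    have "(2::nat) ^ i < 2 * (1 * 2 ^ i)" by simp
    also have "\<dots> \<le> 2 * (m * 2 ^ i)" using assms by (intro mult_le_mono) auto
    finally show ?thesis using le by linarith
  qed
  then have "i < w" by simp
  then show ?thesis using le k i by (intro exI[of _ i]) simp
qed

text \<open>The number \<open>Z\<close> of elements of \<open>X\<close> below a threshold satisfies \<open>[Z = 1] \<ge> 2 Z - Z\<^sup>2\<close>;
  the first two moments of \<open>Z\<close> are known by pairwise independence, and some threshold makes the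
  expectation of \<open>Z\<close> lie between 1/4 and 1/2.\<close>

lemma card_isolating_ge:
  assumes X: "X \<subseteq> {..<2 ^ w}" "X \<noteq> {}" "2 * card X \<le> 2 ^ w"
  shows "3 * 2 ^ (4 * w) \<le> 16 * card {(s, t) \<in> {..<2 ^ (2 * w)} \<times> {..<2 ^ (2 * w)}.
     \<exists>j<2 * w. card {y \<in> X. hash (2 * w) s t y < 2 ^ j} = 1}"
proof -
  define m where "m = card X"
  have finX: "finite X" using X finite_subset by blast
  then have m1: "1 \<le> m" using X by (simp add: m_def card_gt_0_iff Suc_le_eq)
  obtain i where i: "i < w" "2 * (m * 2 ^ i) \<le> 2 ^ w" "2 ^ w < 4 * (m * 2 ^ i)"
    using ex_isolating_scale[OF m1] X(3) by (auto simp: m_def)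
  define W j where "W = 2 * w" and "j = w + i"
  \<comment> \<open>With hash width \<open>2 * w\<close> and \<open>j = w + i\<close>, a hash value
    lies below \<open>2 ^ j\<close> with probability \<open>2 ^ i / 2 ^ w\<close>, so the mean is
    \<open>m * 2 ^ i / 2 ^ w\<close>.\<close>
  have j: "w \<le> j" "j < W" "j \<le> W" using i by (auto simp: W_def j_def)
  define \<Omega> where "\<Omega> = {..<(2::nat) ^ W} \<times> {..<(2::nat) ^ W}"
  define B where "B y = {p \<in> \<Omega>. hash W (fst p) (snd p) y < 2 ^ j}" for y
  define Z where "Z p = card {y \<in> X. hash W (fst p) (snd p) y < 2 ^ j}" for p
  define G where "G = {p \<in> \<Omega>. Z p = 1}"
  have fin\<Omega>: "finite \<Omega>" by (simp add: \<Omega>_def)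
  have Zsum: "real (Z p) = (\<Sum>y\<in>X. of_bool (p \<in> B y))" if "p \<in> \<Omega>" for p
    using that finX by (simp add: Z_def B_def sum.If_cases Int_def of_bool_def)
  have cB: "real (card (B y)) = 2 ^ W * 2 ^ j" for y
  proof -
    have "B y = {(s, t) \<in> {..<2 ^ W} \<times> {..<2 ^ W}. hash W s t y < 2 ^ j}"
      by (auto simp: B_def \<Omega>_def)
    then show ?thesis using card_hash_less[OF j(3), of y] by simp
  qed
  have cBB: "real (card (B y \<inter> B y')) \<le> 2 ^ j * 2 ^ j" if "y \<in> X" "y' \<in> X" "y \<noteq> y'" for y y'
  proof -
    have *: "card (B y \<inter> B y') \<le> 2 ^ j * 2 ^ j" if "y < y'" "y' \<in> X" for y y'
    proof -
      have "B y \<inter> B y' = {(s, t) \<in> {..<2 ^ W} \<times> {..<2 ^ W}. hash W s t y < 2 ^ j \<and> hash W s t y' < 2 ^ j}"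
        by (auto simp: B_def \<Omega>_def)
      then show ?thesis using card_hash_less2[OF that(1) _ j(1,3)] that X by auto
    qed
    have "card (B y \<inter> B y') \<le> 2 ^ j * 2 ^ j"
      using *[of y y'] *[of y' y] that by (cases "y < y'") (auto simp: Int_commute)
    then have "real (card (B y \<inter> B y')) \<le> real (2 ^ j * 2 ^ j)"
      by (rule of_nat_mono)
    then show ?thesis by simp
  qed
  have sumB: "(\<Sum>p\<in>\<Omega>. of_bool (p \<in> S)) = real (card S)" if "S \<subseteq> \<Omega>" for S
    using that fin\<Omega> by (simp add: sum.If_cases of_bool_def Int_absorb1)
  have Bsub: "B y \<subseteq> \<Omega>" for y by (auto simp: B_def)
  have mom1: "(\<Sum>p\<in>\<Omega>. real (Z p)) = real m * (2 ^ W * 2 ^ j)"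
  proof -
    have "(\<Sum>p\<in>\<Omega>. real (Z p)) = (\<Sum>p\<in>\<Omega>. \<Sum>y\<in>X. of_bool (p \<in> B y))"
      by (intro sum.cong) (auto simp: Zsum)
    also have "\<dots> = (\<Sum>y\<in>X. \<Sum>p\<in>\<Omega>. of_bool (p \<in> B y))"
      by (rule sum.swap)
    also have "\<dots> = (\<Sum>y\<in>X. 2 ^ W * 2 ^ j)"
      by (intro sum.cong refl) (simp only: sumB[OF Bsub] cB)
    finally show ?thesis by (simp add: m_def)
  qed
  have mom2: "(\<Sum>p\<in>\<Omega>. real (Z p) ^ 2) \<le> real m * (2 ^ W * 2 ^ j) + real m ^ 2 * (2 ^ j * 2 ^ j)"
  proof -
    have "(\<Sum>p\<in>\<Omega>. real (Z p) ^ 2) = (\<Sum>p\<in>\<Omega>. \<Sum>y\<in>X. \<Sum>y'\<in>X. of_bool (p \<in> B y \<inter> B y'))"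
      by (intro sum.cong) (auto simp: Zsum power2_eq_square sum_product of_bool_conj)
    also have "\<dots> = (\<Sum>y\<in>X. \<Sum>p\<in>\<Omega>. \<Sum>y'\<in>X. of_bool (p \<in> B y \<inter> B y'))"
      by (rule sum.swap)
    also have "\<dots> = (\<Sum>y\<in>X. \<Sum>y'\<in>X. \<Sum>p\<in>\<Omega>. of_bool (p \<in> B y \<inter> B y'))"
      by (intro sum.cong refl sum.swap)
    also have "\<dots> = (\<Sum>y\<in>X. \<Sum>y'\<in>X. real (card (B y \<inter> B y')))"
    proof (intro sum.cong refl)
      fix y y'
      have "B y \<inter> B y' \<subseteq> \<Omega>" using Bsub by blast
      then show "(\<Sum>p\<in>\<Omega>. of_bool (p \<in> B y \<inter> B y')) = real (card (B y \<inter> B y'))"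
        by (rule sumB)
    qed
    \<comment> \<open>The diagonal contributes the first moment. Allowing the pair bound on the
      diagonal as well only weakens the estimate and keeps the sum uniform.\<close>
    also have "\<dots> \<le> (\<Sum>y\<in>X. \<Sum>y'\<in>X. (if y' = y then 2 ^ W * 2 ^ j else 0) + 2 ^ j * 2 ^ j)"
    proof (intro sum_mono)
      fix y y' assume "y \<in> X" "y' \<in> X"
      then show "real (card (B y \<inter> B y')) \<le> (if y' = y then 2 ^ W * 2 ^ j else 0) + 2 ^ j * 2 ^ j"
        using cBB[of y y'] cB[of y] by auto
    qed
    also have "\<dots> = real m * (2 ^ W * 2 ^ j) + real m ^ 2 * (2 ^ j * 2 ^ j)"
      using finX by (simp add: sum.distrib m_def power2_eq_square distrib_left)
    finally show ?thesis .
  qed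
  have "(\<Sum>p\<in>\<Omega>. 2 * real (Z p) - real (Z p) ^ 2) \<le> (\<Sum>p\<in>\<Omega>. of_bool (p \<in> G))"
  proof (intro sum_mono)
    fix p assume "p \<in> \<Omega>"
    have "2 * real z - real z ^ 2 \<le> of_bool (z = 1)" for z :: nat
    proof (cases "z \<le> 1")
      case True
      then have "z = 0 \<or> z = 1" by auto
      then show ?thesis by auto
    next
      case False
      then have "2 * real z \<le> real z * real z" by (intro mult_right_mono) auto
      then show ?thesis by (auto simp: power2_eq_square)
    qed
    from this[of "Z p"] show "2 * real (Z p) - real (Z p) ^ 2 \<le> of_bool (p \<in> G)"
      using \<open>p \<in> \<Omega>\<close> by (simp add: G_def)
  qed
  also have "\<dots> = real (card G)" by (rule sumB) (auto simp: G_def)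
  also have "(\<Sum>p\<in>\<Omega>. 2 * real (Z p) - real (Z p) ^ 2) = 2 * (\<Sum>p\<in>\<Omega>. real (Z p)) - (\<Sum>p\<in>\<Omega>. real (Z p) ^ 2)"
    by (simp add: sum_subtractf sum_distrib_left)
  finally have G1: "real m * (2 ^ W * 2 ^ j) - real m ^ 2 * (2 ^ j * 2 ^ j) \<le> real (card G)"
    using mom1 mom2 by linarith
  define q Q where "q = real (m * 2 ^ i)" and "Q = (2::real) ^ w"
  have WQ: "(2::real) ^ W = Q * Q" and jQ: "(2::real) ^ j = Q * 2 ^ i"
    by (simp_all add: W_def j_def Q_def power_add mult_2)
  have q: "2 * q \<le> Q" "Q < 4 * q"
  proof -
    have "real (2 * (m * 2 ^ i)) \<le> real (2 ^ w)" using i(2) by (rule of_nat_mono)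
    then show "2 * q \<le> Q" by (simp add: q_def Q_def)
    have "real (2 ^ w) < real (4 * (m * 2 ^ i))" using i(3) by (rule of_nat_less_iff[THEN iffD2])
    then show "Q < 4 * q" by (simp add: q_def Q_def)
  qed
  \<comment> \<open>Expanding this product gives \<open>\<mu> - \<mu> * \<mu> \<ge> 3/16\<close> for
    \<open>\<mu> = q / Q\<close>, cleared of denominators; the roots are 1/4 and 3/4.\<close>
  have "0 \<le> (4 * q - Q) * (3 * Q - 4 * q)"
    using q by (intro mult_nonneg_nonneg) auto
  then have "3 * (Q * Q) \<le> 16 * (q * Q - q * q)"
    by (simp add: algebra_simps)
  then have "Q * Q * (3 * (Q * Q)) \<le> Q * Q * (16 * (q * Q - q * q))"
    by (rule mult_left_mono) simp
  also have "Q * Q * (16 * (q * Q - q * q)) = 16 * (real m * (2 ^ W * 2 ^ j) - real m ^ 2 * (2 ^ j * 2 ^ j))"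
    unfolding WQ jQ by (simp add: q_def power2_eq_square algebra_simps)
  also have "\<dots> \<le> 16 * real (card G)" using G1 by simp
  also have "Q * Q * (3 * (Q * Q)) = real (3 * 2 ^ (4 * w))"
  proof -
    have "(2::real) ^ (4 * w) = Q ^ 4"
      by (simp add: Q_def mult.commute flip: power_mult)
    then show ?thesis by (simp add: power4_eq_xxxx)
  qed
  finally have "real (3 * 2 ^ (4 * w)) \<le> real (16 * card G)"
    by simp
  then have "3 * 2 ^ (4 * w) \<le> 16 * card G"
    by (rule of_nat_le_iff[THEN iffD1])
  also have "card G \<le> card {(s, t) \<in> {..<2 ^ (2 * w)} \<times> {..<2 ^ (2 * w)}.
     \<exists>j<2 * w. card {y \<in> X. hash (2 * w) s t y < 2 ^ j} = 1}"
  proof (rule card_mono)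
    show "finite {(s, t) \<in> {..<(2::nat) ^ (2 * w)} \<times> {..<(2::nat) ^ (2 * w)}.
       \<exists>j<2 * w. card {y \<in> X. hash (2 * w) s t y < 2 ^ j} = 1}"
      by (rule finite_subset[of _ "{..<2 ^ (2 * w)} \<times> {..<2 ^ (2 * w)}"]) auto
    show "G \<subseteq> {(s, t) \<in> {..<2 ^ (2 * w)} \<times> {..<2 ^ (2 * w)}.
       \<exists>j<2 * w. card {y \<in> X. hash (2 * w) s t y < 2 ^ j} = 1}"
      using j(2) by (auto simp: G_def \<Omega>_def Z_def W_def)
  qed
  finally show ?thesis by simp
qed


section \<open>Random bits\<close>

definition bit_space :: "random_bits measure" where
  "bit_space = (\<Pi>\<^sub>M i\<in>(UNIV :: nat set). measure_pmf (bernoulli_pmf (1/2)))"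

lemma space_bit_space [simp]: "space bit_space = UNIV"
  by (auto simp: bit_space_def space_PiM)

lemma product_prob_space_bits: "product_prob_space (\<lambda>_::nat. measure_pmf (bernoulli_pmf (1/2)))"
  by (intro product_prob_spaceI prob_space_measure_pmf)

lemma prob_space_bit_space: "prob_space bit_space"
  unfolding bit_space_def by (intro prob_space_PiM prob_space_measure_pmf)

lemma prob_space_coins: "prob_space (coins N)"
  unfolding coins_def bit_space_def[symmetric] by (intro prob_space_PiM prob_space_bit_space)

lemma measurable_component_coins [measurable]:
  "x \<in> nodes N \<Longrightarrow> (\<lambda>\<omega>. \<omega> x) \<in> measurable (coins N) bit_space"
  unfolding coins_def bit_space_def by (rule measurable_component_singleton)

lemma distr_coins:
  assumes "x \<in> nodes N"
  shows "distr (coins N) bit_space (\<lambda>\<omega>. \<omega> x) = bit_space"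
proof -
  interpret product_prob_space "\<lambda>_. bit_space" "nodes N"
    by (intro product_prob_spaceI prob_space_bit_space)
  show ?thesis
    using PiM_component[OF assms] by (simp add: coins_def bit_space_def)
qed

lemma measurable_prefix [measurable]:
  "(\<lambda>\<beta>. map \<beta> [0..<n]) \<in> measurable bit_space (count_space UNIV)"
proof (induction n)
  case (Suc n)
  have "(\<lambda>\<beta>. l @ [\<beta> n]) \<in> measurable bit_space (count_space UNIV)" for l
  proof -
    have "(\<lambda>\<beta>. \<beta> n) \<in> measurable bit_space (measure_pmf (bernoulli_pmf (1/2)))"
      unfolding bit_space_def by (rule measurable_component_singleton) simp
    then show ?thesis
      by (rule measurable_compose) simp
  qed
  from measurable_compose_countable[OF this Suc] show ?case by simp
qed simp

lemma finitary_measurable: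
  assumes "\<And>\<beta> \<beta>'. (\<And>i. i < n \<Longrightarrow> \<beta> i = \<beta>' i) \<Longrightarrow> f \<beta> = f \<beta>'"
  shows "f \<in> measurable bit_space (count_space UNIV)"
proof -
  have "(\<lambda>\<beta>. f (\<lambda>i. map \<beta> [0..<n] ! i)) \<in> measurable bit_space (count_space UNIV)"
    by (rule measurable_compose[OF measurable_prefix[of n]]) simp
  moreover have "f (\<lambda>i. map \<beta> [0..<n] ! i) = f \<beta>" for \<beta>
    by (rule assms) simp
  ultimately show ?thesis by simp
qed

lemma prob_prefix:
  assumes "length bs = n"
  shows "measure bit_space {\<beta>. map \<beta> [0..<n] = bs} = (1/2) ^ n"
proof -
  interpret product_prob_space "\<lambda>_::nat. measure_pmf (bernoulli_pmf (1/2))" UNIV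
    by (rule product_prob_space_bits)
  have "{\<beta>. map \<beta> [0..<n] = bs} = {\<beta>\<in>space bit_space. \<forall>i\<in>{..<n}. \<beta> i \<in> {bs ! i}}"
    using assms by (auto simp: list_eq_iff_nth_eq)
  then have "emeasure bit_space {\<beta>. map \<beta> [0..<n] = bs} =
      (\<Prod>i<n. emeasure (measure_pmf (bernoulli_pmf (1/2))) {bs ! i})"
    unfolding bit_space_def by (simp only:) (rule emeasure_PiM_Collect, auto)
  also have "\<dots> = (\<Prod>i<n. ennreal (1/2))"
    by (intro prod.cong refl) (simp add: emeasure_pmf_single pmf_bernoulli_half)
  also have "\<dots> = ennreal ((1/2) ^ n)"
    by (subst prod_ennreal) auto
  finally show ?thesis
    by (simp add: measure_def)
qed

lemma prob_prefix_in:
  assumes A: "A \<subseteq> {bs. length bs = n}"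
  shows "measure bit_space {\<beta>. map \<beta> [0..<n] \<in> A} = card A / 2 ^ n"
proof -
  interpret prob_space bit_space by (rule prob_space_bit_space)
  have fin: "finite A"
    using A finite_lists_length_eq[of "UNIV :: bool set" n] by (auto intro: finite_subset)
  have meas: "{\<beta>. map \<beta> [0..<n] = bs} \<in> sets bit_space" for bs
    using measurable_sets[OF measurable_prefix[of n], of "{bs}"] by (simp add: vimage_def)
  have "{\<beta>. map \<beta> [0..<n] \<in> A} = (\<Union>bs\<in>A. {\<beta>. map \<beta> [0..<n] = bs})"
    by auto
  then have "measure bit_space {\<beta>. map \<beta> [0..<n] \<in> A} =
      (\<Sum>bs\<in>A. measure bit_space {\<beta>. map \<beta> [0..<n] = bs})"
    using fin meas by (simp only:) (rule finite_measure_finite_Union, auto simp: disjoint_family_on_def)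
  also have "\<dots> = (\<Sum>bs\<in>A. (1/2) ^ n)"
    by (intro sum.cong refl prob_prefix) (use A in auto)
  finally show ?thesis by (simp add: power_divide)
qed

definition drop_bits :: "nat \<Rightarrow> random_bits \<Rightarrow> random_bits" where
  "drop_bits b \<beta> = (\<lambda>i. \<beta> (b + i))"

text \<open>Successive attempts read successive blocks of coins. With \<open>G\<close> the set of
  good seeds, this is the event that the first \<open>j\<close> attempts fail.\<close>

primrec all_outside :: "nat \<Rightarrow> bool list set \<Rightarrow> nat \<Rightarrow> random_bits \<Rightarrow> bool" where
  "all_outside b G 0 \<beta> \<longleftrightarrow> True"
| "all_outside b G (Suc j) \<beta> \<longleftrightarrow> map \<beta> [0..<b] \<notin> G \<and> all_outside b G j (drop_bits b \<beta>)"

text \<open>The event is decided by \<open>j * b\<close> coins, and the deciding prefixes are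
  concatenations of \<open>j\<close> blocks outside \<open>G\<close>. Counting them replaces an
  independence argument for shifted coin sequences.\<close>

lemma all_outside_prefix:
  assumes G: "G \<subseteq> {bs. length bs = b}"
  shows "\<exists>A \<subseteq> {bs. length bs = j * b}. card A = (2 ^ b - card G) ^ j \<and>
     (\<forall>\<beta>. all_outside b G j \<beta> \<longleftrightarrow> map \<beta> [0..<j * b] \<in> A)"
proof (induction j)
  case 0
  show ?case by (intro exI[of _ "{[]}"]) auto
next
  case (Suc j)
  then obtain A where A: "A \<subseteq> {bs. length bs = j * b}" "card A = (2 ^ b - card G) ^ j"
    "\<And>\<beta>. all_outside b G j \<beta> \<longleftrightarrow> map \<beta> [0..<j * b] \<in> A" by blast
  define L where "L = {bs :: bool list. length bs = b} - G"
  have "finite {bs :: bool list. length bs = b}"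
    using finite_lists_length_eq[of "UNIV :: bool set" b] by simp
  moreover have "card {bs :: bool list. length bs = b} = 2 ^ b"
    using card_lists_length_eq[of "UNIV :: bool set" b] by simp
  ultimately have cL: "card L = 2 ^ b - card G"
    unfolding L_def using G by (simp add: card_Diff_subset finite_subset)
  have inj: "inj_on (\<lambda>(u, v). u @ v) (L \<times> A)"
    by (auto simp: inj_on_def L_def)
  have map_split: "map \<beta> [0..<Suc j * b] = map \<beta> [0..<b] @ map (drop_bits b \<beta>) [0..<j * b]" for \<beta>
    by (rule nth_equalityI) (auto simp: nth_append drop_bits_def)
  have "all_outside b G (Suc j) \<beta> \<longleftrightarrow> map \<beta> [0..<Suc j * b] \<in> (\<lambda>(u, v). u @ v) ` (L \<times> A)" for \<beta>
  proof -
    have "map \<beta> [0..<b] @ map (drop_bits b \<beta>) [0..<j * b] \<in> (\<lambda>(u, v). u @ v) ` (L \<times> A) \<longleftrightarrow>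
        map \<beta> [0..<b] \<in> L \<and> map (drop_bits b \<beta>) [0..<j * b] \<in> A"
      by (force simp: L_def image_iff)
    then show ?thesis
      by (simp only: map_split all_outside.simps A(3)) (simp add: L_def)
  qed
  moreover have "card ((\<lambda>(u, v). u @ v) ` (L \<times> A)) = (2 ^ b - card G) ^ Suc j"
    by (simp add: card_image[OF inj] card_cartesian_product cL A(2))
  moreover have "(\<lambda>(u, v). u @ v) ` (L \<times> A) \<subseteq> {bs. length bs = Suc j * b}"
    using A(1) by (auto simp: L_def)
  ultimately show ?case by blast
qed

lemma all_outside_measurable:
  assumes "G \<subseteq> {bs. length bs = b}"
  shows "{\<beta>. all_outside b G j \<beta>} \<in> sets bit_space"
proof -
  obtain A where A: "\<And>\<beta>. all_outside b G j \<beta> \<longleftrightarrow> map \<beta> [0..<j * b] \<in> A"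
    using all_outside_prefix[OF assms] by blast
  then show ?thesis
    using measurable_sets[OF measurable_prefix[of "j * b"], of A] by (simp add: vimage_def)
qed

lemma prob_all_outside:
  assumes G: "G \<subseteq> {bs. length bs = b}" and x: "x \<in> nodes N"
  shows "{\<omega>\<in>space (coins N). all_outside b G j (\<omega> x)} \<in> sets (coins N)"
    and "measure (coins N) {\<omega>\<in>space (coins N). all_outside b G j (\<omega> x)} = (1 - card G / 2 ^ b) ^ j"
proof -
  have eq: "{\<omega>\<in>space (coins N). all_outside b G j (\<omega> x)} =
      (\<lambda>\<omega>. \<omega> x) -` {\<beta>. all_outside b G j \<beta>} \<inter> space (coins N)"
    by auto
  show "{\<omega>\<in>space (coins N). all_outside b G j (\<omega> x)} \<in> sets (coins N)"
    unfolding eq by (rule measurable_sets[OF measurable_component_coins[OF x] all_outside_measurable[OF G]])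
  obtain A where A: "A \<subseteq> {bs. length bs = j * b}" "card A = (2 ^ b - card G) ^ j"
    "\<And>\<beta>. all_outside b G j \<beta> \<longleftrightarrow> map \<beta> [0..<j * b] \<in> A"
    using all_outside_prefix[OF G] by blast
  have "card G \<le> 2 ^ b"
    using card_mono[OF _ G] finite_lists_length_eq[of "UNIV :: bool set" b]
      card_lists_length_eq[of "UNIV :: bool set" b] by simp
  then have cA: "real (card A) = (2 ^ b - real (card G)) ^ j"
    by (simp add: A(2) of_nat_diff)
  have "measure (coins N) {\<omega>\<in>space (coins N). all_outside b G j (\<omega> x)} =
      measure (distr (coins N) bit_space (\<lambda>\<omega>. \<omega> x)) {\<beta>. all_outside b G j \<beta>}"
    unfolding eq by (rule measure_distr[symmetric, OF measurable_component_coins[OF x] all_outside_measurable[OF G]])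
  also have "\<dots> = measure bit_space {\<beta>. map \<beta> [0..<j * b] \<in> A}"
    by (simp add: distr_coins[OF x] A(3))
  also have "\<dots> = card A / 2 ^ (j * b)"
    by (rule prob_prefix_in[OF A(1)])
  also have "\<dots> = (1 - card G / 2 ^ b) ^ j"
    unfolding cA by (simp add: power_divide[symmetric] diff_divide_distrib mult.commute[of j] power_mult)
  finally show "measure (coins N) {\<omega>\<in>space (coins N). all_outside b G j (\<omega> x)} = (1 - card G / 2 ^ b) ^ j" .
qed


section \<open>Measurability of runs\<close>

text \<open>The scheduler is an arbitrary function; a trace is measurable because at each step it takes
  only countably many values.\<close>

lemma trace_measurable:
  assumes sends: "\<And>v h. (\<lambda>\<omega>. sends P (local_input_of N x err v) (\<omega> v) h) \<in> measurable (coins N) (count_space UNIV)"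
  shows "\<exists>S. countable S \<and> (\<lambda>\<omega>. trace P N x err \<sigma> \<omega> i) \<in> measurable (coins N) (count_space S)"
proof (induction i)
  case 0
  define H where "H l = [\<lparr>sent = map (\<lambda>(u, bs). \<lparr>source = x, target = u, content = bs, sent_at = 0\<rparr>) l,
      received = {}, histories = (\<lambda>_. []), clock = 0\<rparr>]" for l :: "(nat \<times> bool list) list"
  have "(\<lambda>\<omega>. H (sends P (local_input_of N x err x) (\<omega> x) [])) \<in> measurable (coins N) (count_space (range H))"
    by (rule measurable_compose[OF sends]) simp
  then show ?case
    by (intro exI[of _ "range H"]) (simp add: initial_def act_def H_def)
next
  case (Suc i)
  then obtain S where S: "countable S" "(\<lambda>\<omega>. trace P N x err \<sigma> \<omega> i) \<in> measurable (coins N) (count_space S)"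
    by blast
  define v where "v Cs = target (sent (last Cs) ! fst (\<sigma> Cs))" for Cs
  define h where "h Cs = histories (last Cs) (v Cs) @
    [(source (sent (last Cs) ! fst (\<sigma> Cs)), content (sent (last Cs) ! fst (\<sigma> Cs)))]" for Cs
  define H where "H Cs l = Cs @ [if quiescent (last Cs) then last Cs else
      \<lparr>sent = sent (last Cs) @
         map (\<lambda>(u, bs). \<lparr>source = v Cs, target = u, content = bs, sent_at = snd (\<sigma> Cs)\<rparr>) l,
       received = insert (fst (\<sigma> Cs)) (received (last Cs)),
       histories = (histories (last Cs))(v Cs := h Cs), clock = snd (\<sigma> Cs)\<rparr>]"
    for Cs and l :: "(nat \<times> bool list) list"
  define S' where "S' = (\<Union>Cs\<in>S. range (H Cs))"
  have "countable S'"
    unfolding S'_def using S(1) by (intro countable_UN) auto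
  have trace: "trace P N x err \<sigma> \<omega> (Suc i) =
      (let Cs = trace P N x err \<sigma> \<omega> i
       in H Cs (sends P (local_input_of N x err (v Cs)) (\<omega> (v Cs)) (h Cs)))" for \<omega>
    by (simp add: H_def v_def h_def deliver_def act_def Let_def split_beta)
  have "(\<lambda>\<omega>. H Cs (sends P (local_input_of N x err (v Cs)) (\<omega> (v Cs)) (h Cs)))
      \<in> measurable (coins N) (count_space S')" if "Cs \<in> S" for Cs
    by (rule measurable_compose[OF sends]) (use that in \<open>auto simp: S'_def\<close>)
  from measurable_compose_countable'[OF this S(2,1)]
  have "(\<lambda>\<omega>. trace P N x err \<sigma> \<omega> (Suc i)) \<in> measurable (coins N) (count_space S')"
    unfolding trace Let_def .
  with \<open>countable S'\<close> show ?case by blast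
qed

lemma run_measurable:
  fixes f :: "config \<Rightarrow> ennreal"
  assumes "\<And>v h. (\<lambda>\<omega>. sends P (local_input_of N x err v) (\<omega> v) h) \<in> measurable (coins N) (count_space UNIV)"
  shows "(\<lambda>\<omega>. SUP i. f (run P N x err \<sigma> \<omega> i)) \<in> borel_measurable (coins N)"
proof (rule borel_measurable_SUP)
  fix i
  obtain S where "(\<lambda>\<omega>. trace P N x err \<sigma> \<omega> i) \<in> measurable (coins N) (count_space S)"
    using trace_measurable[OF assms] by blast
  then show "(\<lambda>\<omega>. f (run P N x err \<sigma> \<omega> i)) \<in> borel_measurable (coins N)"
    unfolding run_def by (rule measurable_compose) simp
qed simp

lemma transcript_measurable:
  assumes "\<And>ts. (\<lambda>\<beta>. strat li \<beta> ts) \<in> measurable bit_space (count_space UNIV)"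
  shows "(\<lambda>\<beta>. transcript (\<lambda>ts. projl (strat li \<beta> ts)) resp r) \<in> measurable bit_space (count_space UNIV)"
proof (induction r)
  case (Suc r)
  have "(\<lambda>\<beta>. ts @ [resp r (projl (strat li \<beta> ts))]) \<in> measurable bit_space (count_space UNIV)" for ts
    by (rule measurable_compose[OF assms]) simp
  from measurable_compose_countable[OF this Suc] show ?case by simp
qed simp

text \<open>Only the initiator's program reads coins. Its view takes countably many values, so the
  strategy may be composed with it.\<close>

lemma sends_measurable:
  assumes strat: "\<And>ts. (\<lambda>\<beta>. strat (local_input_of N x err x) \<beta> ts) \<in> measurable bit_space (count_space UNIV)"
    and x: "x \<in> nodes N"
  shows "(\<lambda>\<omega>. sends (echo_procedure val strat) (local_input_of N x err v) (\<omega> v) h)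
     \<in> measurable (coins N) (count_space UNIV)"
proof (cases "v = x")
  case False
  then show ?thesis by (simp add: echo_procedure_def local_input_of_def)
next
  case True
  let ?I = "local_input_of N x err x"
  have "(\<lambda>\<beta>. root_view val strat ?I \<beta> h) \<in> measurable bit_space (count_space UNIV)"
    unfolding root_view_def by (rule transcript_measurable[of strat ?I, OF strat])
  from measurable_compose_countable[where f = "\<lambda>ts \<beta>. strat ?I \<beta> ts", OF strat this]
  have "(\<lambda>\<beta>. Some (strat ?I \<beta> (root_view val strat ?I \<beta> h))) \<in> measurable bit_space (count_space UNIV)"
    by (rule measurable_compose) simp
  then have "(\<lambda>\<beta>. root_step val strat ?I \<beta> h) \<in> measurable bit_space (count_space UNIV)"
    unfolding root_step_def by (cases "answered (marked_neighbour_ids ?I) (root_round ?I h) h") simp_all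
  then have "(\<lambda>\<beta>. sends (echo_procedure val strat) ?I \<beta> h) \<in> measurable bit_space (count_space UNIV)"
    unfolding echo_procedure_def procedure.simps
    by (rule measurable_compose[where g = "\<lambda>s. if known_error ?I = None then relay val ?I h
        else if marked_neighbour_ids ?I = {} then []
        else (case s of Some (Inl b) \<Rightarrow> map (\<lambda>c. (c, b)) (sorted_list_of_set (marked_neighbour_ids ?I))
              | _ \<Rightarrow> [])"]) simp
  then show ?thesis
    unfolding True by (rule measurable_compose[OF measurable_component_coins[OF x]])
qed


section \<open>The search procedure\<close>

text \<open>The factor 2 reserves a spare bit. It keeps edge codes in the lower half of their range,
  as isolation needs \<open>2 * card X \<le> 2 ^ w\<close>. Neighbours are included because the
  outer endpoint of a leaving edge never answers.\<close>

definition id_width :: "local_input \<Rightarrow> nat" where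
  "id_width li = (LEAST l. \<forall>u\<in>insert (own_id li) (neighbour_ids li). 2 * u < 2 ^ l)"

definition code :: "nat \<Rightarrow> nat set \<Rightarrow> nat" where
  "code l e = Min e + 2 ^ l * Max e"

definition nat_of :: "bool list \<Rightarrow> nat" where
  "nat_of bs = horner_sum of_bool 2 bs"

definition decode :: "bool list \<Rightarrow> nat set" where
  "decode z = (let l = length z div 2 in {nat_of z mod 2 ^ l, nat_of z div 2 ^ l})"

text \<open>The seed is the multiplier followed by the shift, \<open>4 * l\<close> bits each: twice
  the \<open>2 * l\<close> bits of a code, as \<open>card_isolating_ge\<close> requires.\<close>

definition edge_hash :: "nat \<Rightarrow> bool list \<Rightarrow> nat set \<Rightarrow> nat" where
  "edge_hash l s e = hash (4 * l) (nat_of (take (4 * l) s)) (nat_of (drop (4 * l) s)) (code l e)"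

definition first_bit :: "bool list \<Rightarrow> nat" where
  "first_bit p = (LEAST j. bit_at p j)"

text \<open>The payloads \<open>s\<close>, \<open>p\<close>, \<open>z\<close> below have lengths \<open>8 l\<close>, \<open>4 l\<close>, \<open>2 l\<close>, where
  \<open>l\<close> is the ID width of the tree; the receiver recovers \<open>l\<close> from the length of the message.\<close>

definition hash_query :: "bool list \<Rightarrow> bool list" where
  "hash_query s = False # True # s"

definition sum_query :: "bool list \<Rightarrow> bool list \<Rightarrow> bool list" where
  "sum_query s p = False # False # s @ p"

definition test_query :: "bool list \<Rightarrow> bool list" where
  "test_query z = True # z"

fun query :: "bool list \<Rightarrow> nat \<Rightarrow> nat set \<Rightarrow> bool" where
  "query (True # z) j e \<longleftrightarrow> e = decode z"
| "query (False # True # s) j e \<longleftrightarrow> edge_hash (length s div 8) s e < 2 ^ j"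
| "query (False # False # s) j e \<longleftrightarrow>
     (let l = length s div 12
      in edge_hash l (take (8 * l) s) e < 2 ^ first_bit (drop (8 * l) s) \<and> bit (code l e) j)"
| "query _ j e \<longleftrightarrow> False"

text \<open>The divisors turn payload lengths into answer lengths: \<open>8 * l\<close> seed bits
  call for \<open>4 * l\<close> level parities, and \<open>12 * l\<close> bits of seed and parities
  call for the \<open>2 * l\<close> bits of a code. The empty query asks for the ID width, given as
  that many False bits.\<close>

fun width :: "local_input \<Rightarrow> bool list \<Rightarrow> nat" where
  "width li [] = id_width li"
| "width li (True # z) = 1"
| "width li (False # True # s) = length s div 2"
| "width li (False # False # s) = length s div 6"
| "width li [False] = 0"

definition answer :: "local_input \<Rightarrow> bool list \<Rightarrow> bool list" where
  "answer li b =
     map (\<lambda>j. odd (card {e \<in> (\<lambda>u. {own_id li, u}) ` neighbour_ids li. query b j e})) [0..<width li b]"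

text \<open>One attempt takes four rounds: the ID width \<open>a\<close> (in unary), the parities \<open>p\<close> of the numbers
  of leaving edges with hash value below \<open>2 ^ j\<close>, the exclusive or \<open>z\<close> of the codes of those
  below the first odd level, and the test \<open>t\<close> whether \<open>z\<close> encodes a leaving edge.\<close>

fun plan :: "nat \<Rightarrow> random_bits \<Rightarrow> bool list list \<Rightarrow> bool list + nat set option" where
  "plan 0 \<beta> ts = Inr None"
| "plan (Suc k) \<beta> [] = Inl []"
| "plan (Suc k) \<beta> [a] = Inl (hash_query (map \<beta> [0..<8 * length a]))"
| "plan (Suc k) \<beta> [a, p] = Inl (sum_query (map \<beta> [0..<8 * length a]) p)"
| "plan (Suc k) \<beta> [a, p, z] = Inl (test_query z)"
| "plan (Suc k) \<beta> (a # p # z # t # ts) =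
     (if t = [True] then Inr (Some (decode z)) else plan k (drop_bits (8 * length a) \<beta>) ts)"

definition search :: "(local_input \<Rightarrow> nat) \<Rightarrow> procedure" where
  "search attempts = echo_procedure answer (\<lambda>li \<beta> ts. plan (attempts li) \<beta> ts)"

text \<open>For fixed \<open>k\<close> and \<open>ts\<close> only finitely many coins are read: each
  finished attempt in \<open>ts\<close> discards a block whose length is visible in
  \<open>ts\<close>.\<close>

lemma plan_measurable: "(\<lambda>\<beta>. plan k \<beta> ts) \<in> measurable bit_space (count_space UNIV)"
proof -
  have "\<exists>n. \<forall>\<beta> \<beta>'. (\<forall>i<n. \<beta> i = \<beta>' i) \<longrightarrow> plan k \<beta> ts = plan k \<beta>' ts"
  proof (induction k arbitrary: ts)
    case (Suc k)
    have seed: "map \<beta> [0..<n] = map \<beta>' [0..<n]" if "\<forall>i<n. \<beta> i = \<beta>' i" for n and \<beta> \<beta>' :: random_bits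
      using that by simp
    consider "ts = []" | a where "ts = [a]" | a p where "ts = [a, p]" | a p z where "ts = [a, p, z]"
      | a p z t us where "ts = a # p # z # t # us"
      by (cases ts; cases "tl ts"; cases "tl (tl ts)"; cases "tl (tl (tl ts))") simp_all
    then show ?case
    proof cases
      case (5 a p z t us)
      obtain n where n: "\<And>\<beta> \<beta>'. (\<forall>i<n. \<beta> i = \<beta>' i) \<Longrightarrow> plan k \<beta> us = plan k \<beta>' us"
        using Suc.IH by blast
      have "plan (Suc k) \<beta> ts = plan (Suc k) \<beta>' ts" if "\<forall>i<8 * length a + n. \<beta> i = \<beta>' i" for \<beta> \<beta>'
        using that n[of "drop_bits (8 * length a) \<beta>" "drop_bits (8 * length a) \<beta>'"]
        by (simp add: 5 drop_bits_def)
      then show ?thesis by blast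
    next
      case (2 a)
      have "plan (Suc k) \<beta> ts = plan (Suc k) \<beta>' ts" if "\<forall>i<8 * length a. \<beta> i = \<beta>' i" for \<beta> \<beta>'
        unfolding 2 plan.simps seed[OF that] ..
      then show ?thesis by blast
    next
      case (3 a p)
      have "plan (Suc k) \<beta> ts = plan (Suc k) \<beta>' ts" if "\<forall>i<8 * length a. \<beta> i = \<beta>' i" for \<beta> \<beta>'
        unfolding 3 plan.simps seed[OF that] ..
      then show ?thesis by blast
    qed simp_all
  qed simp
  then obtain n where n: "\<forall>\<beta> \<beta>'. (\<forall>i<n. \<beta> i = \<beta>' i) \<longrightarrow> plan k \<beta> ts = plan k \<beta>' ts" ..
  show ?thesis
    by (rule finitary_measurable[of n]) (use n in simp)
qed

section \<open>Coding of edges and bounds on ID widths\<close>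

lemma nat_of_bits: "n < 2 ^ l \<Longrightarrow> nat_of (map (bit n) [0..<l]) = n"
  by (simp add: nat_of_def horner_sum_bit_eq_take_bit take_bit_nat_eq_self)

lemma
  assumes e: "e = {p, q}" "p \<noteq> q" and l: "\<forall>u\<in>e. 2 * u < 2 ^ l"
  shows code_less: "2 * code l e < 2 ^ (2 * l)"
    and decode_code: "decode (map (bit (code l e)) [0..<2 * l]) = e"
proof -
  have *: "2 * code l {p, q} < 2 ^ (2 * l) \<and> decode (map (bit (code l {p, q})) [0..<2 * l]) = {p, q}"
    if pq: "p < q" "2 * p < 2 ^ l" "2 * q < 2 ^ l" for p q
  proof
    have c: "code l {p, q} = p + 2 ^ l * q"
      using pq by (simp add: code_def)
    have "Suc (2 * q) \<le> 2 ^ l" using pq by simp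
    then have le: "2 ^ l * Suc (2 * q) \<le> 2 ^ l * 2 ^ l" by (rule mult_le_mono2)
    have "2 * code l {p, q} < 2 ^ l + 2 * (2 ^ l * q)"
      using pq(2) by (simp add: c)
    also have "\<dots> = 2 ^ l * Suc (2 * q)" by simp
    also note le
    also have "(2::nat) ^ l * 2 ^ l = 2 ^ (2 * l)" by (simp add: mult_2 power_add)
    finally show less: "2 * code l {p, q} < 2 ^ (2 * l)" .
    then have "code l {p, q} < 2 ^ (2 * l)" by linarith
    from nat_of_bits[OF this] have "nat_of (map (bit (code l {p, q})) [0..<2 * l]) = p + 2 ^ l * q"
      unfolding c .
    moreover have "p < 2 ^ l" using pq by simp
    ultimately show "decode (map (bit (code l {p, q})) [0..<2 * l]) = {p, q}"
      by (simp add: decode_def Let_def)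
  qed
  have "2 * code l e < 2 ^ (2 * l) \<and> decode (map (bit (code l e)) [0..<2 * l]) = e"
  proof (cases "p < q")
    case True
    then show ?thesis using *[of p q] l by (simp add: e)
  next
    case False
    have "e = {q, p}" using e by auto
    then show ?thesis using *[of q p] l e(2) False by simp
  qed
  then show "2 * code l e < 2 ^ (2 * l)" "decode (map (bit (code l e)) [0..<2 * l]) = e"
    by auto
qed

lemma id_width_ge:
  assumes "finite (neighbour_ids li)" "u \<in> insert (own_id li) (neighbour_ids li)"
  shows "2 * u < 2 ^ id_width li"
proof -
  define S where "S = insert (own_id li) (neighbour_ids li)"
  \<comment> \<open>Some exponent must work before \<open>LEAST\<close> means anything; this one is
    merely convenient.\<close>
  have "\<forall>u\<in>S. 2 * u < 2 ^ (2 * Suc (Max S))"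
  proof
    fix u assume "u \<in> S"
    then have "u \<le> Max S" using assms by (intro Max_ge) (auto simp: S_def)
    then have "2 * u < 2 * Suc (Max S)" by simp
    also have "\<dots> < 2 ^ (2 * Suc (Max S))" by (rule less_exp)
    finally show "2 * u < 2 ^ (2 * Suc (Max S))" .
  qed
  then have "\<forall>u\<in>S. 2 * u < 2 ^ id_width li"
    unfolding id_width_def S_def[symmetric] by (rule LeastI)
  then show ?thesis using assms(2) by (simp only: S_def)
qed

text \<open>By minimality some ID fails at the width below, so that width is at most one more than
  its logarithm. The summand 2 is the spare bit and this step of one.\<close>

lemma id_width_le:
  assumes "finite (neighbour_ids li)" "\<And>u. u \<in> insert (own_id li) (neighbour_ids li) \<Longrightarrow> 1 \<le> u \<and> log 2 (real u) \<le> B"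
  shows "real (id_width li) \<le> B + 2"
proof -
  let ?P = "\<lambda>l. \<forall>u\<in>insert (own_id li) (neighbour_ids li). 2 * u < 2 ^ l"
  have "id_width li \<noteq> 0"
    using id_width_ge[OF assms(1), of "own_id li"] assms(2)[of "own_id li"] by (intro notI) simp
  then obtain l where l: "id_width li = Suc l" by (cases "id_width li") auto
  then have "\<not> ?P l"
    using not_less_Least[of l ?P] by (simp add: id_width_def)
  then obtain u where u: "u \<in> insert (own_id li) (neighbour_ids li)" "2 ^ l \<le> 2 * u"
    by (auto simp: not_less)
  have "real (2 ^ l) \<le> real (2 * u)" using u(2) by (rule of_nat_mono)
  then have "2 powr real l \<le> 2 * real u" by (simp add: powr_realpow)
  then have "real l \<le> log 2 (2 * real u)"
    using assms(2)[OF u(1)] by (subst le_log_iff) auto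
  also have "\<dots> = 1 + log 2 (real u)"
    using assms(2)[OF u(1)] by (subst log_mult) auto
  finally show ?thesis
    using assms(2)[OF u(1)] l by simp
qed


section \<open>Totals of the answers over the marked tree\<close>

locale marked_tree =
  fixes a :: real and N :: network and x :: nat and err :: real
  assumes N: "is_network a N" and pm: "properly_marked N" and forest: "is_forest (marked_edges N)"
    and x: "x \<in> nodes N"
begin

abbreviation inp :: "nat \<Rightarrow> local_input" where
  "inp v \<equiv> local_input_of N x err v"

definition T :: "nat set" where "T = tree_of N x"

definition L :: "nat set set" where "L = leaving_edges N x"

definition total :: "bool list \<Rightarrow> bool list" where
  "total b = xorl.F (\<lambda>v. answer (inp v) b) T"

text \<open>The empty query yields the longest unary answer, so this is the maximal ID width in the
  tree.\<close>

definition l :: nat where "l = length (total [])"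

lemma finite_nodes: "finite (nodes N)"
  using N by (simp add: is_network_def)

lemma T_nodes: "T \<subseteq> nodes N"
  unfolding T_def by (rule tree_of_nodes[OF N x])

lemma finite_T: "finite T"
  using T_nodes finite_nodes finite_subset by blast

lemma edgeE:
  assumes "e \<in> edges N"
  obtains u v where "e = {u, v}" "u \<in> nodes N" "v \<in> nodes N" "u \<noteq> v"
  using assms N unfolding is_network_def by blast

lemma finite_edges: "finite (edges N)"
proof -
  have "edges N \<subseteq> Pow (nodes N)" by (auto elim: edgeE)
  then show ?thesis using finite_nodes finite_subset by blast
qed

lemma finite_neighbours: "finite (neighbour_ids (inp v))"
proof -
  have "neighbour_ids (inp v) \<subseteq> nodes N"
    using edge_nodes[OF N] by (auto simp: local_input_of_def)
  then show ?thesis using finite_nodes finite_subset by blast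
qed

text \<open>A marked edge has both endpoints in the tree or neither, so parity alone singles out the
  leaving edges. This is what exclusive or can detect.\<close>

lemma L_eq: "L = {e \<in> edges N. odd (card (e \<inter> T))}"
proof -
  have "card (e \<inter> T) = 1 \<longleftrightarrow> odd (card (e \<inter> T))" if "e \<in> edges N" for e
  proof -
    obtain u v where "e = {u, v}" "u \<noteq> v" using \<open>e \<in> edges N\<close> by (rule edgeE)
    then have "card (e \<inter> T) \<le> 2"
      using card_mono[of e "e \<inter> T"] by simp
    then have "card (e \<inter> T) = 0 \<or> card (e \<inter> T) = 1 \<or> card (e \<inter> T) = 2"
      by linarith
    then show ?thesis by auto
  qed
  moreover have "card (e \<inter> T) \<noteq> 1" if e: "e \<in> marked_edges N" for e
  proof -
    have "e \<in> edges N" using e by (simp add: marked_edges_def)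
    then obtain u v where uv: "e = {u, v}" "u \<noteq> v" by (rule edgeE)
    have "v \<in> T" if "u \<in> T" "{u, v} \<in> marked_edges N" for u v
      using that by (auto simp: T_def tree_of_def intro: rtrancl_into_rtrancl)
    then have "u \<in> T \<longleftrightarrow> v \<in> T" using e uv by (auto simp: insert_commute)
    then have "e \<inter> T = {} \<or> e \<inter> T = {u, v}" using uv by auto
    then show ?thesis using uv(2) by auto
  qed
  ultimately show ?thesis
    unfolding L_def leaving_edges_def T_def[symmetric] by auto
qed


lemma incident: "(\<lambda>u. {own_id (inp v), u}) ` neighbour_ids (inp v) = {e \<in> edges N. v \<in> e}"
proof (intro equalityI subsetI)
  fix e assume "e \<in> {e \<in> edges N. v \<in> e}"
  then have e: "e \<in> edges N" "v \<in> e" by auto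
  from e(1) obtain p q where "e = {p, q}" by (rule edgeE)
  with e have "\<exists>u. e = {v, u}" by auto
  with e show "e \<in> (\<lambda>u. {own_id (inp v), u}) ` neighbour_ids (inp v)"
    by (auto simp: local_input_of_def)
qed (auto simp: local_input_of_def)


lemma total_eq:
  assumes w: "\<And>v. v \<in> T \<Longrightarrow> width (inp v) b = w"
  shows "total b = map (\<lambda>j. odd (card {e \<in> L. query b j e})) [0..<w]"
proof (rule bit_list_eqI)
  have xT: "x \<in> T" by (simp add: T_def tree_of_def)
  have len: "j < length (total b) \<longleftrightarrow> j < w" for j
    unfolding total_def using xT by (subst less_length_xorl_F[OF finite_T]) (auto simp: answer_def w)
  then show "length (total b) = length (map (\<lambda>j. odd (card {e \<in> L. query b j e})) [0..<w])"
    by (metis diff_zero length_map length_upt linorder_neqE_nat less_irrefl)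
  fix j
  show "bit_at (total b) j = bit_at (map (\<lambda>j. odd (card {e \<in> L. query b j e})) [0..<w]) j"
  proof (cases "j < w")
    case False
    then show ?thesis using len by (simp add: bit_at_def)
  next
    case True
    let ?E = "{e \<in> edges N. query b j e}"
    have "bit_at (total b) j \<longleftrightarrow> odd (card {v \<in> T. odd (card {e \<in> ?E. v \<in> e})})"
      unfolding total_def bit_at_xorl_F[OF finite_T]
      by (intro arg_cong[where f = "\<lambda>A. odd (card A)"] Collect_cong conj_cong refl)
        (use True in \<open>auto simp: bit_at_def answer_def w incident conj_ac\<close>)
    \<comment> \<open>A sum has the parity of the number of its odd terms. Applied here to nodes
      and, after double counting incidences, to edges, this exchanges a parity over the tree for one
      over \<open>L\<close>.\<close>
    also have "\<dots> \<longleftrightarrow> odd (\<Sum>v\<in>T. card {e \<in> ?E. v \<in> e})"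
      by (simp only: even_sum_iff[OF finite_T])
    also have "(\<Sum>v\<in>T. card {e \<in> ?E. v \<in> e}) = (\<Sum>e\<in>?E. card {v \<in> T. v \<in> e})"
      using finite_T finite_edges by (intro sum_multicount_gen) auto
    also have "odd \<dots> \<longleftrightarrow> odd (card {e \<in> ?E. odd (card {v \<in> T. v \<in> e})})"
      using finite_edges by (simp add: even_sum_iff)
    also have "{e \<in> ?E. odd (card {v \<in> T. v \<in> e})} = {e \<in> L. query b j e}"
      by (auto simp: L_eq Int_def conj_commute)
    finally show ?thesis using True by (simp add: bit_at_def)
  qed
qed

lemma l_ge: "v \<in> T \<Longrightarrow> id_width (inp v) \<le> l"
proof (rule ccontr)
  assume v: "v \<in> T" "\<not> id_width (inp v) \<le> l"
  then have "l < length (xorl.F (\<lambda>v. answer (inp v) []) T)"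
    by (subst less_length_xorl_F[OF finite_T]) (use v in \<open>auto simp: answer_def not_le\<close>)
  then show False by (simp add: l_def total_def)
qed

lemma l_le: "(\<And>v. v \<in> T \<Longrightarrow> id_width (inp v) \<le> B) \<Longrightarrow> l \<le> B"
  unfolding l_def total_def by (rule length_xorl_F_le) (simp add: answer_def)

lemma L_ids:
  assumes "e \<in> L" "u \<in> e"
  shows "2 * u < 2 ^ l"
proof -
  have e: "e \<in> edges N" "odd (card (e \<inter> T))" using assms by (auto simp: L_eq)
  have "e \<inter> T \<noteq> {}" using e(2) by (intro notI) simp
  then obtain v where v: "v \<in> e" "v \<in> T" by auto
  then have "e \<in> (\<lambda>u. {own_id (inp v), u}) ` neighbour_ids (inp v)"
    unfolding incident using e by simp
  then have "u \<in> insert (own_id (inp v)) (neighbour_ids (inp v))" using assms(2) by auto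
  then have "2 * u < 2 ^ id_width (inp v)"
    by (rule id_width_ge[OF finite_neighbours])
  also have "\<dots> \<le> 2 ^ l" using l_ge[OF v(2)] by simp
  finally show ?thesis .
qed

lemma L_code:
  assumes "e \<in> L"
  shows "2 * code l e < 2 ^ (2 * l)" "decode (map (bit (code l e)) [0..<2 * l]) = e"
proof -
  have "e \<in> edges N" using assms by (simp add: L_eq)
  then obtain p q where pq: "e = {p, q}" "p \<noteq> q" by (rule edgeE)
  from code_less[OF pq, of l] decode_code[OF pq, of l] L_ids[OF assms]
  show "2 * code l e < 2 ^ (2 * l)" "decode (map (bit (code l e)) [0..<2 * l]) = e" by auto
qed

lemma inj_code: "inj_on (code l) L"
  by (rule inj_on_inverseI[where g = "\<lambda>n. decode (map (bit n) [0..<2 * l])"]) (rule L_code(2))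

definition candidate :: "bool list \<Rightarrow> bool list" where
  "candidate s = total (sum_query s (total (hash_query s)))"

text \<open>Good seeds are defined by success rather than by isolation, so that failure of the test
  is exactly membership in the complement.\<close>

definition G :: "bool list set" where
  "G = {s. length s = 8 * l \<and> decode (candidate s) \<in> L}"

lemma total_hash:
  "length s = 8 * l \<Longrightarrow> total (hash_query s) = map (\<lambda>j. odd (card {e \<in> L. edge_hash l s e < 2 ^ j})) [0..<4 * l]"
  by (subst total_eq[where w = "4 * l"]) (auto simp: hash_query_def)

lemma total_sum:
  assumes "length s = 8 * l" "length p = 4 * l"
  shows "total (sum_query s p) =
     map (\<lambda>j. odd (card {e \<in> L. edge_hash l s e < 2 ^ first_bit p \<and> bit (code l e) j})) [0..<2 * l]"
  using assms by (subst total_eq[where w = "2 * l"]) (auto simp: sum_query_def Let_def)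

lemma total_test: "total (test_query z) = [decode z \<in> L]"
proof -
  have "{e \<in> L. e = decode z} = (if decode z \<in> L then {decode z} else {})" by auto
  then show ?thesis
    by (subst total_eq[where w = 1]) (auto simp: test_query_def)
qed

text \<open>The level sets grow with the level, so the smallest odd level \<open>i\<close> selects a
  nonempty subset of the singleton at level \<open>j\<close>, hence the same singleton. The
  exclusive or of the codes is then the code of that edge.\<close>

lemma isolating_in_G:
  assumes s: "length s = 8 * l" and j: "j < 4 * l" "card {e \<in> L. edge_hash l s e < 2 ^ j} = 1"
  shows "s \<in> G"
proof -
  define p where "p = total (hash_query s)"
  have p: "bit_at p i \<longleftrightarrow> i < 4 * l \<and> odd (card {e \<in> L. edge_hash l s e < 2 ^ i})" for i
    by (auto simp: p_def total_hash[OF s] bit_at_def)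
  define i where "i = first_bit p"
  have pj: "bit_at p j" using j by (simp add: p)
  have i: "i \<le> j" "bit_at p i"
    unfolding i_def first_bit_def using pj by (auto intro: Least_le LeastI)
  obtain e where e: "{e \<in> L. edge_hash l s e < 2 ^ j} = {e}"
    using j(2) by (auto simp: card_1_singleton_iff)
  have "(2::nat) ^ i \<le> 2 ^ j" using i(1) by simp
  then have sub: "{e \<in> L. edge_hash l s e < 2 ^ i} \<subseteq> {e}"
    unfolding e[symmetric] by (auto intro: less_le_trans)
  have "{e \<in> L. edge_hash l s e < 2 ^ i} \<noteq> {}"
    using i(2) p[of i] by (intro notI) simp
  with sub have ei: "{e \<in> L. edge_hash l s e < 2 ^ i} = {e}" by auto
  then have eL: "e \<in> L" by auto
  have sel: "{e' \<in> L. edge_hash l s e' < 2 ^ i \<and> bit (code l e') k} = (if bit (code l e) k then {e} else {})" for k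
    using ei by auto
  have lp: "length p = 4 * l" by (simp add: p_def total_hash[OF s])
  have "candidate s = map (bit (code l e)) [0..<2 * l]"
    unfolding candidate_def p_def[symmetric] total_sum[OF s lp] i_def[symmetric] sel by simp
  then have "decode (candidate s) = e" using L_code(2)[OF eL] by simp
  then show ?thesis using s eL by (simp add: G_def)
qed

text \<open>Isolating pairs of hash parameters inject into good seeds by writing out both numbers in
  binary.\<close>

lemma card_G:
  assumes "L \<noteq> {}"
  shows "3 / 16 \<le> card G / 2 ^ (8 * l)"
proof -
  define W where "W = 4 * l"
  define X where "X = code l ` L"
  define S where "S = {(s, t) \<in> {..<(2::nat) ^ W} \<times> {..<(2::nat) ^ W}.
     \<exists>j<W. card {y \<in> X. hash W s t y < 2 ^ j} = 1}"
  define bits where "bits = (\<lambda>(s, t). map (bit (s::nat)) [0..<W] @ map (bit (t::nat)) [0..<W])"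
  have X: "X \<subseteq> {..<2 ^ (2 * l - 1)}"
  proof
    fix y assume "y \<in> X"
    then have "2 * y < 2 ^ (2 * l)" using L_code(1) by (auto simp: X_def)
    then show "y \<in> {..<2 ^ (2 * l - 1)}" by (cases "2 * l") auto
  qed
  \<comment> \<open>For \<open>l = 0\<close> all IDs on a leaving edge would be 0, but its endpoints
    differ. Without this, halving the range of codes would fail.\<close>
  have l0: "l \<noteq> 0"
  proof
    assume "l = 0"
    obtain e where "e \<in> L" using assms by auto
    with L_code(1)[of e] \<open>l = 0\<close> have "e \<in> L" "code 0 e = 0" by auto
    moreover obtain p q where "e = {p, q}" "p \<noteq> q" using \<open>e \<in> L\<close> by (auto simp: L_eq elim: edgeE)
    ultimately show False using L_ids[of e p] L_ids[of e q] \<open>l = 0\<close> by auto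
  qed
  have "card X \<le> 2 ^ (2 * l - 1)"
    using card_mono[OF _ X] by simp
  then have cX: "2 * card X \<le> 2 ^ (2 * l)"
    using l0 by (cases "2 * l") auto
  have X': "X \<subseteq> {..<2 ^ (2 * l)}" using L_code(1) by (force simp: X_def)
  have "X \<noteq> {}" using assms by (simp add: X_def)
  from card_isolating_ge[OF X' this cX]
  have S: "3 * 2 ^ (8 * l) \<le> 16 * card S" by (simp add: S_def W_def)
  have sub: "bits ` S \<subseteq> G"
  proof
    fix s assume "s \<in> bits ` S"
    then obtain u t where ut: "(u, t) \<in> S" "s = bits (u, t)" by auto
    have s: "length s = 8 * l" by (simp add: ut bits_def W_def)
    have "take W s = map (bit u) [0..<W]" "drop W s = map (bit t) [0..<W]"
      by (simp_all add: ut bits_def)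
    moreover have "u < 2 ^ W" "t < 2 ^ W" using ut by (auto simp: S_def)
    ultimately have nat: "nat_of (take W s) = u" "nat_of (drop W s) = t"
      by (simp_all add: nat_of_bits)
    obtain j where j: "j < W" "card {y \<in> X. hash W u t y < 2 ^ j} = 1" using ut by (auto simp: S_def)
    have "{y \<in> X. hash W u t y < 2 ^ j} = code l ` {e \<in> L. edge_hash l s e < 2 ^ j}"
      by (auto simp: X_def edge_hash_def W_def[symmetric] nat)
    moreover have "inj_on (code l) {e \<in> L. edge_hash l s e < 2 ^ j}"
      by (rule inj_on_subset[OF inj_code]) auto
    ultimately have "card {e \<in> L. edge_hash l s e < 2 ^ j} = 1"
      using j(2) by (simp add: card_image)
    then show "s \<in> G" using j(1) by (intro isolating_in_G[OF s]) (auto simp: W_def)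
  qed
  have inj: "inj_on bits S"
  proof (rule inj_on_inverseI[where g = "\<lambda>s. (nat_of (take W s), nat_of (drop W s))"])
    fix p assume "p \<in> S"
    then show "(nat_of (take W (bits p)), nat_of (drop W (bits p))) = p"
      by (auto simp: S_def bits_def nat_of_bits)
  qed
  have fin: "finite G"
    by (rule finite_subset[OF _ finite_lists_length_eq[of "UNIV :: bool set" "8 * l"]]) (auto simp: G_def)
  have "card S \<le> card G"
    by (rule card_inj_on_le[OF inj sub fin])
  with S have "real (3 * 2 ^ (8 * l)) \<le> real (16 * card G)"
    by (intro of_nat_mono) linarith
  then show ?thesis by (simp add: field_simps)
qed

lemma G_length: "G \<subseteq> {s. length s = 8 * l}"
  by (auto simp: G_def)

section \<open>Repeated attempts as functions of the coins\<close>

fun tries :: "nat \<Rightarrow> random_bits \<Rightarrow> nat" where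
  "tries 0 \<beta> = 0"
| "tries (Suc k) \<beta> = (if map \<beta> [0..<8 * l] \<in> G then 1 else Suc (tries k (drop_bits (8 * l) \<beta>)))"

fun result :: "nat \<Rightarrow> random_bits \<Rightarrow> nat set option" where
  "result 0 \<beta> = None"
| "result (Suc k) \<beta> =
     (if map \<beta> [0..<8 * l] \<in> G then Some (decode (candidate (map \<beta> [0..<8 * l])))
      else result k (drop_bits (8 * l) \<beta>))"

lemma result_L: "result k \<beta> = Some e \<Longrightarrow> e \<in> L"
  by (induction k arbitrary: \<beta>) (auto simp: G_def split: if_splits)

lemma result_None: "result k \<beta> = None \<longleftrightarrow> all_outside (8 * l) G k \<beta>"
  by (induction k arbitrary: \<beta>) auto

text \<open>Attempt \<open>j\<close>, counted from zero, takes place iff the \<open>j\<close>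
  attempts before it failed. This is the tail-sum form needed for the expectation.\<close>

lemma tries_eq: "tries k \<beta> = (\<Sum>j<k. of_bool (all_outside (8 * l) G j \<beta>))"
proof (induction k arbitrary: \<beta>)
  case (Suc k)
  show ?case
    unfolding sum.lessThan_Suc_shift by (simp add: Suc del: sum.lessThan_Suc)
qed simp

lemma tries_le: "tries k \<beta> \<le> k"
  by (induction k arbitrary: \<beta>) auto

definition transcripts :: "nat \<Rightarrow> random_bits \<Rightarrow> nat \<Rightarrow> bool list list" where
  "transcripts k \<beta> = transcript (\<lambda>ts. projl (plan k \<beta> ts)) (\<lambda>_. total)"

lemma transcripts_Suc: "transcripts k \<beta> (Suc r) = transcripts k \<beta> r @ [total (projl (plan k \<beta> (transcripts k \<beta> r)))]"
  by (simp add: transcripts_def)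

text \<open>The longest message is the sum query: two tag bits, \<open>8 * l\<close> seed bits and
  \<open>4 * l\<close> parities.\<close>

definition fits :: "bool list \<Rightarrow> bool" where
  "fits b \<longleftrightarrow> length b \<le> 12 * l + 2 \<and> (\<forall>v\<in>T. length (answer (inp v) b) \<le> 12 * l + 2)"

text \<open>Induction on the remaining attempts. The first one fills four transcript entries; if it
  fails, what follows is the same process on coins shifted by one block.\<close>

lemma transcripts_plan:
  "plan k \<beta> (transcripts k \<beta> (4 * tries k \<beta>)) = Inr (result k \<beta>) \<and>
     (r < 4 * tries k \<beta> \<longrightarrow> (\<exists>b. plan k \<beta> (transcripts k \<beta> r) = Inl b \<and> fits b))"
proof (induction k arbitrary: \<beta> r)
  case (Suc k)
  define s where "s = map \<beta> [0..<8 * l]"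
  define p where "p = total (hash_query s)"
  define t where "t = total (test_query (candidate s))"
  define \<beta>' where "\<beta>' = drop_bits (8 * l) \<beta>"
  have s: "length s = 8 * l" by (simp add: s_def)
  have la: "length (total []) = l" by (simp add: l_def)
  have lp: "length p = 4 * l" by (simp add: p_def total_hash[OF s])
  have lz: "length (candidate s) = 2 * l"
    unfolding candidate_def p_def[symmetric] total_sum[OF s lp] by simp
  have t: "t = [True] \<longleftrightarrow> s \<in> G" using s by (simp add: t_def total_test G_def)
  have t0: "transcripts (Suc k) \<beta> 0 = []"
    by (simp add: transcripts_def)
  have t1: "transcripts (Suc k) \<beta> (Suc 0) = [total []]"
    by (simp add: transcripts_Suc t0)
  have t2: "transcripts (Suc k) \<beta> (Suc (Suc 0)) = [total [], p]"
    by (simp add: transcripts_Suc[of _ _ "Suc 0"] t1 la p_def s_def)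
  have t3: "transcripts (Suc k) \<beta> (Suc (Suc (Suc 0))) = [total [], p, candidate s]"
    by (simp add: transcripts_Suc[of _ _ "Suc (Suc 0)"] t2 la flip: s_def) (simp add: candidate_def p_def)
  have t4: "transcripts (Suc k) \<beta> (Suc (Suc (Suc (Suc 0)))) = [total [], p, candidate s, t]"
    by (simp add: transcripts_Suc[of _ _ "Suc (Suc (Suc 0))"] t3 t_def)
  have tr: "transcripts (Suc k) \<beta> 0 = []" "transcripts (Suc k) \<beta> 1 = [total []]"
    "transcripts (Suc k) \<beta> 2 = [total [], p]" "transcripts (Suc k) \<beta> 3 = [total [], p, candidate s]"
    "transcripts (Suc k) \<beta> 4 = [total [], p, candidate s, t]"
    by (simp_all add: t0 t1 t2 t3 t4 eval_nat_numeral)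
  have fits: "fits []" "fits (hash_query s)" "fits (sum_query s p)" "fits (test_query (candidate s))"
  proof -
    have "id_width (inp v) \<le> 12 * l + 2" if "v \<in> T" for v
      using l_ge[OF that] by simp
    then show "fits []" "fits (hash_query s)" "fits (sum_query s p)" "fits (test_query (candidate s))"
      using s lp lz by (simp_all add: fits_def answer_def hash_query_def sum_query_def test_query_def)
  qed
  have first: "\<exists>b. plan (Suc k) \<beta> (transcripts (Suc k) \<beta> r) = Inl b \<and> fits b" if "r < 4"
  proof -
    have "r = 0 \<or> r = 1 \<or> r = 2 \<or> r = 3" using that by auto
    then show ?thesis using fits by (auto simp: tr t1 la simp flip: s_def)
  qed
  show "plan (Suc k) \<beta> (transcripts (Suc k) \<beta> (4 * tries (Suc k) \<beta>)) = Inr (result (Suc k) \<beta>) \<and>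
     (r < 4 * tries (Suc k) \<beta> \<longrightarrow> (\<exists>b. plan (Suc k) \<beta> (transcripts (Suc k) \<beta> r) = Inl b \<and> fits b))"
  proof (cases "s \<in> G")
    case True
    then have "tries (Suc k) \<beta> = 1" by (simp add: s_def)
    then show ?thesis using True first t by (simp add: tr flip: s_def)
  next
    case False
    then have tries: "tries (Suc k) \<beta> = Suc (tries k \<beta>')" and res: "result (Suc k) \<beta> = result k \<beta>'"
      by (simp_all add: \<beta>'_def flip: s_def)
    have plan: "plan (Suc k) \<beta> ([total [], p, candidate s, t] @ ts) = plan k \<beta>' ts" for ts
      using False t by (simp add: la \<beta>'_def)
    have tr': "transcripts (Suc k) \<beta> (4 + r) = [total [], p, candidate s, t] @ transcripts k \<beta>' r" for r
    proof (induction r)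
      case 0
      show ?case by (simp add: tr) (simp add: transcripts_def)
    next
      case (Suc r)
      show ?case
        by (simp only: add_Suc_right transcripts_Suc Suc plan) simp
    qed
    have "\<exists>b. plan (Suc k) \<beta> (transcripts (Suc k) \<beta> r) = Inl b \<and> fits b" if "r < 4 * tries (Suc k) \<beta>"
    proof (cases "r < 4")
      case False
      then obtain r' where r': "r = 4 + r'" using le_Suc_ex by (auto simp: not_less)
      then have "r' < 4 * tries k \<beta>'" using that tries by simp
      then show ?thesis using Suc.IH[of \<beta>' r'] unfolding r' tr' plan by blast
    qed (rule first)
    moreover have "4 * tries (Suc k) \<beta> = 4 + 4 * tries k \<beta>'" unfolding tries by simp
    ultimately show ?thesis using Suc.IH[of \<beta>'] by (simp only: tr' plan res) simp
  qed
qed simp_all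

end


section \<open>Correctness, cost and success probability of the search\<close>

context marked_tree
begin

definition alone :: bool where
  "alone \<longleftrightarrow> {u. {x, u} \<in> marks N x} = {}"

definition outcome_of :: "nat \<Rightarrow> random_bits \<Rightarrow> nat set option" where
  "outcome_of k \<beta> =
     (if alone then (if neighbour_ids (inp x) = {} then None else Some {x, Min (neighbour_ids (inp x))})
      else result k \<beta>)"

lemma marks_edges: "v \<in> T \<Longrightarrow> marks N v \<subseteq> edges N"
  using N T_nodes unfolding is_network_def by blast

lemma search_spec_alone:
  assumes alone and ex: "is_execution (search att) N x err \<omega> \<rho>"
  shows "messages_legal N b \<rho>" "returns (search att) N x err \<omega> \<rho> (outcome_of k (\<omega> x))" "message_count \<rho> = 0"
proof -
  have marked: "marked_neighbour_ids (inp x) = {}"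
    using assms(1) by (simp add: alone_def local_input_of_def)
  have \<rho>0: "\<rho> 0 = initial (search att) N x err \<omega>"
    using ex by (simp add: is_execution_def)
  have "act (search att) N x err \<omega> x [] 0 = []"
    by (simp add: act_def search_def echo_procedure_def marked) (simp add: local_input_of_def)
  then have sent0: "sent (\<rho> 0) = []"
    by (simp add: \<rho>0 initial_def)
  have "\<rho> i = \<rho> 0" for i
  proof (induction i)
    case (Suc i)
    then show ?case using execution_step[OF ex, of i] sent0 by (simp add: quiescent_def)
  qed simp
  then have sent: "sent (\<rho> i) = []" for i
    using sent0 by metis
  show "messages_legal N b \<rho>" "message_count \<rho> = 0"
    by (simp_all add: messages_legal_def message_count_def sent)
  have "output_at (search att) N x err \<omega> (\<rho> 0) = Some (outcome_of k (\<omega> x))"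
    using assms(1) by (simp add: output_at_def search_def echo_procedure_def marked outcome_of_def)
      (simp add: local_input_of_def)
  then show "returns (search att) N x err \<omega> \<rho> (outcome_of k (\<omega> x))"
    unfolding returns_def by (intro exI[of _ 0]) simp
qed

text \<open>The echo analysis applies with \<open>4 * tries k (\<omega> x)\<close> rounds. Each
  round costs two messages per tree node other than \<open>x\<close>, which gives the factor
  8.\<close>

lemma search_spec:
  assumes ex: "is_execution (search att) N x err \<omega> \<rho>"
  defines "k \<equiv> att (inp x)"
  shows "messages_legal N (real (12 * l + 2)) \<rho>"
    and "returns (search att) N x err \<omega> \<rho> (outcome_of k (\<omega> x))"
    and "message_count \<rho> \<le> of_nat (8 * card (nodes N) * tries k (\<omega> x))"
proof -
  have "messages_legal N (real (12 * l + 2)) \<rho> \<and> returns (search att) N x err \<omega> \<rho> (outcome_of k (\<omega> x)) \<and>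
     message_count \<rho> \<le> of_nat (8 * card (nodes N) * tries k (\<omega> x))"
  proof (cases alone)
    case True
    then show ?thesis using search_spec_alone[OF True ex] by simp
  next
    case False
    obtain par dep where tree: "rooted_tree T x (\<lambda>v. {u. {v, u} \<in> marks N v}) par dep"
      using rooted_tree_of[OF N pm forest x] by (auto simp: T_def)
    let ?strat = "\<lambda>li \<beta> ts. plan (att li) \<beta> ts"
    interpret echo_run T x "\<lambda>v. {u. {v, u} \<in> marks N v}" par dep N err \<omega> answer ?strat
        "4 * tries k (\<omega> x)" "result k (\<omega> x)"
      using tree False by (intro echo_run.intro echo_run_axioms.intro) (auto simp: alone_def)
    have ts: "ts = transcripts k (\<omega> x)"
    proof -
      have "total = (\<lambda>b. xorl.F (\<lambda>v. answer (inp v) b) T)"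
        by (rule ext) (simp add: total_def)
      then show ?thesis by (simp add: ts_def transcripts_def k_def)
    qed
    have fits: "fits (bc r)" and plan: "plan k (\<omega> x) (ts r) = Inl (bc r)" if r: "r < 4 * tries k (\<omega> x)" for r
      using transcripts_plan[of k "\<omega> x" r] r by (auto simp: bc_def ts k_def)
    have concludes: concludes
      unfolding concludes_def using plan transcripts_plan[of k "\<omega> x"] by (simp add: ts flip: k_def)
    have ex': "is_execution (echo_procedure answer ?strat) N x err \<omega> \<rho>"
      using ex by (simp add: search_def)
    have "messages_legal N (real (12 * l + 2)) \<rho>"
      by (rule execution_legal[OF concludes ex' marks_edges, of "12 * l + 2"]) (use fits in \<open>auto simp: fits_def\<close>)
    moreover have "returns (search att) N x err \<omega> \<rho> (outcome_of k (\<omega> x))"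
      using execution_returns[OF concludes ex'] False by (simp add: outcome_of_def search_def)
    moreover have "message_count \<rho> \<le> of_nat (8 * card (nodes N) * tries k (\<omega> x))"
    proof -
      have "card V \<le> card (nodes N)"
        using T_nodes finite_nodes by (intro card_mono) (auto simp: V_def)
      then have "2 * card V * (4 * tries k (\<omega> x)) \<le> 8 * card (nodes N) * tries k (\<omega> x)"
        by simp
      then have "(of_nat (2 * card V * (4 * tries k (\<omega> x))) :: ennreal) \<le> of_nat (8 * card (nodes N) * tries k (\<omega> x))"
        by (rule of_nat_mono)
      then show ?thesis using execution_message_count[OF concludes ex'] order.trans by blast
    qed
    ultimately show ?thesis by blast
  qed
  then show "messages_legal N (real (12 * l + 2)) \<rho>"
    and "returns (search att) N x err \<omega> \<rho> (outcome_of k (\<omega> x))"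
    and "message_count \<rho> \<le> of_nat (8 * card (nodes N) * tries k (\<omega> x))"
    by blast+
qed

lemma alone_T: "alone \<Longrightarrow> T = {x}"
proof -
  assume alone
  then have *: "{x, u} \<notin> marked_edges N" for u
    using marks_iff_marked_edges[OF N pm x] by (auto simp: alone_def)
  have "v = x" if "(x, v) \<in> {(u, w). {u, w} \<in> marked_edges N}\<^sup>*" for v
    using that by (cases rule: converse_rtranclE) (auto simp: *)
  then show ?thesis by (auto simp: T_def tree_of_def)
qed

lemma alone_L:
  assumes alone
  shows "L = (\<lambda>u. {x, u}) ` neighbour_ids (inp x)"
proof -
  have "e \<in> L \<longleftrightarrow> e \<in> edges N \<and> x \<in> e" for e
  proof -
    have "e \<inter> {x} = (if x \<in> e then {x} else {})" by auto
    then show ?thesis by (simp add: L_eq alone_T[OF assms])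
  qed
  then have "L = {e \<in> edges N. x \<in> e}" by auto
  also have "\<dots> = (\<lambda>u. {x, u}) ` neighbour_ids (inp x)"
    using incident[of x] by (simp add: local_input_of_def)
  finally show ?thesis .
qed

lemma outcome_L:
  assumes "outcome_of k \<beta> = Some e"
  shows "e \<in> L"
proof (cases alone)
  case True
  with assms have "neighbour_ids (inp x) \<noteq> {}" "e = {x, Min (neighbour_ids (inp x))}"
    by (auto simp: outcome_of_def split: if_splits)
  then show ?thesis
    unfolding alone_L[OF True] using Min_in[OF finite_neighbours] by blast
next
  case False
  then show ?thesis using assms result_L by (simp add: outcome_of_def)
qed

lemma outcome_empty: "L = {} \<Longrightarrow> outcome_of k \<beta> = None"
  using outcome_L by (cases "outcome_of k \<beta>") auto

lemma returns_unique:
  assumes "returns P N x err \<omega> \<rho> r" "returns P N x err \<omega> \<rho> r'"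
  shows "r = r'"
proof -
  obtain i j where i: "output_at P N x err \<omega> (\<rho> i) = Some r" "\<And>l. l < i \<Longrightarrow> output_at P N x err \<omega> (\<rho> l) = None"
    and j: "output_at P N x err \<omega> (\<rho> j) = Some r'" "\<And>l. l < j \<Longrightarrow> output_at P N x err \<omega> (\<rho> l) = None"
    using assms unfolding returns_def by blast
  have "i = j"
    using i j by (metis linorder_neqE_nat option.distinct(1))
  then show ?thesis using i j by simp
qed

lemma bad_seeds_power_le:
  assumes "L \<noteq> {}"
  shows "(1 - card G / 2 ^ (8 * l)) ^ j \<le> (13 / 16) ^ j"
proof (rule power_mono)
  show "1 - card G / 2 ^ (8 * l) \<le> 13 / 16"
    using card_G[OF assms] by simp
  have "card G \<le> 2 ^ (8 * l)"
    using card_mono[OF _ G_length] finite_lists_length_eq[of "UNIV :: bool set" "8 * l"]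
      card_lists_length_eq[of "UNIV :: bool set" "8 * l"] by simp
  then have "real (card G) \<le> real (2 ^ (8 * l))"
    by (rule of_nat_mono)
  then show "0 \<le> 1 - card G / 2 ^ (8 * l)"
    by simp
qed

text \<open>Whatever the scheduler does, the result is \<open>outcome_of k (\<omega> x)\<close>, so
  the event depends on the initiator's coins only and its probability is a count of blocks.\<close>

lemma prob_search:
  assumes L: "L \<noteq> {}" and \<sigma>: "is_scheduler (search att) N x err \<sigma>"
  shows "1 - (13/16) ^ att (inp x) \<le> return_leaving_prob (search att) N x err \<sigma>"
proof -
  interpret prob_space "coins N" by (rule prob_space_coins)
  define k where "k = att (inp x)"
  have ret: "returns (search att) N x err \<omega> (run (search att) N x err \<sigma> \<omega>) (outcome_of k (\<omega> x))"
    if "\<omega> \<in> space (coins N)" for \<omega>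
    using search_spec(2) \<sigma> that by (auto simp: is_scheduler_def k_def)
  have eq: "{\<omega> \<in> space (coins N).
       \<exists>e\<in>leaving_edges N x. returns (search att) N x err \<omega> (run (search att) N x err \<sigma> \<omega>) (Some e)}
     = {\<omega> \<in> space (coins N). outcome_of k (\<omega> x) \<noteq> None}"
  proof (intro Collect_cong conj_cong refl)
    fix \<omega> assume "\<omega> \<in> space (coins N)"
    from ret[OF this]
    show "(\<exists>e\<in>leaving_edges N x. returns (search att) N x err \<omega> (run (search att) N x err \<sigma> \<omega>) (Some e))
      \<longleftrightarrow> outcome_of k (\<omega> x) \<noteq> None"
      using returns_unique outcome_L unfolding L_def by (metis not_None_eq)
  qed
  show ?thesis
  proof (cases alone)
    case True
    then have "outcome_of k \<beta> \<noteq> None" for \<beta>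
      using L by (simp add: outcome_of_def alone_L)
    then have "return_leaving_prob (search att) N x err \<sigma> = 1"
      unfolding return_leaving_prob_def eq by (simp add: prob_space)
    then show ?thesis by simp
  next
    case False
    have "{\<omega> \<in> space (coins N). outcome_of k (\<omega> x) \<noteq> None} =
        space (coins N) - {\<omega> \<in> space (coins N). all_outside (8 * l) G k (\<omega> x)}"
      using False by (auto simp: outcome_of_def result_None simp del: not_None_eq)
    then have "return_leaving_prob (search att) N x err \<sigma> = 1 - (1 - card G / 2 ^ (8 * l)) ^ k"
      unfolding return_leaving_prob_def eq
      using prob_all_outside[OF G_length x] by (simp add: prob_compl)
    then show ?thesis
      using bad_seeds_power_le[OF L, of k] by (simp add: k_def)
  qed
qed

text \<open>Tail sums bounded by a geometric series of ratio 13/16, whose limit is 16/3.\<close>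

lemma expectation_tries:
  assumes L: "L \<noteq> {}"
  shows "(\<integral>\<^sup>+\<omega>. of_nat (tries k (\<omega> x)) \<partial>coins N) \<le> ennreal (16 / 3)"
proof -
  interpret prob_space "coins N" by (rule prob_space_coins)
  define E where "E j = {\<omega> \<in> space (coins N). all_outside (8 * l) G j (\<omega> x)}" for j
  have E: "E j \<in> sets (coins N)" for j
    unfolding E_def by (rule prob_all_outside(1)[OF G_length x])
  have mE: "emeasure (coins N) (E j) \<le> ennreal ((13 / 16) ^ j)" for j
    unfolding emeasure_eq_measure E_def prob_all_outside(2)[OF G_length x]
    by (rule ennreal_leI[OF bad_seeds_power_le[OF L]])
  have "(\<integral>\<^sup>+\<omega>. of_nat (tries k (\<omega> x)) \<partial>coins N) = (\<integral>\<^sup>+\<omega>. (\<Sum>j<k. indicator (E j) \<omega>) \<partial>coins N)"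
  proof (rule nn_integral_cong)
    fix \<omega> assume \<omega>: "\<omega> \<in> space (coins N)"
    have "(of_nat (tries k (\<omega> x)) :: ennreal) = (\<Sum>j<k. of_nat (of_bool (all_outside (8 * l) G j (\<omega> x))))"
      unfolding tries_eq by simp
    also have "\<dots> = (\<Sum>j<k. indicator (E j) \<omega>)"
      using \<omega> by (intro sum.cong refl) (simp add: E_def indicator_def)
    finally show "of_nat (tries k (\<omega> x)) = (\<Sum>j<k. indicator (E j) \<omega> :: ennreal)" .
  qed
  also have "\<dots> = (\<Sum>j<k. emeasure (coins N) (E j))"
    using E by (subst nn_integral_sum) auto
  also have "\<dots> \<le> (\<Sum>j<k. ennreal ((13 / 16) ^ j))"
    by (intro sum_mono mE)
  also have "\<dots> = ennreal (\<Sum>j<k. (13 / 16) ^ j)"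
    by (rule sum_ennreal) simp
  also have "\<dots> \<le> ennreal (16 / 3)"
  proof (rule ennreal_leI)
    have "(\<Sum>j<k. (13 / 16 :: real) ^ j) = (1 - (13 / 16) ^ k) / (3 / 16)"
      by (simp add: sum_gp_strict)
    also have "\<dots> \<le> 1 / (3 / 16)"
      by (intro divide_right_mono) auto
    finally show "(\<Sum>j<k. (13 / 16 :: real) ^ j) \<le> 16 / 3" by simp
  qed
  finally show ?thesis .
qed

lemma search_sends_measurable:
  "(\<lambda>\<omega>. sends (search att) (inp v) (\<omega> v) h) \<in> measurable (coins N) (count_space UNIV)"
  unfolding search_def by (rule sends_measurable[OF plan_measurable x])

text \<open>At most 8 messages per node and attempt, times 16/3 attempts, is 128/3, which is below
  43.\<close>

lemma expectation_search:
  assumes L: "L \<noteq> {}" and \<sigma>: "is_scheduler (search att) N x err \<sigma>" and K: "43 \<le> K"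
  shows "expectation_le N (\<lambda>\<omega>. running_time (run (search att) N x err \<sigma> \<omega>)) (K * real (card (nodes N)))"
    and "expectation_le N (\<lambda>\<omega>. message_count (run (search att) N x err \<sigma> \<omega>)) (K * real (card (nodes N)))"
proof -
  define n where "n = card (nodes N)"
  define k where "k = att (inp x)"
  have ex: "is_execution (search att) N x err \<omega> (run (search att) N x err \<sigma> \<omega>)" if "\<omega> \<in> space (coins N)" for \<omega>
    using \<sigma> that by (simp add: is_scheduler_def)
  have meas: "(\<lambda>\<omega>. running_time (run (search att) N x err \<sigma> \<omega>)) \<in> borel_measurable (coins N)"
    "(\<lambda>\<omega>. message_count (run (search att) N x err \<sigma> \<omega>)) \<in> borel_measurable (coins N)"
    unfolding running_time_def message_count_def by (intro run_measurable search_sends_measurable)+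
  have tries_meas: "(\<lambda>\<omega>. of_nat (tries k (\<omega> x)) :: ennreal) \<in> borel_measurable (coins N)"
  proof -
    have "(\<lambda>\<omega>. \<Sum>j<k. indicator {\<omega> \<in> space (coins N). all_outside (8 * l) G j (\<omega> x)} \<omega> :: ennreal)
        \<in> borel_measurable (coins N)"
      using prob_all_outside(1)[OF G_length x] by (intro borel_measurable_sum borel_measurable_indicator) auto
    then show ?thesis
      by (rule measurable_cong[THEN iffD1, rotated]) (auto simp: tries_eq indicator_def intro!: sum.cong)
  qed
  have msg: "(\<integral>\<^sup>+\<omega>. message_count (run (search att) N x err \<sigma> \<omega>) \<partial>coins N) \<le> ennreal (K * real n)"
  proof -
    have "(\<integral>\<^sup>+\<omega>. message_count (run (search att) N x err \<sigma> \<omega>) \<partial>coins N) \<le>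
        (\<integral>\<^sup>+\<omega>. of_nat (8 * n) * of_nat (tries k (\<omega> x)) \<partial>coins N)"
    proof (rule nn_integral_mono)
      fix \<omega> assume "\<omega> \<in> space (coins N)"
      from search_spec(3)[OF ex[OF this]]
      show "message_count (run (search att) N x err \<sigma> \<omega>) \<le> of_nat (8 * n) * of_nat (tries k (\<omega> x))"
        by (simp add: n_def k_def)
    qed
    also have "\<dots> = of_nat (8 * n) * (\<integral>\<^sup>+\<omega>. of_nat (tries k (\<omega> x)) \<partial>coins N)"
      by (rule nn_integral_cmult[OF tries_meas])
    also have "\<dots> \<le> of_nat (8 * n) * ennreal (16 / 3)"
      by (intro mult_left_mono expectation_tries[OF L]) simp
    also have "\<dots> = ennreal (real (8 * n) * (16 / 3))"
      unfolding ennreal_of_nat_eq_real_of_nat by (rule ennreal_mult[symmetric]) simp_all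
    also have "\<dots> \<le> ennreal (K * real n)"
    proof (rule ennreal_leI)
      have "real (8 * n) * (16 / 3) \<le> 43 * real n" by simp
      also have "\<dots> \<le> K * real n" using K by (intro mult_right_mono) auto
      finally show "real (8 * n) * (16 / 3) \<le> K * real n" .
    qed
    finally show ?thesis .
  qed
  have "(\<integral>\<^sup>+\<omega>. running_time (run (search att) N x err \<sigma> \<omega>) \<partial>coins N) \<le>
      (\<integral>\<^sup>+\<omega>. message_count (run (search att) N x err \<sigma> \<omega>) \<partial>coins N)"
    by (intro nn_integral_mono running_time_le_message_count[OF ex])
  with msg meas
  show "expectation_le N (\<lambda>\<omega>. running_time (run (search att) N x err \<sigma> \<omega>)) (K * real (card (nodes N)))"
    and "expectation_le N (\<lambda>\<omega>. message_count (run (search att) N x err \<sigma> \<omega>)) (K * real (card (nodes N)))"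
    unfolding expectation_le_def n_def by auto
qed

lemma l_bound: "real l \<le> a * log 2 (real (card (nodes N))) + 3"
proof -
  define n where "n = card (nodes N)"
  have n: "0 < n" using x finite_nodes by (auto simp: n_def card_gt_0_iff)
  have "id_width (inp v) \<le> nat \<lfloor>a * log 2 (real n) + 2\<rfloor>" if "v \<in> T" for v
  proof -
    have "real (id_width (inp v)) \<le> a * log 2 (real n) + 2"
    proof (rule id_width_le[OF finite_neighbours])
      fix u assume "u \<in> insert (own_id (inp v)) (neighbour_ids (inp v))"
      then have "u \<in> nodes N"
        using that T_nodes edge_nodes[OF N] by (auto simp: local_input_of_def)
      then have u: "1 \<le> u" "real u \<le> real n powr a"
        using N by (auto simp: is_network_def network_size_def n_def)
      then have "log 2 (real u) \<le> log 2 (real n powr a)"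
        using n by (subst log_le_cancel_iff) auto
      also have "\<dots> = a * log 2 (real n)"
        using n by (subst log_powr) auto
      finally show "1 \<le> u \<and> log 2 (real u) \<le> a * log 2 (real n)" using u by simp
    qed
    then show ?thesis by linarith
  qed
  then have "l \<le> nat \<lfloor>a * log 2 (real n) + 2\<rfloor>" by (rule l_le)
  \<comment> \<open>Nonnegativity is needed because \<open>nat\<close> truncates; it holds since the
    ID of \<open>x\<close> lies between 1 and the ID bound.\<close>
  moreover have "0 \<le> a * log 2 (real n)"
  proof -
    have "1 \<le> real x" "real x \<le> real n powr a"
      using N x by (auto simp: is_network_def network_size_def n_def)
    then have "log 2 1 \<le> log 2 (real n powr a)"
      using n by (subst log_le_cancel_iff) auto
    then show ?thesis using n by (simp add: log_powr)
  qed
  ultimately show ?thesis by (simp add: n_def) linarith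
qed

lemma search_legal:
  assumes ex: "is_execution (search att) N x err \<omega> \<rho>" and K: "12 * \<bar>a\<bar> + 43 \<le> K"
  shows "messages_legal N (K * log 2 (real (card (nodes N)))) \<rho>"
  unfolding messages_legal_def
proof (intro allI ballI)
  fix i m assume m: "m \<in> set (sent (\<rho> i))"
  define n where "n = card (nodes N)"
  have 1: "{source m, target m} \<in> edges N" "real (length (content m)) \<le> real (12 * l + 2)"
    using search_spec(1)[OF ex] m by (auto simp: messages_legal_def)
  have "card {source m, target m} \<le> n"
    unfolding n_def using edge_nodes[OF N 1(1)] finite_nodes by (intro card_mono) auto
  \<comment> \<open>Any message needs an edge and so two nodes. The logarithm is therefore at least
    1 and absorbs the additive constant \<open>12 * 3 + 2 = 38\<close>.\<close>
  then have n: "2 \<le> n"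
    using edge_nodes(3)[OF N 1(1)] by simp
  then have log: "1 \<le> log 2 (real n)"
    by (subst le_log_iff) auto
  have "real (12 * l + 2) \<le> 12 * (a * log 2 (real n)) + 38"
    using l_bound by (simp add: n_def)
  also have "\<dots> \<le> 12 * (\<bar>a\<bar> * log 2 (real n)) + 43 * log 2 (real n)"
    using log by (intro add_mono mult_left_mono mult_right_mono) auto
  also have "\<dots> = (12 * \<bar>a\<bar> + 43) * log 2 (real n)"
    by (simp add: algebra_simps)
  also have "\<dots> \<le> K * log 2 (real n)"
    using K log by (intro mult_right_mono) auto
  finally show "{source m, target m} \<in> edges N \<and>
      real (length (content m)) \<le> K * log 2 (real (card (nodes N)))"
    using 1 by (simp add: n_def)
qed

end

text \<open>The network size is unknown to the initiator, so the number of attempts is derived from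
  its error parameter and the failure bound 13/16.\<close>

definition find_any :: procedure where
  "find_any = search (\<lambda>li. LEAST k. (13/16) ^ k \<le> the (known_error li))"

definition find_any_C :: procedure where
  "find_any_C = search (\<lambda>_. 1)"

theorem lemma5:
  fixes a c :: real
  shows "\<exists>FindAny FindAnyC :: procedure. \<forall>\<epsilon> :: nat \<Rightarrow> real.
    (\<forall>n\<ge>1. 0 < \<epsilon> n \<and> \<epsilon> n < 1 / (2 * real n powr c)) \<and>
    (\<exists>d :: nat. (\<lambda>n. inverse (\<epsilon> n)) \<in> O(\<lambda>n. real n ^ d)) \<longrightarrow>
    (\<exists>K :: real. \<forall>N x n.
      is_network a N \<and> properly_marked N \<and> is_forest (marked_edges N) \<and>
      x \<in> nodes N \<and> n = network_size N \<longrightarrow>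
      (\<forall>P\<in>{FindAny, FindAnyC}. \<forall>\<omega>\<in>space (coins N). \<forall>\<rho>. is_execution P N x (\<epsilon> n) \<omega> \<rho> \<longrightarrow>
         messages_legal N (K * log 2 (real n)) \<rho> \<and>
         (leaving_edges N x = {} \<longrightarrow> returns P N x (\<epsilon> n) \<omega> \<rho> None)) \<and>
      (leaving_edges N x \<noteq> {} \<longrightarrow>
         (\<forall>\<sigma>. is_scheduler FindAny N x (\<epsilon> n) \<sigma> \<longrightarrow>
            return_leaving_prob FindAny N x (\<epsilon> n) \<sigma> \<ge> 1 - real n powr (- c) \<and>
            expectation_le N (\<lambda>\<omega>. running_time (run FindAny N x (\<epsilon> n) \<sigma> \<omega>)) (K * real n) \<and>
            expectation_le N (\<lambda>\<omega>. message_count (run FindAny N x (\<epsilon> n) \<sigma> \<omega>)) (K * real n)) \<and>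
         (\<forall>\<sigma>. is_scheduler FindAnyC N x (\<epsilon> n) \<sigma> \<longrightarrow>
            return_leaving_prob FindAnyC N x (\<epsilon> n) \<sigma> \<ge> 1 / 16) \<and>
         (\<forall>\<omega>\<in>space (coins N). \<forall>\<rho>. is_execution FindAnyC N x (\<epsilon> n) \<omega> \<rho> \<longrightarrow>
            ((\<exists>e\<in>leaving_edges N x. returns FindAnyC N x (\<epsilon> n) \<omega> \<rho> (Some e)) \<or>
             returns FindAnyC N x (\<epsilon> n) \<omega> \<rho> None) \<and>
            running_time \<rho> \<le> ennreal (K * real n) \<and>
            message_count \<rho> \<le> ennreal (K * real n))))"
proof -
  define K where "K = 12 * \<bar>a\<bar> + 43"
  have K: "12 * \<bar>a\<bar> + 43 \<le> K" "43 \<le> K" by (simp_all add: K_def)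
  show ?thesis
  proof (rule exI[of _ find_any], rule exI[of _ find_any_C], intro allI impI, elim conjE,
      rule exI[of _ K], intro allI impI, elim conjE, intro conjI ballI allI impI)
    fix \<epsilon> :: "nat \<Rightarrow> real" and N x n
    assume \<epsilon>: "\<forall>n\<ge>1. 0 < \<epsilon> n \<and> \<epsilon> n < 1 / (2 * real n powr c)"
      and net: "is_network a N" "properly_marked N" "is_forest (marked_edges N)" "x \<in> nodes N"
      and n: "n = network_size N"
    interpret marked_tree a N x "\<epsilon> n"
      by (rule marked_tree.intro) (use net in auto)
    have n_card: "n = card (nodes N)" by (simp add: n network_size_def)
    have n1: "1 \<le> n"
      using net(4) finite_nodes by (auto simp: n_card Suc_le_eq card_gt_0_iff)
    define att :: "local_input \<Rightarrow> nat" where "att = (\<lambda>li. LEAST k. (13/16) ^ k \<le> the (known_error li))"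
    have fa: "find_any = search att" by (simp add: find_any_def att_def)
    {
      fix P \<omega> \<rho> assume P: "P \<in> {find_any, find_any_C}" and ex: "is_execution P N x (\<epsilon> n) \<omega> \<rho>"
      obtain att where att: "P = search att" using P by (auto simp: fa find_any_C_def)
      show "messages_legal N (K * log 2 (real n)) \<rho>"
        by (rule search_legal[OF ex[unfolded att] K(1), folded n_card])
      show "returns P N x (\<epsilon> n) \<omega> \<rho> None" if "leaving_edges N x = {}"
        using search_spec(2)[OF ex[unfolded att]] outcome_empty[unfolded L_def, OF that] by (simp add: att)
    }
    {
      fix \<sigma> assume L: "leaving_edges N x \<noteq> {}" and \<sigma>: "is_scheduler find_any N x (\<epsilon> n) \<sigma>"
      have \<epsilon>n: "0 < \<epsilon> n" "\<epsilon> n < 1 / (2 * real n powr c)" using \<epsilon> n1 by auto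
      \<comment> \<open>Positivity of the error parameter makes the \<open>LEAST\<close> in the
        number of attempts meaningful.\<close>
      have "\<exists>k. (13/16 :: real) ^ k \<le> \<epsilon> n"
        using real_arch_pow_inv[OF \<epsilon>n(1), of "13/16"] by (auto intro: less_imp_le)
      then have "(13/16 :: real) ^ att (inp x) \<le> \<epsilon> n"
        unfolding att_def by (simp add: local_input_of_def) (rule LeastI_ex)
      also have "\<dots> \<le> 1 / (2 * real n powr c)" using \<epsilon>n(2) by simp
      also have "\<dots> \<le> real n powr (- c)"
        using n1 by (simp add: powr_minus_divide field_simps)
      finally show "1 - real n powr (- c) \<le> return_leaving_prob find_any N x (\<epsilon> n) \<sigma>"
        using prob_search[unfolded L_def, OF L \<sigma>[unfolded fa]] by (simp add: fa)
      show "expectation_le N (\<lambda>\<omega>. running_time (run find_any N x (\<epsilon> n) \<sigma> \<omega>)) (K * real n)"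
        and "expectation_le N (\<lambda>\<omega>. message_count (run find_any N x (\<epsilon> n) \<sigma> \<omega>)) (K * real n)"
        using expectation_search[unfolded L_def, OF L \<sigma>[unfolded fa] K(2)] unfolding fa n_card by blast+
    }
    show "1 / 16 \<le> return_leaving_prob find_any_C N x (\<epsilon> n) \<sigma>"
      if "leaving_edges N x \<noteq> {}" "is_scheduler find_any_C N x (\<epsilon> n) \<sigma>" for \<sigma>
      using prob_search[unfolded L_def, OF that[unfolded find_any_C_def]] by (simp add: find_any_C_def)
    {
      fix \<omega> \<rho> assume ex: "is_execution find_any_C N x (\<epsilon> n) \<omega> \<rho>"
      note spec = search_spec[OF ex[unfolded find_any_C_def]]
      have "returns find_any_C N x (\<epsilon> n) \<omega> \<rho> (outcome_of 1 (\<omega> x))"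
        using spec(2) by (simp add: find_any_C_def)
      then show "(\<exists>e\<in>leaving_edges N x. returns find_any_C N x (\<epsilon> n) \<omega> \<rho> (Some e)) \<or>
          returns find_any_C N x (\<epsilon> n) \<omega> \<rho> None"
        using outcome_L[of 1 "\<omega> x"] unfolding L_def by (cases "outcome_of 1 (\<omega> x)") auto
      \<comment> \<open>A single attempt gives a bound of \<open>8 * n\<close> messages for all
        coins and schedules, which is why it holds in the worst case.\<close>
      have "8 * card (nodes N) * tries 1 (\<omega> x) \<le> 8 * n"
        using tries_le[of 1 "\<omega> x"] by (simp add: n_card)
      then have "(of_nat (8 * card (nodes N) * tries 1 (\<omega> x)) :: ennreal) \<le> of_nat (8 * n)"
        by (rule of_nat_mono)
      then have "message_count \<rho> \<le> of_nat (8 * n)"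
        using spec(3) order.trans by blast
      also have "\<dots> = ennreal (8 * real n)"
        unfolding ennreal_of_nat_eq_real_of_nat by simp
      also have "\<dots> \<le> ennreal (K * real n)"
        using K(2) by (intro ennreal_leI mult_right_mono) auto
      finally show "message_count \<rho> \<le> ennreal (K * real n)" .
      with running_time_le_message_count[OF ex] show "running_time \<rho> \<le> ennreal (K * real n)"
        by (rule order.trans)
    }
  qed
qed

end
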